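(* Let $A$ be a Douglas algebra, $H^\infty \subset A \subset L^\infty$, which is invariant under composition from the inside with automorphisms of the unit disk, i.e. $f\circ\phi\in A$ for every $f\in A$ and every automorphism $\phi$ of $\mathbb{D}$. Then the following conditions are equivalent: (1) $A\neq H^\infty$; (2) $A$ is $\omega^*$-convex-transitive; (3) $A$ is $\omega^*$-convex-transitive with respect to the subgroup of $\mathcal{G}_A$ consisting of the weighted composition operators $f\mapsto \psi\cdot (f\circ\phi)$ (which are isometric isomorphisms of $A$ onto $A$), where $\psi\in A$ satisfies $|\psi|=1$ a.e. on $\partial\mathbb{D}$ and $\phi$ is an automorphism of $\mathbb{D}$.
   Context: All Banach spaces are complex. $\mathbb{D}$ is the open unit disk and $\partial\mathbb{D}$ its boundary with Lebesgue measure $m$; $L^\infty=L^\infty(\partial\mathbb{D},m)$ and $L^1=L^1(\partial\mathbb{D},m)$. $H^\infty$ is the algebra of bounded analytic functions on $\mathbb{D}$ with the supremum norm, identified isometrically with a closed subalgebra of $L^\infty$ via radial boundary values. An inner function is an $f\in H^\infty$ whose boundary function has modulus $1$ a.e. A Douglas algebra is a norm-closed subalgebra of $L^\infty$ of the form $[H^\infty,\overline{Q}]$, the closed algebra generated by $H^\infty$ and the complex conjugates of the boundary functions of the elements of some set $Q$ of inner functions (equivalently, by the Chang–Marshall theorem, any closed algebra between $H^\infty$ and $L^\infty$). An automorphism of $\mathbb{D}$ is a Möbius transformation $\phi$ of $\mathbb{D}$ onto itself; it extends to a bilipschitz homeomorphism of $\partial\mathbb{D}$ onto itself, so $f\circ\phi$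 makes sense for $f\in L^\infty$. For a Banach space $X$, $B_X$ is the closed unit ball, $S_X$ the unit sphere, and $\mathcal{G}_X$ the group of all linear isometric isomorphisms of $X$ onto $X$. On $A\subset L^\infty$, $\omega^*$ denotes the topology $\sigma(A,L^1)$, i.e. the relative topology on $A$ inherited from the weak-star topology of $L^\infty=(L^1)^*$. For a subgroup $G\subset\mathcal{G}_A$, $A$ is $\omega^*$-convex-transitive with respect to $G$ if $\overline{\mathrm{conv}}^{\,\omega^*}\{T(x): T\in G\}=B_A$ for every $x\in S_A$ (closure taken in $A$); $A$ is $\omega^*$-convex-transitive if this holds with $G=\mathcal{G}_A$.
   Formalization: In (3) only those operators f ↦ ψ·(f∘φ) that map A onto A are taken; the parenthetical claim that all of them are isometric isomorphisms onto A fails, e.g. for A = H^∞, φ the identity and ψ(z) = z. *)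

theory Defs
  imports "HOL-Analysis.Analysis" "HOL-Probability.Essential_Supremum"
begin

section \<open>Arc length on the unit circle\<close>

definition circle_measure :: "complex measure" where
  "circle_measure =
     distr (restrict_space lborel {0..<2 * pi}) (restrict_space borel (sphere 0 1)) cis"

lemma space_circle_measure [simp]: "space circle_measure = sphere 0 1"
  by (simp add: circle_measure_def space_restrict_space)

lemma sets_circle_measure [simp, measurable_cong]:
  "sets circle_measure = sets (restrict_space borel (sphere 0 1))"
  by (simp add: circle_measure_def)

lemma measurable_cis_circle:
  "cis \<in> measurable (restrict_space lborel {0..<2 * pi}) (restrict_space borel (sphere 0 1))"
proof (rule measurable_restrict_space2)
  have "cis \<in> borel_measurable borel"
    by (intro borel_measurable_continuous_onI continuous_intros)
  then show "cis \<in> borel_measurable (restrict_space lborel {0..<2 * pi})"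
    by (simp add: measurable_restrict_space1)
qed simp

lemma emeasure_circle_measure:
  assumes "X \<in> sets circle_measure"
  shows "emeasure circle_measure X = emeasure lborel {t \<in> {0..<2 * pi}. cis t \<in> X}"
proof -
  have "emeasure circle_measure X =
      emeasure (restrict_space lborel {0..<2 * pi}) {t \<in> {0..<2 * pi}. cis t \<in> X}"
    using assms unfolding circle_measure_def
    by (subst emeasure_distr[OF measurable_cis_circle])
       (auto simp: space_restrict_space intro!: arg_cong2[where f=emeasure])
  then show ?thesis
    by (subst (asm) emeasure_restrict_space) auto
qed

lemma emeasure_circle_measure_space:
  "emeasure circle_measure (sphere 0 1) = ennreal (2 * pi)"
proof -
  have "sphere 0 1 \<in> sets circle_measure"
    using sets.top[of circle_measure] by simp
  moreover have "{t \<in> {0..<2 * pi}. cis t \<in> sphere 0 1} = {0..<2 * pi}"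
    by auto
  ultimately show ?thesis
    by (simp only: emeasure_circle_measure) simp
qed

lemma circle_null_sets_iff:
  assumes "X \<in> sets circle_measure"
  shows "X \<in> null_sets circle_measure \<longleftrightarrow> negligible {t \<in> {0..<2 * pi}. cis t \<in> X}"
proof -
  have "cis -` X \<inter> space (restrict_space lborel {0..<2 * pi})
      \<in> sets (restrict_space lborel {0..<2 * pi})"
    using measurable_sets[OF measurable_cis_circle] assms by simp
  moreover have "cis -` X \<inter> space (restrict_space lborel {0..<2 * pi}) =
      {t \<in> {0..<2 * pi}. cis t \<in> X}"
    by (auto simp: space_restrict_space)
  ultimately have "{t \<in> {0..<2 * pi}. cis t \<in> X} \<in> sets lborel"
    by (simp add: sets_restrict_space_iff)
  then show ?thesis
    using assms by (simp add: emeasure_circle_measure null_sets_def negligible_iff_emeasure0)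
qed

section \<open>Automorphisms of the disc\<close>

text \<open>The same formula gives the extension of a disc automorphism to the circle; the
  denominator does not vanish on the closed disc (see \<open>disc_automorphism_cball\<close> below).\<close>

definition disc_automorphism :: "(complex \<Rightarrow> complex) \<Rightarrow> bool" where
  "disc_automorphism \<phi> \<longleftrightarrow>
     (\<exists>a b c d. a * d - b * c \<noteq> 0 \<and> \<phi> = (\<lambda>z. (a * z + b) / (c * z + d))) \<and>
     \<phi> ` ball 0 1 = ball 0 1"

lemma disc_automorphism_cball:
  fixes a b c d :: complex
  assumes nz: "a * d - b * c \<noteq> 0"
    and im: "(\<lambda>z. (a * z + b) / (c * z + d)) ` ball 0 1 = ball 0 1"
    and z: "z \<in> cball 0 1"
  shows "c * z + d \<noteq> 0"
proof
  assume 0: "c * z + d = 0"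
  have anz: "a * z + b \<noteq> 0"
  proof
    assume "a * z + b = 0"
    then have "b = - a * z" "d = - c * z" using 0 by (simp_all add: eq_neg_iff_add_eq_0 add.commute)
    then show False using nz by simp
  qed
  let ?r = "\<lambda>n. of_real (1 - 1 / real (n + 2)) * (z::complex) + of_real (if z = 0 then 1 / real (n + 2) else 0)"
  define w where "w = ?r"
  have w_lim: "w \<longlonglongrightarrow> z"
  proof -
    have 1: "(\<lambda>n. 1 / real (n + 2)) \<longlonglongrightarrow> 0"
      by (intro LIMSEQ_ignore_initial_segment lim_1_over_n)
    have "(\<lambda>n. of_real (1 - 1 / real (n + 2)) * (z::complex) + of_real (if z = 0 then 1 / real (n + 2) else 0))
      \<longlonglongrightarrow> of_real (1 - 0) * z + of_real 0"
      by (intro tendsto_intros 1, cases "z = 0") (use 1 in \<open>simp_all add: add.commute\<close>)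
    then show ?thesis by (simp add: w_def)
  qed
  have w_ball: "w n \<in> ball 0 1" for n
  proof (cases "z = 0")
    case False
    have "cmod (w n) = (1 - 1 / real (n + 2)) * cmod z"
      using False by (simp add: w_def norm_mult del: of_real_diff of_real_divide)
    also have "\<dots> \<le> 1 - 1 / real (n + 2)"
      using z by (intro mult_left_le) auto
    also have "\<dots> < 1" by simp
    finally show ?thesis by simp
  next
    case True
    then have "w n = of_real (1 / real (n + 2))" by (simp add: w_def)
    then have "cmod (w n) = 1 / real (n + 2)" by (simp del: of_real_divide)
    also have "\<dots> < 1" by simp
    finally show ?thesis by simp
  qed
  have w_ne: "w n \<noteq> z" for n
  proof (cases "z = 0")
    case True
    then have "w n = of_real (1 / real (n + 2))" by (simp add: w_def)
    moreover have "1 / real (n + 2) \<noteq> 0" by simp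
    ultimately show ?thesis using True by (metis of_real_eq_0_iff)
  next
    case False
    have "w n - z = - of_real (1 / real (n + 2)) * z"
      using False by (simp add: w_def algebra_simps)
    moreover have "- of_real (1 / real (n + 2)) * z \<noteq> 0"
      using False by (simp del: of_real_divide)
    ultimately show ?thesis by (metis right_minus_eq)
  qed
  have c: "c \<noteq> 0" using 0 nz by auto
  have den: "c * w n + d \<noteq> 0" for n
  proof
    assume "c * w n + d = 0"
    then have "c * w n = c * z" using 0 by (metis add_right_cancel)
    then show False using c w_ne[of n] by simp
  qed
  have le: "cmod (a * w n + b) \<le> cmod (c * w n + d)" for n
  proof -
    have "(a * w n + b) / (c * w n + d) \<in> ball 0 1"
      using im w_ball[of n] by blast
    then have "cmod (a * w n + b) / cmod (c * w n + d) < 1"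
      by (simp add: norm_divide)
    then show ?thesis using den[of n] by (simp add: divide_less_eq)
  qed
  have "cmod (a * z + b) \<le> cmod (c * z + d)"
    by (rule LIMSEQ_le[of "\<lambda>n. cmod (a * w n + b)" _ "\<lambda>n. cmod (c * w n + d)"])
       (intro tendsto_intros w_lim, intro tendsto_intros w_lim, use le in auto)
  with 0 anz show False by simp
qed

lemma disc_automorphism_sphere:
  fixes a b c d :: complex
  assumes nz: "a * d - b * c \<noteq> 0"
    and im: "(\<lambda>z. (a * z + b) / (c * z + d)) ` ball 0 1 = ball 0 1"
    and z: "z \<in> sphere 0 1"
  shows "(a * z + b) / (c * z + d) \<in> sphere 0 1"
proof -
  let ?f = "\<lambda>z. (a * z + b) / (c * z + d)"
  have den: "c * z + d \<noteq> 0" if "z \<in> cball 0 1" for z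
    using disc_automorphism_cball[OF nz im that] .
  have cont: "continuous_on (cball 0 1) ?f"
    by (intro continuous_intros) (use den in auto)
  have "?f ` closure (ball 0 1) \<subseteq> closure (?f ` ball 0 1)"
    by (rule image_closure_subset) (use cont in simp, simp, rule closure_subset)
  then have "?f ` cball 0 1 \<subseteq> cball 0 1" using im by simp
  moreover have "?f z \<in> ?f ` cball 0 1" by (rule imageI) (use z in simp)
  ultimately have "?f z \<in> cball 0 1" by blast
  moreover have "?f z \<notin> ball 0 1"
  proof
    assume "?f z \<in> ball 0 1"
    then obtain w where w: "w \<in> ball 0 1" "?f z = ?f w" using im by (metis (no_types, lifting) imageE)
    have dz: "c * z + d \<noteq> 0" "c * w + d \<noteq> 0" using den z w by auto
    then have "(a * z + b) * (c * w + d) = (a * w + b) * (c * z + d)"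
      using w(2) by (simp add: frac_eq_eq)
    then have "(a * d - b * c) * (z - w) = 0" by (simp add: algebra_simps)
    then show False using nz w z by auto
  qed
  ultimately show ?thesis by auto
qed

lemma circle_arg:
  assumes "z \<in> sphere 0 1"
  shows "Arg2pi z \<in> {0..<2 * pi}" "cis (Arg2pi z) = z"
  using Arg2pi_ge_0[of z] Arg2pi_lt_2pi[of z] complex_norm_eq_1_exp[of z] assms
  by (auto simp: cis_conv_exp)

lemma disc_automorphism_measurable_nonsingular:
  assumes "disc_automorphism \<phi>"
  shows "\<phi> \<in> measurable circle_measure circle_measure"
    and "N \<in> null_sets circle_measure \<Longrightarrow> \<phi> -` N \<inter> space circle_measure \<in> null_sets circle_measure"
proof -
  obtain a b c d where nz: "a * d - b * c \<noteq> 0" and phi: "\<phi> = (\<lambda>z. (a * z + b) / (c * z + d))"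
    and im: "\<phi> ` ball 0 1 = ball 0 1"
    using assms unfolding disc_automorphism_def by blast
  note im' = im[unfolded phi]
  have den: "c * z + d \<noteq> 0" if "z \<in> sphere 0 1" for z
    using disc_automorphism_cball[OF nz im'] that by auto
  have sph: "\<phi> z \<in> sphere 0 1" if "z \<in> sphere 0 1" for z
    using disc_automorphism_sphere[OF nz im' that] by (simp add: phi)
  have "\<phi> \<in> borel_measurable borel"
    unfolding phi by measurable
  then have "\<phi> \<in> measurable (restrict_space borel (sphere 0 1)) (restrict_space borel (sphere 0 1))"
    by (intro measurable_restrict_space2 measurable_restrict_space1)
       (use sph in \<open>auto simp: space_restrict_space\<close>)
  then show meas: "\<phi> \<in> measurable circle_measure circle_measure"
    by (simp cong: measurable_cong_sets)
  assume N: "N \<in> null_sets circle_measure"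
  define h where "h w = (d * w - b) / (a - c * w)" for w
  have hden: "a - c * \<phi> z \<noteq> 0" and h: "h (\<phi> z) = z" if "z \<in> sphere 0 1" for z
  proof -
    have e: "a - c * \<phi> z = (a * d - b * c) / (c * z + d)"
      using den[OF that] by (simp add: phi field_simps)
    then show "a - c * \<phi> z \<noteq> 0" using nz den[OF that] by simp
    have "d * \<phi> z - b = z * ((a * d - b * c) / (c * z + d))"
      using den[OF that] by (simp add: phi field_simps)
    then show "h (\<phi> z) = z" unfolding h_def e using nz den[OF that] by simp
  qed
  define S where "S = {s \<in> {0..<2 * pi}. cis s \<in> N \<and> a - c * cis s \<noteq> 0 \<and> - h (cis s) \<notin> \<real>\<^sub>\<le>\<^sub>0}"
  define k where "k s = Im (Ln (- h (cis s))) + pi" for s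
  have "negligible {s \<in> {0..<2 * pi}. cis s \<in> N}"
    using N circle_null_sets_iff[of N] by (simp only: null_setsD2)
  then have negS: "negligible S"
    by (rule negligible_subset) (auto simp: S_def)
  have kdiff: "k differentiable_on S"
  proof -
    have "k differentiable (at s)" if "s \<in> S" for s
    proof -
      have s: "a - c * cis s \<noteq> 0" "- h (cis s) \<notin> \<real>\<^sub>\<le>\<^sub>0" using that by (auto simp: S_def)
      have "((\<lambda>w. Ln (- h w)) has_field_derivative deriv (\<lambda>w. Ln (- h w)) (cis s)) (at (cis s))"
      proof (rule DERIV_deriv_iff_field_differentiable[THEN iffD2])
        have "h field_differentiable (at (cis s))"
          unfolding h_def by (intro derivative_intros) (use s in auto)
        then have "(\<lambda>w. - h w) field_differentiable (at (cis s))"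
          by (rule field_differentiable_minus)
        moreover have "Ln field_differentiable (at (- h (cis s)))"
          by (rule field_differentiable_at_Ln[OF s(2)])
        ultimately show "(\<lambda>w. Ln (- h w)) field_differentiable (at (cis s))"
          using field_differentiable_compose[of "\<lambda>w. - h w" "cis s" Ln] by (simp add: o_def)
      qed
      moreover have "cis differentiable (at s)"
        unfolding differentiable_def
        using has_derivative_cis[OF has_derivative_ident] by blast
      ultimately have "((\<lambda>w. Ln (- h w)) \<circ> cis) differentiable (at s)"
        by (intro differentiable_chain_at)
           (auto simp: differentiable_def has_field_derivative_def has_vector_derivative_def)
      then obtain D where D: "((\<lambda>t. Ln (- h (cis t))) has_derivative D) (at s)"
        by (auto simp: differentiable_def o_def)
      have "(k has_derivative (\<lambda>x. Im (D x))) (at s)"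
        unfolding k_def
        using has_derivative_add[OF has_derivative_Im[OF D] has_derivative_const[of pi]] by simp
      then show ?thesis by (auto simp: differentiable_def)
    qed
    then show ?thesis by (simp add: differentiable_at_imp_differentiable_on)
  qed
  have "negligible (insert 0 (k ` S))"
    using negligible_differentiable_image_negligible[OF order_refl negS kdiff] by simp
  moreover have "{t \<in> {0..<2 * pi}. cis t \<in> \<phi> -` N \<inter> space circle_measure} \<subseteq> insert 0 (k ` S)"
  proof safe
    fix t assume t: "t \<in> {0..<2 * pi}" and tN: "\<phi> (cis t) \<in> N" and t0: "t \<notin> k ` S"
    let ?s = "Arg2pi (\<phi> (cis t))"
    have s: "?s \<in> {0..<2 * pi}" "cis ?s = \<phi> (cis t)"
      using circle_arg[OF sph[of "cis t"]] by auto
    have hs: "h (cis ?s) = cis t" using s h by simp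
    show "t = 0"
    proof (rule ccontr)
      assume "t \<noteq> 0"
      have At: "Arg2pi (cis t) = t"
        by (rule Arg2pi_unique[of 1]) (use t in \<open>auto simp: cis_conv_exp\<close>)
      have "- cis t \<notin> \<real>\<^sub>\<le>\<^sub>0"
      proof
        assume "- cis t \<in> \<real>\<^sub>\<le>\<^sub>0"
        then have "cis t \<in> \<real> \<and> 0 \<le> Re (cis t)"
          by (auto simp: complex_nonpos_Reals_iff complex_is_Real_iff)
        then show False using Arg2pi_eq_0[of "cis t"] At \<open>t \<noteq> 0\<close> by simp
      qed
      then have "?s \<in> S" using s hs tN hden[of "cis t"] by (auto simp: S_def)
      moreover have "k ?s = t"
        unfolding k_def hs using Arg2pi_Ln[of "cis t"] At t \<open>t \<noteq> 0\<close> by auto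
      ultimately show False using t0 by (metis imageI)
    qed
  qed
  ultimately have "negligible {t \<in> {0..<2 * pi}. cis t \<in> \<phi> -` N \<inter> space circle_measure}"
    by (rule negligible_subset)
  moreover have "\<phi> -` N \<inter> space circle_measure \<in> sets circle_measure"
    using measurable_sets[OF meas] N by blast
  ultimately show "\<phi> -` N \<inter> space circle_measure \<in> null_sets circle_measure"
    using circle_null_sets_iff by blast
qed

lemma disc_automorphism_AE:
  assumes "disc_automorphism \<phi>" "AE z in circle_measure. P z"
  shows "AE z in circle_measure. P (\<phi> z)"
proof -
  obtain N where N: "N \<in> null_sets circle_measure" "{z \<in> space circle_measure. \<not> P z} \<subseteq> N"
    using assms(2) by (auto simp: eventually_ae_filter)
  have "{z \<in> space circle_measure. \<not> P (\<phi> z)} \<subseteq> \<phi> -` N \<inter> space circle_measure"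
    using N(2) measurable_space[OF disc_automorphism_measurable_nonsingular(1)[OF assms(1)]] by blast
  then show ?thesis
    using disc_automorphism_measurable_nonsingular(2)[OF assms(1) N(1)]
    unfolding eventually_ae_filter by blast
qed

section \<open>The algebra of essentially bounded functions on the circle\<close>

definition ess_bounded :: "(complex \<Rightarrow> complex) \<Rightarrow> bool" where
  "ess_bounded f \<longleftrightarrow>
     f \<in> borel_measurable circle_measure \<and> (\<exists>C. AE z in circle_measure. cmod (f z) \<le> C)"

definition linf_rel :: "(complex \<Rightarrow> complex) \<Rightarrow> (complex \<Rightarrow> complex) \<Rightarrow> bool" where
  "linf_rel f g \<longleftrightarrow> ess_bounded f \<and> ess_bounded g \<and> (AE z in circle_measure. f z = g z)"

definition ess_norm :: "(complex \<Rightarrow> complex) \<Rightarrow> real" where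
  "ess_norm f = real_of_ereal (esssup circle_measure (\<lambda>z. ereal (cmod (f z))))"

lemma ess_boundedI:
  "f \<in> borel_measurable circle_measure \<Longrightarrow> AE z in circle_measure. cmod (f z) \<le> C \<Longrightarrow> ess_bounded f"
  by (auto simp: ess_bounded_def)

lemma ess_bounded_const: "ess_bounded (\<lambda>_. c)"
  by (rule ess_boundedI[of _ "cmod c"]) auto

lemma ess_bounded_add:
  assumes "ess_bounded f" "ess_bounded g" shows "ess_bounded (\<lambda>z. f z + g z)"
proof -
  obtain C D where "AE z in circle_measure. cmod (f z) \<le> C" "AE z in circle_measure. cmod (g z) \<le> D"
    using assms by (auto simp: ess_bounded_def)
  then have "AE z in circle_measure. cmod (f z + g z) \<le> C + D"
    by eventually_elim (rule norm_triangle_mono)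
  then show ?thesis
    using assms by (intro ess_boundedI) (auto simp: ess_bounded_def)
qed

lemma ess_bounded_mult:
  assumes "ess_bounded f" "ess_bounded g" shows "ess_bounded (\<lambda>z. f z * g z)"
proof -
  obtain C D where "AE z in circle_measure. cmod (f z) \<le> C" "AE z in circle_measure. cmod (g z) \<le> D"
    using assms by (auto simp: ess_bounded_def)
  then have "AE z in circle_measure. cmod (f z * g z) \<le> C * D"
    by eventually_elim (auto simp: norm_mult intro!: mult_mono intro: order_trans[OF norm_ge_zero])
  then show ?thesis
    using assms by (intro ess_boundedI) (auto simp: ess_bounded_def)
qed

lemma ess_bounded_cmult: "ess_bounded f \<Longrightarrow> ess_bounded (\<lambda>z. c * f z)"
  using ess_bounded_mult[OF ess_bounded_const] .

lemma ess_bounded_uminus: "ess_bounded f \<Longrightarrow> ess_bounded (\<lambda>z. - f z)"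
  using ess_bounded_cmult[of f "-1"] by simp

lemma ess_bounded_diff: "ess_bounded f \<Longrightarrow> ess_bounded g \<Longrightarrow> ess_bounded (\<lambda>z. f z - g z)"
  using ess_bounded_add[OF _ ess_bounded_uminus] by fastforce

lemma ess_bounded_scaleR: "ess_bounded f \<Longrightarrow> ess_bounded (\<lambda>z. r *\<^sub>R f z)"
  using ess_bounded_cmult[of f "of_real r"] by (simp add: scaleR_conv_of_real)

lemma ess_bounded_cnj: "ess_bounded f \<Longrightarrow> ess_bounded (\<lambda>z. cnj (f z))"
  by (auto simp: ess_bounded_def intro: measurable_compose[OF _ borel_measurable_continuous_onI[OF continuous_on_cnj[OF continuous_on_id]]])

lemma ess_bounded_comp:
  assumes "disc_automorphism \<phi>" "ess_bounded f" shows "ess_bounded (\<lambda>z. f (\<phi> z))"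
proof -
  obtain C where "AE z in circle_measure. cmod (f z) \<le> C" using assms(2) by (auto simp: ess_bounded_def)
  from disc_automorphism_AE[OF assms(1) this] show ?thesis
    using measurable_compose[OF disc_automorphism_measurable_nonsingular(1)[OF assms(1)], of f borel] assms(2)
    by (intro ess_boundedI) (auto simp: ess_bounded_def)
qed

lemma ess_norm_le:
  assumes "f \<in> borel_measurable circle_measure" "0 \<le> C" "AE z in circle_measure. cmod (f z) \<le> C"
  shows "ess_norm f \<le> C"
proof -
  have "esssup circle_measure (\<lambda>z. ereal (cmod (f z))) \<le> ereal C"
    using assms by (intro esssup_I) auto
  then show ?thesis unfolding ess_norm_def
    using assms(2) by (cases "esssup circle_measure (\<lambda>z. ereal (cmod (f z)))") auto
qed

lemma ess_norm_nonneg_AE: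
  assumes "ess_bounded f"
  shows "0 \<le> ess_norm f" "AE z in circle_measure. cmod (f z) \<le> ess_norm f"
proof -
  obtain C where C: "AE z in circle_measure. cmod (f z) \<le> C" and m: "f \<in> borel_measurable circle_measure"
    using assms by (auto simp: ess_bounded_def)
  let ?e = "esssup circle_measure (\<lambda>z. ereal (cmod (f z)))"
  have nz: "emeasure circle_measure (space circle_measure) \<noteq> 0"
    by (simp add: emeasure_circle_measure_space)
  have "esssup circle_measure (\<lambda>_. 0 :: ereal) \<le> ?e"
    by (rule esssup_mono) auto
  then have e0: "0 \<le> ?e" using esssup_const[OF nz, of "0 :: ereal"] by simp
  moreover have "?e \<le> ereal C" using m C by (intro esssup_I) auto
  ultimately have e: "?e = ereal (ess_norm f)"
    unfolding ess_norm_def by (cases ?e) auto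
  show "0 \<le> ess_norm f" using e0 e by simp
  show "AE z in circle_measure. cmod (f z) \<le> ess_norm f"
    using esssup_AE[where M=circle_measure and f="\<lambda>z. ereal (cmod (f z))"] unfolding e by simp
qed

lemma ess_norm_cong:
  assumes "linf_rel f g" shows "ess_norm f = ess_norm g"
proof -
  have *: "ess_norm f \<le> ess_norm g" if "linf_rel f g" for f g
  proof (rule ess_norm_le)
    from that show "f \<in> borel_measurable circle_measure" by (auto simp: linf_rel_def ess_bounded_def)
    from that have g: "ess_bounded g" and eq: "AE z in circle_measure. f z = g z"
      by (auto simp: linf_rel_def)
    show "0 \<le> ess_norm g" by (rule ess_norm_nonneg_AE(1)[OF g])
    show "AE z in circle_measure. cmod (f z) \<le> ess_norm g"
      using ess_norm_nonneg_AE(2)[OF g] eq by eventually_elim simp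
  qed
  have "linf_rel g f" using assms by (auto simp: linf_rel_def)
  then show ?thesis using * assms by (intro antisym) auto
qed

quotient_type linf = "complex \<Rightarrow> complex" / partial: linf_rel
proof (rule part_equivpI)
  show "\<exists>f. linf_rel f f"
    using ess_bounded_const by (auto simp: linf_rel_def)
  show "symp linf_rel"
    by (auto simp: symp_def linf_rel_def)
  show "transp linf_rel"
  proof (rule transpI)
    fix f g h assume "linf_rel f g" "linf_rel g h"
    then have "ess_bounded f" "ess_bounded h"
        "AE z in circle_measure. f z = g z" "AE z in circle_measure. g z = h z"
      by (auto simp: linf_rel_def)
    moreover from this(3,4) have "AE z in circle_measure. f z = h z"
      by eventually_elim simp
    ultimately show "linf_rel f h" by (simp add: linf_rel_def)
  qed
qed

instantiation linf :: real_normed_algebra_1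
begin

lift_definition zero_linf :: linf is "\<lambda>_. 0"
  by (simp add: linf_rel_def ess_bounded_const)

lift_definition one_linf :: linf is "\<lambda>_. 1"
  by (simp add: linf_rel_def ess_bounded_const)

lift_definition plus_linf :: "linf \<Rightarrow> linf \<Rightarrow> linf" is "\<lambda>f g z. f z + g z"
  by (auto simp: linf_rel_def ess_bounded_add elim: eventually_elim2)

lift_definition minus_linf :: "linf \<Rightarrow> linf \<Rightarrow> linf" is "\<lambda>f g z. f z - g z"
  by (auto simp: linf_rel_def ess_bounded_diff elim: eventually_elim2)

lift_definition uminus_linf :: "linf \<Rightarrow> linf" is "\<lambda>f z. - f z"
  by (auto simp: linf_rel_def ess_bounded_uminus)

lift_definition times_linf :: "linf \<Rightarrow> linf \<Rightarrow> linf" is "\<lambda>f g z. f z * g z"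
  by (auto simp: linf_rel_def ess_bounded_mult elim: eventually_elim2)

lift_definition scaleR_linf :: "real \<Rightarrow> linf \<Rightarrow> linf" is "\<lambda>r f z. r *\<^sub>R f z"
  by (auto simp: linf_rel_def ess_bounded_scaleR elim: eventually_mono)

lift_definition norm_linf :: "linf \<Rightarrow> real" is ess_norm
  by (rule ess_norm_cong)

definition dist_linf :: "linf \<Rightarrow> linf \<Rightarrow> real" where
  "dist_linf f g = norm (f - g)"

definition sgn_linf :: "linf \<Rightarrow> linf" where
  "sgn_linf f = scaleR (inverse (norm f)) f"

definition uniformity_linf :: "(linf \<times> linf) filter" where
  "uniformity_linf = (INF e\<in>{0<..}. principal {(f, g). dist f g < e})"

definition open_linf :: "linf set \<Rightarrow> bool" where
  "open_linf U \<longleftrightarrow> (\<forall>f\<in>U. \<forall>\<^sub>F (f', g) in uniformity. f' = f \<longrightarrow> g \<in> U)"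

instance
proof
  fix f g h :: linf and r s :: real
  note rel = linf_rel_def ess_bounded_const ess_bounded_add ess_bounded_mult ess_bounded_uminus
    ess_bounded_diff ess_bounded_scaleR
  show "f + g + h = f + (g + h)" by transfer (auto simp: rel algebra_simps)
  show "f + g = g + f" by transfer (auto simp: rel algebra_simps)
  show "0 + f = f" by transfer (auto simp: rel)
  show "- f + f = 0" by transfer (auto simp: rel)
  show "f - g = f + - g" by transfer (auto simp: rel)
  show "f * g * h = f * (g * h)" by transfer (auto simp: rel algebra_simps)
  show "(f + g) * h = f * h + g * h" by transfer (auto simp: rel algebra_simps)
  show "f * (g + h) = f * g + f * h" by transfer (auto simp: rel algebra_simps)
  show "1 * f = f" by transfer (auto simp: rel)
  show "f * 1 = f" by transfer (auto simp: rel)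
  show "r *\<^sub>R (f + g) = r *\<^sub>R f + r *\<^sub>R g" by transfer (auto simp: rel algebra_simps)
  show "(r + s) *\<^sub>R f = r *\<^sub>R f + s *\<^sub>R f" by transfer (auto simp: rel algebra_simps)
  show "r *\<^sub>R s *\<^sub>R f = (r * s) *\<^sub>R f" by transfer (auto simp: rel)
  show "1 *\<^sub>R f = f" by transfer (auto simp: rel)
  show "r *\<^sub>R f * g = r *\<^sub>R (f * g)" by transfer (auto simp: rel)
  show "f * r *\<^sub>R g = r *\<^sub>R (f * g)" by transfer (auto simp: rel)
  show "dist f g = norm (f - g)" by (rule dist_linf_def)
  show "sgn f = scaleR (inverse (norm f)) f" by (rule sgn_linf_def)
  show "uniformity = (INF e\<in>{0<..}. principal {(f, g :: linf). dist f g < e})"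
    by (rule uniformity_linf_def)
  show "open U \<longleftrightarrow> (\<forall>f\<in>U. \<forall>\<^sub>F (f', g) in uniformity. f' = f \<longrightarrow> g \<in> U)" for U :: "linf set"
    by (rule open_linf_def)
  have nz: "emeasure circle_measure (space circle_measure) \<noteq> 0"
    by (simp add: emeasure_circle_measure_space)
  have norm_one: "norm (1 :: linf) = 1"
  proof transfer
    show "ess_norm (\<lambda>_. 1) = 1"
      unfolding ess_norm_def using esssup_const[OF nz, of "ereal 1"] by simp
  qed
  then show "norm (1 :: linf) = 1" .
  show n0: "norm f = 0 \<longleftrightarrow> f = 0" for f :: linf
  proof transfer
    fix f assume f: "linf_rel f f"
    then have b: "ess_bounded f" by (simp add: linf_rel_def)
    show "ess_norm f = 0 \<longleftrightarrow> linf_rel f (\<lambda>_. 0)"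
    proof
      assume "ess_norm f = 0"
      then show "linf_rel f (\<lambda>_. 0)"
        using ess_norm_nonneg_AE(2)[OF b] b by (auto simp: linf_rel_def ess_bounded_const)
    next
      assume "linf_rel f (\<lambda>_. 0)"
      then show "ess_norm f = 0"
        using ess_norm_cong[of f "\<lambda>_. 0"] esssup_const[OF nz, of "0::ereal"]
        by (simp add: ess_norm_def zero_ereal_def)
    qed
  qed
  show "(0 :: linf) \<noteq> 1"
  proof
    assume "(0 :: linf) = 1"
    then show False using n0[of 1] norm_one by simp
  qed
  show "norm (f + g) \<le> norm f + norm g"
  proof transfer
    fix f g assume "linf_rel f f" "linf_rel g g"
    then have b: "ess_bounded f" "ess_bounded g" by (auto simp: linf_rel_def)
    show "ess_norm (\<lambda>z. f z + g z) \<le> ess_norm f + ess_norm g"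
    proof (rule ess_norm_le)
      show "(\<lambda>z. f z + g z) \<in> borel_measurable circle_measure"
        using ess_bounded_add[OF b] by (simp add: ess_bounded_def)
      show "0 \<le> ess_norm f + ess_norm g" using b ess_norm_nonneg_AE(1) by auto
      show "AE z in circle_measure. cmod (f z + g z) \<le> ess_norm f + ess_norm g"
        using ess_norm_nonneg_AE(2)[OF b(1)] ess_norm_nonneg_AE(2)[OF b(2)]
        by eventually_elim (rule norm_triangle_mono)
    qed
  qed
  show "norm (f * g) \<le> norm f * norm g"
  proof transfer
    fix f g assume "linf_rel f f" "linf_rel g g"
    then have b: "ess_bounded f" "ess_bounded g" by (auto simp: linf_rel_def)
    show "ess_norm (\<lambda>z. f z * g z) \<le> ess_norm f * ess_norm g"
    proof (rule ess_norm_le)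
      show "(\<lambda>z. f z * g z) \<in> borel_measurable circle_measure"
        using ess_bounded_mult[OF b] by (simp add: ess_bounded_def)
      show "0 \<le> ess_norm f * ess_norm g" using b ess_norm_nonneg_AE(1) by auto
      show "AE z in circle_measure. cmod (f z * g z) \<le> ess_norm f * ess_norm g"
        using ess_norm_nonneg_AE(2)[OF b(1)] ess_norm_nonneg_AE(2)[OF b(2)]
        by eventually_elim (auto simp: norm_mult intro!: mult_mono ess_norm_nonneg_AE(1)[OF b(1)])
    qed
  qed
  show "norm (r *\<^sub>R f) = \<bar>r\<bar> * norm f"
  proof -
    have le: "norm (r *\<^sub>R f) \<le> \<bar>r\<bar> * norm f" for r and f :: linf
    proof transfer
      fix r f assume "linf_rel f f"
      then have b: "ess_bounded f" by (auto simp: linf_rel_def)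
      show "ess_norm (\<lambda>z. r *\<^sub>R f z) \<le> \<bar>r\<bar> * ess_norm f"
      proof (rule ess_norm_le)
        show "(\<lambda>z. r *\<^sub>R f z) \<in> borel_measurable circle_measure"
          using ess_bounded_scaleR[OF b] by (simp add: ess_bounded_def)
        show "0 \<le> \<bar>r\<bar> * ess_norm f" using ess_norm_nonneg_AE(1)[OF b] by auto
        show "AE z in circle_measure. cmod (r *\<^sub>R f z) \<le> \<bar>r\<bar> * ess_norm f"
          using ess_norm_nonneg_AE(2)[OF b] by eventually_elim (auto intro!: mult_left_mono)
      qed
    qed
    have sc: "a *\<^sub>R b *\<^sub>R f = (a * b) *\<^sub>R f" "1 *\<^sub>R f = f" for a b :: real
      by (transfer, auto simp: rel)+
    have z: "0 *\<^sub>R f = 0" by transfer (auto simp: rel)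
    show ?thesis
    proof (cases "r = 0")
      case True
      then show ?thesis using z n0[of 0] by simp
    next
      case False
      have "norm f = norm (inverse r *\<^sub>R r *\<^sub>R f)" using False sc by simp
      also have "\<dots> \<le> \<bar>inverse r\<bar> * norm (r *\<^sub>R f)" by (rule le)
      finally have "\<bar>r\<bar> * norm f \<le> norm (r *\<^sub>R f)"
        using False by (simp add: field_simps)
      then show ?thesis using le[of r f] by simp
    qed
  qed
qed

end

text \<open>The type class only provides real scalars.\<close>

lift_definition scaleC :: "complex \<Rightarrow> linf \<Rightarrow> linf" (infixr "*\<^sub>C" 75) is "\<lambda>c f z. c * f z"
  by (auto simp: linf_rel_def ess_bounded_cmult elim: eventually_mono)

lift_definition linf_cnj :: "linf \<Rightarrow> linf" is "\<lambda>f z. cnj (f z)"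
  by (auto simp: linf_rel_def ess_bounded_cnj elim: eventually_mono)

lift_definition unimodular :: "linf \<Rightarrow> bool" is
  "\<lambda>f. AE z in circle_measure. cmod (f z) = 1"
proof -
  fix f g assume "linf_rel f g"
  then have "AE z in circle_measure. f z = g z" by (simp add: linf_rel_def)
  then have "AE z in circle_measure. cmod (f z) = 1 \<longleftrightarrow> cmod (g z) = 1"
    by eventually_elim simp
  then show "(AE z in circle_measure. cmod (f z) = 1) = (AE z in circle_measure. cmod (g z) = 1)"
    by (rule eventually_subst)
qed

lemma linf_rel_comp:
  assumes "linf_rel f g" "disc_automorphism \<phi>"
  shows "linf_rel (\<lambda>z. f (\<phi> z)) (\<lambda>z. g (\<phi> z))"
proof -
  have "AE z in circle_measure. f z = g z"
    using assms(1) by (simp add: linf_rel_def)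
  from disc_automorphism_AE[OF assms(2) this] show ?thesis
    using assms by (simp add: linf_rel_def ess_bounded_comp)
qed

text \<open>Only used when \<open>\<phi>\<close> is a disc automorphism; the other branch is a dummy value.\<close>

lift_definition linf_comp :: "linf \<Rightarrow> (complex \<Rightarrow> complex) \<Rightarrow> linf" is
  "\<lambda>f \<phi>. if disc_automorphism \<phi> then (\<lambda>z. f (\<phi> z)) else (\<lambda>_. 0)"
  by (simp add: linf_rel_comp) (simp add: linf_rel_def ess_bounded_const)

lemma linf_rel_integral:
  assumes "linf_rel f f'" "integrable circle_measure g"
  shows "(LINT z|circle_measure. f z * g z) = (LINT z|circle_measure. f' z * g z)"
proof (rule integral_cong_AE)
  have m: "f \<in> borel_measurable circle_measure" "f' \<in> borel_measurable circle_measure"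
    and eq: "AE z in circle_measure. f z = f' z"
    using assms(1) by (auto simp: linf_rel_def ess_bounded_def)
  have "g \<in> borel_measurable circle_measure" using assms(2) by auto
  then show "(\<lambda>z. f z * g z) \<in> borel_measurable circle_measure"
      "(\<lambda>z. f' z * g z) \<in> borel_measurable circle_measure"
    using m by auto
  show "AE z in circle_measure. f z * g z = f' z * g z" using eq by eventually_elim simp
qed

text \<open>Only used for integrable \<open>g\<close>; the other branch is a dummy value.\<close>

lift_definition linf_pairing :: "linf \<Rightarrow> (complex \<Rightarrow> complex) \<Rightarrow> complex" is
  "\<lambda>f g. if integrable circle_measure g then (LINT z|circle_measure. f z * g z) else 0"
  by (rule ext) (simp add: linf_rel_integral)

definition linf_weak_star :: "linf topology" where
  "linf_weak_star = topology_generated_by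
     {{f. linf_pairing f g \<in> U} | g U. integrable circle_measure g \<and> open U}"

section \<open>Bounded analytic functions and Douglas algebras\<close>

lift_definition radial_boundary_value :: "(complex \<Rightarrow> complex) \<Rightarrow> linf \<Rightarrow> bool" is
  "\<lambda>F f. AE z in circle_measure. ((\<lambda>r. F (of_real r * z)) \<longlongrightarrow> f z) (at_left 1)"
proof -
  fix F f g assume "linf_rel f g"
  then have "AE z in circle_measure. f z = g z" by (simp add: linf_rel_def)
  then have "AE z in circle_measure. ((\<lambda>r. F (of_real r * z)) \<longlongrightarrow> f z) (at_left 1) \<longleftrightarrow>
      ((\<lambda>r. F (of_real r * z)) \<longlongrightarrow> g z) (at_left 1)"
    by eventually_elim simp
  then show "(AE z in circle_measure. ((\<lambda>r. F (of_real r * z)) \<longlongrightarrow> f z) (at_left 1)) =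
      (AE z in circle_measure. ((\<lambda>r. F (of_real r * z)) \<longlongrightarrow> g z) (at_left 1))"
    by (rule eventually_subst)
qed

definition Hinf :: "linf set" where
  "Hinf = {f. \<exists>F. F holomorphic_on ball 0 1 \<and> bounded (F ` ball 0 1) \<and> radial_boundary_value F f}"

definition inner_functions :: "linf set" where
  "inner_functions = {f \<in> Hinf. unimodular f}"

definition closed_subalgebra :: "linf set \<Rightarrow> bool" where
  "closed_subalgebra B \<longleftrightarrow>
     closed B \<and> 0 \<in> B \<and> (\<forall>f\<in>B. \<forall>g\<in>B. f + g \<in> B \<and> f * g \<in> B) \<and> (\<forall>c. \<forall>f\<in>B. c *\<^sub>C f \<in> B)"

definition douglas_algebra :: "linf set \<Rightarrow> bool" where
  "douglas_algebra A \<longleftrightarrow>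
     (\<exists>Q \<subseteq> inner_functions. A = closed_subalgebra hull (Hinf \<union> linf_cnj ` Q))"

section \<open>Isometry groups and weak-star convex transitivity\<close>

text \<open>Isometric isomorphisms are complex linear. Operators on \<open>A\<close> are represented by functions on the whole type; the values outside \<open>A\<close>
  are irrelevant.\<close>

definition isometry_group :: "linf set \<Rightarrow> (linf \<Rightarrow> linf) set" where
  "isometry_group A =
     {T. bij_betw T A A \<and>
         (\<forall>f\<in>A. \<forall>g\<in>A. T (f + g) = T f + T g) \<and> (\<forall>c. \<forall>f\<in>A. T (c *\<^sub>C f) = c *\<^sub>C T f) \<and>
         (\<forall>f\<in>A. norm (T f) = norm f)}"

text \<open>For \<open>\<psi> \<in> A\<close> unimodular the map \<open>f \<mapsto> \<psi> * (f \<circ> \<phi>)\<close> need not be onto \<open>A\<close>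
  (take \<open>A = Hinf\<close> and \<open>\<psi>\<close> a nonconstant inner function), hence the intersection with
  the isometry group.\<close>

definition weighted_composition_group :: "linf set \<Rightarrow> (linf \<Rightarrow> linf) set" where
  "weighted_composition_group A =
     {T \<in> isometry_group A. \<exists>\<psi>\<in>A. \<exists>\<phi>. unimodular \<psi> \<and> disc_automorphism \<phi> \<and>
        (\<forall>f\<in>A. T f = \<psi> * linf_comp f \<phi>)}"

definition weak_star_convex_transitive_wrt :: "(linf \<Rightarrow> linf) set \<Rightarrow> linf set \<Rightarrow> bool" where
  "weak_star_convex_transitive_wrt G A \<longleftrightarrow>
     (\<forall>x \<in> A \<inter> sphere 0 1.
        subtopology linf_weak_star A closure_of (convex hull {T x | T. T \<in> G}) = A \<inter> cball 0 1)"

definition weak_star_convex_transitive :: "linf set \<Rightarrow> bool" where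
  "weak_star_convex_transitive A \<longleftrightarrow> weak_star_convex_transitive_wrt (isometry_group A) A"

end

theory Submission
  imports Defs "HOL-Complex_Analysis.Complex_Analysis"
begin

text \<open>
  If \<open>A\<close> is not \<open>H\<^sup>\<infinity>\<close>, it contains a nonconstant \<open>q\<close> of \<open>H\<^sup>\<infinity>\<close> together with its conjugate.
  Rotation averages of \<open>q \<circ> \<phi>\<close>, with \<open>\<phi>\<close> chosen so that \<open>q \<circ> \<phi>\<close> has nonzero derivative at \<open>0\<close>,
  converge to a multiple of the coordinate function, so the coordinate is an a.e. limit of elements
  \<open>b\<close> of the self-adjoint part of \<open>A\<close>. By continuous functional calculus each \<open>cis (\<alpha> b)\<close> is a unitary
  of \<open>A\<close>, and every function bounded by one is an a.e. limit of means of two such unitaries.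
  Moreover unimodular multiples of \<open>x \<circ> \<phi>\<^sub>k\<close> tend to \<open>1\<close> a.e. when the automorphisms \<open>\<phi>\<^sub>k\<close>
  concentrate at points where \<open>|x|\<close> is almost maximal. Bounded a.e. convergence implies weak-star
  convergence, so the closed convex hull of the orbit of \<open>x\<close> is the whole unit ball.

  Conversely, a surjective isometry of \<open>H\<^sup>\<infinity>\<close> maps \<open>1\<close> to a constant, so the orbit of \<open>1\<close> spans
  only the constants.
\<close>

section \<open>Arc length, rotations and continuous approximation\<close>

text \<open>Weak-star convergence always arises from bounded a.e. convergence of sequences, so every
  approximation is built to keep the modulus at most one. The limits involved are not merged into a
  diagonal sequence: each one lands in the weak-star closure, and closure is idempotent. The detour
  through the coordinate function has a reason: continuous functions of \<open>q\<close> alone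
  cannot separate points of the circle at which \<open>q\<close> agrees. Automorphism invariance of
  \<open>A\<close> removes this obstacle. A weight must have its conjugate in \<open>A\<close> as
  well, because otherwise the operator maps \<open>A\<close> into \<open>A\<close> but not onto.
  Hence the calculus lives in the self-adjoint part of \<open>A\<close>, and for
  \<open>H^\<infinity>\<close> that part consists of the constants only. The converse does not
  classify the isometries. It singles out the unit by an infinitesimal condition: the directions in
  which the norm grows only to second order. A linear isometry carries such directions to such
  directions.\<close>

interpretation circle: finite_measure circle_measure
  by (rule finite_measureI) (simp add: emeasure_circle_measure_space)

lemma measure_circle: "measure circle_measure (sphere 0 1) = 2 * pi"
  by (simp add: measure_def emeasure_circle_measure_space)

lemma integrable_circle_bounded:
  fixes f :: "complex \<Rightarrow> 'a::{banach, second_countable_topology}"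
  assumes "f \<in> borel_measurable circle_measure" "AE z in circle_measure. norm (f z) \<le> C"
  shows "integrable circle_measure f"
  using circle.integrable_const_bound[OF assms(2,1)] .

lemma measurable_circle_continuous:
  assumes "continuous_on (sphere 0 1) f"
  shows "f \<in> borel_measurable circle_measure"
  by (subst measurable_cong_sets[OF sets_circle_measure refl])
     (rule borel_measurable_continuous_on_restrict[OF assms])

lemma measurable_circleI:
  assumes "f \<in> borel_measurable borel"
  shows "f \<in> borel_measurable circle_measure"
  using assms by (simp add: measurable_restrict_space1 cong: measurable_cong_sets)

lemma sets_circle_iff: "X \<in> sets circle_measure \<longleftrightarrow> X \<in> sets borel \<and> X \<subseteq> sphere 0 1"
  by (auto simp: sets_restrict_space_iff)

lemma AE_circle_sphere: "AE z in circle_measure. z \<in> sphere 0 1"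
  using AE_space[of circle_measure] by simp

text \<open>Needed at two points: \<open>1\<close>, where the branch cut of \<open>Arg2pi\<close>
  meets the circle, and \<open>-1\<close>, the repelling fixed point of the concentrating
  automorphisms.\<close>

lemma AE_circle_neq: "AE z in circle_measure. z \<noteq> w"
proof -
  have "{z \<in> space circle_measure. z = w} \<in> null_sets circle_measure"
  proof (subst circle_null_sets_iff)
    have "{z \<in> space circle_measure. z = w} = sphere 0 1 \<inter> {w}" by auto
    then show "{z \<in> space circle_measure. z = w} \<in> sets circle_measure"
      by (simp only: sets_circle_iff)
         (intro conjI borel_closed closed_Int closed_sphere closed_singleton Int_lower1)
    have "{t \<in> {0..<2 * pi}. cis t \<in> {z \<in> space circle_measure. z = w}} \<subseteq> {Arg2pi w}"
    proof safe
      fix t assume "t \<in> {0..<2 * pi}"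
      then show "t = Arg2pi (cis t)"
        using Arg2pi_unique[of 1 t "cis t"] by (auto simp: cis_conv_exp)
    qed
    then show "negligible {t \<in> {0..<2 * pi}. cis t \<in> {z \<in> space circle_measure. z = w}}"
      using negligible_sing negligible_subset by blast
  qed
  then show ?thesis by (rule AE_I'[rotated 0]) auto
qed

lemma borel_measurable_Arg2pi [measurable]: "Arg2pi \<in> borel_measurable borel"
  by (rule borel_measurableI_greater) (simp add: borel_open open_Arg2pi2pi_gt)

lemma emeasure_lborel_shift:
  fixes S :: "real set"
  assumes "S \<in> sets borel"
  shows "emeasure lborel ((+) c -` S) = emeasure lborel S"
proof -
  have "emeasure (distr lborel borel ((+) c)) S = emeasure lborel S"
    by (simp add: lborel_distr_plus)
  then show ?thesis using assms by (subst (asm) emeasure_distr) auto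
qed

section \<open>Rotation invariance of arc length\<close>

lemma measurable_rotation:
  assumes "cmod w = 1"
  shows "(\<lambda>z. w * z) \<in> measurable circle_measure circle_measure"
proof -
  have "(\<lambda>z. w * z) \<in> measurable (restrict_space borel (sphere 0 1)) (restrict_space borel (sphere 0 1))"
    by (intro measurable_restrict_space2 measurable_restrict_space1)
       (use assms in \<open>auto simp: space_restrict_space norm_mult\<close>)
  then show ?thesis by (simp cong: measurable_cong_sets)
qed

lemma distr_rotation:
  assumes w: "cmod w = 1"
  shows "distr circle_measure circle_measure (\<lambda>z. w * z) = circle_measure"
proof (rule measure_eqI)
  fix X assume "X \<in> sets (distr circle_measure circle_measure (\<lambda>z. w * z))"
  then have X: "X \<in> sets circle_measure" by simp
  define s where "s = Arg2pi w"
  have s: "0 \<le> s" "s < 2 * pi" "cis s = w" using circle_arg[of w] w by (auto simp: s_def)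
  define Y where "Y = {t. cis t \<in> X}"
  have "cis \<in> borel_measurable borel"
    by (intro borel_measurable_continuous_onI continuous_intros)
  then have Y: "Y \<in> sets borel"
    using measurable_sets[of cis borel borel X] X unfolding sets_circle_iff by (simp add: Y_def vimage_def)
  \<comment> \<open>A rotation shifts the argument by \<open>s\<close>, and the shifted interval
    wraps past \<open>2 * pi\<close>. \<open>A\<close> collects the arguments that do not wrap,
    \<open>B\<close> those that do; the shifts carry them to the parts of \<open>Y\<close> above and
    below \<open>s\<close>.\<close>
  define A where "A = (+) s -` (Y \<inter> {s..<2*pi})"
  define B where "B = (+) (s - 2*pi) -` (Y \<inter> {0..<s})"
  have mAB: "A \<in> sets borel" "B \<in> sets borel"
    unfolding A_def B_def using Y
    by (auto intro!: measurable_sets_borel[of _ borel])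
  have per: "cis (s - 2*pi + t) = w * cis t" "cis (s + t) = w * cis t" for t
    using s(3) by (auto simp: cis_mult[symmetric] cis_divide[symmetric] simp flip: cis_mult)
  have "(\<lambda>z. w * z) -` X \<inter> space circle_measure \<in> sets circle_measure"
    using measurable_sets[OF measurable_rotation[OF w] X] .
  then have "emeasure (distr circle_measure circle_measure (\<lambda>z. w * z)) X =
      emeasure lborel {t \<in> {0..<2 * pi}. cis t \<in> (\<lambda>z. w * z) -` X \<inter> space circle_measure}"
    by (subst emeasure_distr[OF measurable_rotation[OF w] X]) (simp only: emeasure_circle_measure)
  also have "{t \<in> {0..<2 * pi}. cis t \<in> (\<lambda>z. w * z) -` X \<inter> space circle_measure} = A \<union> B"
    using s by (auto simp: A_def B_def Y_def per)
  also have "emeasure lborel (A \<union> B) = emeasure lborel A + emeasure lborel B"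
    using mAB by (subst plus_emeasure) (auto simp: A_def B_def)
  also have "\<dots> = emeasure lborel (Y \<inter> {s..<2*pi}) + emeasure lborel (Y \<inter> {0..<s})"
    using Y unfolding A_def B_def by (subst (1 2) emeasure_lborel_shift) auto
  also have "\<dots> = emeasure lborel ((Y \<inter> {s..<2*pi}) \<union> (Y \<inter> {0..<s}))"
    using Y by (subst plus_emeasure) auto
  also have "(Y \<inter> {s..<2*pi}) \<union> (Y \<inter> {0..<s}) = {t \<in> {0..<2 * pi}. cis t \<in> X}"
    using s by (auto simp: Y_def)
  finally show "emeasure (distr circle_measure circle_measure (\<lambda>z. w * z)) X = emeasure circle_measure X"
    using X by (simp add: emeasure_circle_measure)
qed simp

lemma integral_rotation:
  fixes f :: "complex \<Rightarrow> 'a::{banach, second_countable_topology}"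
  assumes "cmod w = 1" "f \<in> borel_measurable circle_measure"
  shows "(LINT z|circle_measure. f (w * z)) = (LINT z|circle_measure. f z)"
  using integral_distr[OF measurable_rotation[OF assms(1)] assms(2)] distr_rotation[OF assms(1)]
  by simp

lemma AE_rotation:
  assumes "cmod w = 1" "AE z in circle_measure. P z"
  shows "AE z in circle_measure. P (w * z)"
  by (rule AE_distrD[OF measurable_rotation[OF assms(1)]])
     (simp only: distr_rotation[OF assms(1)] assms(2))

text \<open>Cutting off near the branch cut makes a continuous function of the argument continuous in \<open>z\<close>.\<close>

lemma continuous_cutoff_Arg2pi:
  fixes g :: "real \<Rightarrow> real"
  assumes g: "continuous_on UNIV g"
  shows "continuous_on UNIV (\<lambda>z. min 1 (c * infdist z \<real>\<^sub>\<ge>\<^sub>0) * g (Arg2pi z))"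
proof (rule continuous_at_imp_continuous_on, rule ballI)
  fix z :: complex
  let ?d = "\<lambda>z. min 1 (c * infdist z (\<real>\<^sub>\<ge>\<^sub>0 :: complex set))"
  have dc: "isCont ?d w" for w
    by (intro continuous_intros)
  show "isCont (\<lambda>z. ?d z * g (Arg2pi z)) z"
  proof (cases "z \<in> \<real>\<^sub>\<ge>\<^sub>0")
    case False
    then have "isCont (\<lambda>z. g (Arg2pi z)) z"
      using continuous_at_Arg2pi[OF False] g isCont_o2[of z Arg2pi g]
      by (simp add: continuous_on_eq_continuous_at)
    then show ?thesis using dc by (intro continuous_mult) auto
  next
    case True
    have "bounded (g ` {0..2*pi})"
      by (intro compact_imp_bounded compact_continuous_image continuous_on_subset[OF g]) auto
    then obtain C where C: "\<And>t. t \<in> {0..2*pi} \<Longrightarrow> \<bar>g t\<bar> \<le> C"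
      unfolding bounded_iff by (metis imageI real_norm_def)
    have b: "\<bar>g (Arg2pi w)\<bar> \<le> C" for w
      using C[of "Arg2pi w"] Arg2pi[of w] by auto
    have "?d \<midarrow>z\<rightarrow> ?d z" using dc[of z] by (simp add: isCont_def)
    moreover have dz: "?d z = 0" using True by simp
    ultimately have "(\<lambda>w. C * \<bar>?d w\<bar>) \<midarrow>z\<rightarrow> 0"
      by (intro tendsto_eq_intros tendsto_rabs) auto
    then have "(\<lambda>w. ?d w * g (Arg2pi w)) \<midarrow>z\<rightarrow> 0"
    proof (rule Lim_null_comparison[rotated])
      show "\<forall>\<^sub>F w in at z. norm (?d w * g (Arg2pi w)) \<le> C * \<bar>?d w\<bar>"
        using b by (auto simp: abs_mult mult.commute[of C] intro!: always_eventually mult_left_mono)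
    qed
    then show ?thesis using dz by (simp add: isCont_def)
  qed
qed

text \<open>The function is pulled back to the line, where \<open>measurable_on\<close> provides
  continuous functions converging off a negligible set, and these are carried back by
  \<open>Arg2pi\<close>. The cutoff in \<open>H\<close> tends to one off the branch cut and keeps
  \<open>H n\<close> continuous on the whole plane, so that exponents built this way can later be
  applied to the values of an element of \<open>A\<close>.\<close>

lemma circle_real_approx:
  fixes f :: "complex \<Rightarrow> real"
  assumes f: "f \<in> borel_measurable circle_measure"
  obtains H :: "nat \<Rightarrow> complex \<Rightarrow> real"
  where "\<And>n. continuous_on UNIV (H n)" "AE z in circle_measure. (\<lambda>n. H n z) \<longlonglongrightarrow> f z"
proof -
  have f1: "(\<lambda>t. f (cis t)) \<in> borel_measurable (restrict_space lborel {0..<2*pi})"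
    using measurable_compose[OF measurable_cis_circle, of f borel] f
    by (simp cong: measurable_cong_sets)
  define u where "u t = indicat_real {0..<2*pi} t *\<^sub>R f (cis t)" for t
  have "u \<in> borel_measurable lborel"
    using f1 unfolding u_def by (subst (asm) borel_measurable_restrict_space_iff) auto
  then have "u \<in> borel_measurable lebesgue" by (rule measurable_completion)
  then have "u measurable_on UNIV"
    by (rule lebesgue_measurable_imp_measurable_on) simp
  then obtain N g where N: "negligible N" and g: "\<And>n. continuous_on UNIV (g n)"
    and lim: "\<And>t. t \<notin> N \<Longrightarrow> (\<lambda>n. g n t) \<longlonglongrightarrow> u t"
    unfolding measurable_on_def by (auto split: if_splits)
  \<comment> \<open>A Borel cover of \<open>N\<close> is required: \<open>N\<close> is merely
    Lebesgue null, while \<open>X\<close> has to be measurable for arc length.\<close>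
  have "N \<in> null_sets lebesgue" using N by (simp add: negligible_iff_null_sets)
  then obtain N' where N': "N' \<in> null_sets lborel" "N \<subseteq> N'"
    by (auto simp: null_sets_completion_iff2)
  define X where "X = {z \<in> sphere 0 1. Arg2pi z \<in> N'}"
  have "N' \<in> sets borel" using N'(1) by auto
  then have "Arg2pi -` N' \<inter> space borel \<in> sets borel"
    by (rule measurable_sets[OF borel_measurable_Arg2pi])
  moreover have "X = Arg2pi -` N' \<inter> sphere 0 1" by (auto simp: X_def)
  ultimately have Xs: "X \<in> sets circle_measure" unfolding sets_circle_iff by auto
  have At: "Arg2pi (cis t) = t" if "t \<in> {0..<2*pi}" for t
    using Arg2pi_unique[of 1 t "cis t"] that by (auto simp: cis_conv_exp)
  have "negligible N'" using N'(1)
    by (metis negligible_iff_null_sets null_sets_completionI)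
  then have "negligible {t \<in> {0..<2 * pi}. cis t \<in> X}"
    by (rule negligible_subset) (auto simp: X_def At)
  then have "X \<in> null_sets circle_measure"
    using circle_null_sets_iff[OF Xs] by simp
  then have aeX: "AE z in circle_measure. z \<notin> X" by (rule AE_not_in)
  define H where "H n z = min 1 (real n * infdist z \<real>\<^sub>\<ge>\<^sub>0) * g n (Arg2pi z)" for n and z :: complex
  have "AE z in circle_measure. (\<lambda>n. H n z) \<longlonglongrightarrow> f z"
    using aeX AE_circle_sphere AE_circle_neq[of 1]
  proof eventually_elim
    case (elim z)
    have c: "Arg2pi z \<in> {0..<2*pi}" "cis (Arg2pi z) = z" using circle_arg[of z] elim by auto
    then have "(\<lambda>n. g n (Arg2pi z)) \<longlonglongrightarrow> f z"
      using lim[of "Arg2pi z"] elim N'(2) by (auto simp: X_def u_def)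
    moreover have "(\<lambda>n. min 1 (real n * infdist z (\<real>\<^sub>\<ge>\<^sub>0 :: complex set))) \<longlonglongrightarrow> 1"
    proof -
      have "z \<notin> \<real>\<^sub>\<ge>\<^sub>0" using elim by (auto elim!: nonneg_Reals_cases)
      then have p: "infdist z (\<real>\<^sub>\<ge>\<^sub>0 :: complex set) > 0"
        using in_closed_iff_infdist_zero[OF closed_nonneg_Reals_complex, of z] infdist_nonneg[of z "\<real>\<^sub>\<ge>\<^sub>0"]
          nonneg_Reals_zero_I by (metis empty_iff order_le_less)
      have "\<forall>\<^sub>F n in sequentially. real n \<ge> 1 / infdist z (\<real>\<^sub>\<ge>\<^sub>0 :: complex set)"
        using filterlim_real_sequentially unfolding filterlim_at_top by blast
      then have "\<forall>\<^sub>F n in sequentially. min 1 (real n * infdist z (\<real>\<^sub>\<ge>\<^sub>0 :: complex set)) = 1"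
        by eventually_elim (use p in \<open>simp add: field_simps\<close>)
      then show ?thesis by (rule tendsto_eventually)
    qed
    ultimately have "(\<lambda>n. min 1 (real n * infdist z (\<real>\<^sub>\<ge>\<^sub>0 :: complex set)) * g n (Arg2pi z)) \<longlonglongrightarrow> 1 * f z"
      by (intro tendsto_mult)
    then show ?case by (simp add: H_def)
  qed
  moreover have "continuous_on UNIV (H n)" for n
    unfolding H_def by (rule continuous_cutoff_Arg2pi[OF g])
  ultimately show thesis using that by blast
qed

text \<open>Every point of the closed disc is the midpoint of a chord perpendicular to its radius.
  With \<open>s z\<close> the unit direction of \<open>f z\<close>, the endpoints of that chord are
  \<open>v 1 z\<close> and \<open>v (-1) z\<close>, explicit enough to depend measurably on
  \<open>z\<close>.\<close>

lemma cis_mean_representation: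
  fixes f :: "complex \<Rightarrow> complex"
  assumes [measurable]: "f \<in> borel_measurable circle_measure"
  obtains \<alpha> \<beta> :: "complex \<Rightarrow> real"
  where "\<alpha> \<in> borel_measurable circle_measure" "\<beta> \<in> borel_measurable circle_measure"
    "\<And>z. cmod (f z) \<le> 1 \<Longrightarrow> f z = (cis (\<alpha> z) + cis (\<beta> z)) / 2"
proof -
  define s where "s z = (if f z = 0 then 1 else sgn (f z))" for z
  define v where "v e z = s z * Complex (cmod (f z)) (e * sqrt (1 - (cmod (f z))\<^sup>2))" for e z
  have [measurable]: "s \<in> borel_measurable circle_measure"
    unfolding s_def sgn_div_norm by measurable
  have Cx: "Complex a b = of_real a + \<i> * of_real b" for a b by (simp add: complex_eq_iff)
  have [measurable]: "v e \<in> borel_measurable circle_measure" for e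
    unfolding v_def Cx by measurable
  have v1: "cmod (v e z) = 1" if "cmod (f z) \<le> 1" "e\<^sup>2 = 1" for e z
  proof -
    have "(cmod (f z))\<^sup>2 \<le> 1" using that by (simp add: power_le_one)
    then have "cmod (Complex (cmod (f z)) (e * sqrt (1 - (cmod (f z))\<^sup>2))) = 1"
      using that(2) by (simp add: cmod_def power_mult_distrib)
    moreover have "cmod (s z) = 1" by (auto simp: s_def norm_sgn)
    ultimately show ?thesis by (simp add: v_def norm_mult)
  qed
  have c: "cis (Arg2pi (v e z)) = v e z" if "cmod (f z) \<le> 1" "e\<^sup>2 = 1" for e z
    using circle_arg[of "v e z"] v1[OF that] by simp
  show thesis
  proof
    show "(\<lambda>z. Arg2pi (v 1 z)) \<in> borel_measurable circle_measure"
         "(\<lambda>z. Arg2pi (v (-1) z)) \<in> borel_measurable circle_measure" by measurable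
    fix z assume z: "cmod (f z) \<le> 1"
    have "v 1 z + v (-1) z = 2 * (s z * of_real (cmod (f z)))"
      by (simp add: v_def Cx algebra_simps)
    also have "s z * of_real (cmod (f z)) = f z"
      by (simp add: s_def sgn_div_norm scaleR_conv_of_real)
    finally show "f z = (cis (Arg2pi (v 1 z)) + cis (Arg2pi (v (-1) z))) / 2"
      using c[OF z, of 1] c[OF z, of "-1"] by simp
  qed
qed

text \<open>The real exponents are approximated rather than \<open>f\<close> itself. Whatever
  continuous exponents occur, the result is a mean of two unimodular functions, so the bound
  survives, and so does the shape that the algebra can reproduce.\<close>

lemma circle_unit_approx:
  assumes f: "f \<in> borel_measurable circle_measure" and b: "AE z in circle_measure. cmod (f z) \<le> 1"
  obtains \<alpha> \<beta> :: "nat \<Rightarrow> complex \<Rightarrow> real"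
  where "\<And>n. continuous_on UNIV (\<alpha> n)" "\<And>n. continuous_on UNIV (\<beta> n)"
    "AE z in circle_measure. (\<lambda>n. (cis (\<alpha> n z) + cis (\<beta> n z)) / 2) \<longlonglongrightarrow> f z"
proof -
  obtain a c where m: "a \<in> borel_measurable circle_measure" "c \<in> borel_measurable circle_measure"
    and eq: "\<And>z. cmod (f z) \<le> 1 \<Longrightarrow> f z = (cis (a z) + cis (c z)) / 2"
    using cis_mean_representation[OF f] by blast
  obtain \<alpha> where \<alpha>: "\<And>n. continuous_on UNIV (\<alpha> n)" "AE z in circle_measure. (\<lambda>n. \<alpha> n z) \<longlonglongrightarrow> a z"
    using circle_real_approx[OF m(1)] by blast
  obtain \<beta> where \<beta>: "\<And>n. continuous_on UNIV (\<beta> n)" "AE z in circle_measure. (\<lambda>n. \<beta> n z) \<longlonglongrightarrow> c z"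
    using circle_real_approx[OF m(2)] by blast
  have "AE z in circle_measure. (\<lambda>n. (cis (\<alpha> n z) + cis (\<beta> n z)) / 2) \<longlonglongrightarrow> f z"
    using \<alpha>(2) \<beta>(2) b
  proof eventually_elim
    case (elim z)
    have "(\<lambda>n. (cis (\<alpha> n z) + cis (\<beta> n z)) / 2) \<longlonglongrightarrow> (cis (a z) + cis (c z)) / 2"
      using elim(1,2) by (intro tendsto_intros) auto
    then show ?case by (simp only: eq[OF elim(3)])
  qed
  then show thesis using that \<alpha>(1) \<beta>(1) by blast
qed

section \<open>Representatives and the weak-star topology\<close>

lemma linf_rel_rep_linf: "linf_rel (rep_linf f) (rep_linf f)"
  by (rule Quotient_rep_reflp[OF Quotient_linf])

lemma abs_rep_linf: "abs_linf (rep_linf f) = f"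
  by (rule Quotient_abs_rep[OF Quotient_linf])

lemma ess_bounded_rep_linf: "ess_bounded (rep_linf f)"
  using linf_rel_rep_linf[of f] by (simp add: linf_rel_def)

lemma measurable_rep_linf [measurable]: "rep_linf f \<in> borel_measurable circle_measure"
  using ess_bounded_rep_linf[of f] by (simp add: ess_bounded_def)

lemma rep_abs_linf:
  assumes "ess_bounded u"
  shows "AE z in circle_measure. rep_linf (abs_linf u) z = u z"
proof -
  have "linf_rel u u" using assms by (simp add: linf_rel_def)
  then have "linf_rel (rep_linf (abs_linf u)) u"
    using Quotient_rep_abs[OF Quotient_linf] by blast
  then show ?thesis by (simp add: linf_rel_def)
qed

lemma linf_eqI:
  assumes "AE z in circle_measure. rep_linf f z = rep_linf g z"
  shows "f = g"
proof -
  have "linf_rel (rep_linf f) (rep_linf g)"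
    using assms ess_bounded_rep_linf by (simp add: linf_rel_def)
  then show ?thesis using Quotient_rel_abs[OF Quotient_linf] abs_rep_linf by metis
qed

lemma rep_linf_0: "AE z in circle_measure. rep_linf 0 z = 0"
  unfolding zero_linf_def using rep_abs_linf[OF ess_bounded_const] by (simp add: zero_linf_def map_fun_def)

lemma rep_linf_1: "AE z in circle_measure. rep_linf 1 z = 1"
  unfolding one_linf_def using rep_abs_linf[OF ess_bounded_const] by simp

lemma rep_linf_add: "AE z in circle_measure. rep_linf (f + g) z = rep_linf f z + rep_linf g z"
  using rep_abs_linf[OF ess_bounded_add[OF ess_bounded_rep_linf[of f] ess_bounded_rep_linf[of g]]]
    plus_linf.abs_eq[OF linf_rel_rep_linf[of f] linf_rel_rep_linf[of g]]
  by (simp add: abs_rep_linf)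

lemma rep_linf_diff: "AE z in circle_measure. rep_linf (f - g) z = rep_linf f z - rep_linf g z"
  using rep_abs_linf[OF ess_bounded_diff[OF ess_bounded_rep_linf[of f] ess_bounded_rep_linf[of g]]]
    minus_linf.abs_eq[OF linf_rel_rep_linf[of f] linf_rel_rep_linf[of g]]
  by (simp add: abs_rep_linf)

lemma rep_linf_mult: "AE z in circle_measure. rep_linf (f * g) z = rep_linf f z * rep_linf g z"
  using rep_abs_linf[OF ess_bounded_mult[OF ess_bounded_rep_linf[of f] ess_bounded_rep_linf[of g]]]
    times_linf.abs_eq[OF linf_rel_rep_linf[of f] linf_rel_rep_linf[of g]]
  by (simp add: abs_rep_linf)

lemma rep_linf_scaleR: "AE z in circle_measure. rep_linf (r *\<^sub>R f) z = r *\<^sub>R rep_linf f z"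
  using rep_abs_linf[OF ess_bounded_scaleR[OF ess_bounded_rep_linf[of f], of r]]
    scaleR_linf.abs_eq[OF linf_rel_rep_linf[of f], of r]
  by (simp add: abs_rep_linf)

lemma rep_linf_scaleC: "AE z in circle_measure. rep_linf (c *\<^sub>C f) z = c * rep_linf f z"
  using rep_abs_linf[OF ess_bounded_cmult[OF ess_bounded_rep_linf[of f], of c]]
    scaleC.abs_eq[OF linf_rel_rep_linf[of f], of c]
  by (simp add: abs_rep_linf)

lemma rep_linf_cnj: "AE z in circle_measure. rep_linf (linf_cnj f) z = cnj (rep_linf f z)"
  using rep_abs_linf[OF ess_bounded_cnj[OF ess_bounded_rep_linf[of f]]]
    linf_cnj.abs_eq[OF linf_rel_rep_linf[of f]]
  by (simp add: abs_rep_linf)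

lemma rep_linf_comp:
  assumes "disc_automorphism \<phi>"
  shows "AE z in circle_measure. rep_linf (linf_comp f \<phi>) z = rep_linf f (\<phi> z)"
  using rep_abs_linf[OF ess_bounded_comp[OF assms ess_bounded_rep_linf[of f]]]
    linf_comp.abs_eq[OF linf_rel_rep_linf[of f], of \<phi>] assms
  by (simp add: abs_rep_linf)

lemma rep_linf_sum:
  "finite I \<Longrightarrow> AE z in circle_measure. rep_linf (\<Sum>i\<in>I. f i) z = (\<Sum>i\<in>I. rep_linf (f i) z)"
proof (induction I rule: finite_induct)
  case empty
  then show ?case using rep_linf_0 by simp
next
  case (insert i I)
  from insert.IH rep_linf_add[of "f i" "\<Sum>i\<in>I. f i"] show ?case
    by eventually_elim (use insert.hyps in simp)
qed

lemma unimodular_iff: "unimodular f \<longleftrightarrow> (AE z in circle_measure. cmod (rep_linf f z) = 1)"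
  using unimodular.abs_eq[OF linf_rel_rep_linf[of f]] by (simp add: abs_rep_linf)

lemma radial_boundary_value_iff:
  "radial_boundary_value F f \<longleftrightarrow>
    (AE z in circle_measure. ((\<lambda>r. F (of_real r * z)) \<longlongrightarrow> rep_linf f z) (at_left 1))"
  using radial_boundary_value.abs_eq[OF linf_rel_rep_linf[of f], of F] by (simp add: abs_rep_linf)

lemma linf_pairing_eq:
  "integrable circle_measure g \<Longrightarrow> linf_pairing f g = (LINT z|circle_measure. rep_linf f z * g z)"
  using linf_pairing.abs_eq[OF linf_rel_rep_linf[of f]] by (simp add: abs_rep_linf fun_eq_iff)

lemma norm_linf_eq: "norm f = ess_norm (rep_linf f)"
  using norm_linf.abs_eq[OF linf_rel_rep_linf[of f]] by (simp add: abs_rep_linf)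

lemma AE_norm_linf: "AE z in circle_measure. cmod (rep_linf f z) \<le> norm f"
  using ess_norm_nonneg_AE(2)[OF ess_bounded_rep_linf] by (simp add: norm_linf_eq)

lemma norm_linf_le:
  "0 \<le> C \<Longrightarrow> AE z in circle_measure. cmod (rep_linf f z) \<le> C \<Longrightarrow> norm f \<le> C"
  unfolding norm_linf_eq by (rule ess_norm_le) auto

lemma linf_cnj_add: "linf_cnj (f + g) = linf_cnj f + linf_cnj g"
  by transfer (auto simp: linf_rel_def ess_bounded_add ess_bounded_cnj)

lemma linf_cnj_scaleC: "linf_cnj (c *\<^sub>C f) = cnj c *\<^sub>C linf_cnj f"
  by transfer (auto simp: linf_rel_def ess_bounded_cmult ess_bounded_cnj)

lemma linf_cnj_0 [simp]: "linf_cnj 0 = 0"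
  by transfer (auto simp: linf_rel_def ess_bounded_const)

lemma scaleC_of_real: "of_real r *\<^sub>C f = r *\<^sub>R f"
  by transfer (auto simp: linf_rel_def ess_bounded_cmult scaleR_conv_of_real)

lemma scaleC_mult_left: "(c *\<^sub>C f) * g = c *\<^sub>C (f * g)"
  by transfer (auto simp: linf_rel_def ess_bounded_cmult ess_bounded_mult)

lemma linf_mult_commute: "f * g = g * (f :: linf)"
  by transfer (auto simp: linf_rel_def ess_bounded_mult mult.commute)

section \<open>Weak-star limits and the weak-star closed unit ball\<close>

lemma topspace_weak_star [simp]: "topspace linf_weak_star = UNIV"
proof -
  have "{f. linf_pairing f (\<lambda>_. 0) \<in> UNIV} = UNIV" by simp
  then have "UNIV \<in> {{f. linf_pairing f g \<in> U} | g U. integrable circle_measure g \<and> open U}"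
    by (intro CollectI exI[of _ "\<lambda>_. 0"] exI[of _ UNIV]) auto
  then show ?thesis unfolding linf_weak_star_def topology_generated_by_topspace by blast
qed

lemma limitin_weak_star:
  assumes "\<And>g. integrable circle_measure g \<Longrightarrow> (\<lambda>n. linf_pairing (F n) g) \<longlonglongrightarrow> linf_pairing f g"
  shows "limitin linf_weak_star F f sequentially"
  unfolding limitin_def
proof (intro conjI allI impI)
  fix U assume U: "openin linf_weak_star U \<and> f \<in> U"
  then have "generate_topology_on {{f. linf_pairing f g \<in> U} | g U. integrable circle_measure g \<and> open U} U"
    by (simp add: linf_weak_star_def openin_topology_generated_by_iff)
  then have "f \<in> U \<longrightarrow> (\<forall>\<^sub>F n in sequentially. F n \<in> U)"
  proof induction
    case (Basis s)
    then obtain g V where "s = {f. linf_pairing f g \<in> V}" "integrable circle_measure g" "open V" by blast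
    then show ?case using assms[of g] by (auto dest: topological_tendstoD)
  next
    case (UN K)
    show ?case
    proof
      assume "f \<in> \<Union>K"
      then obtain k where k: "k \<in> K" "f \<in> k" by blast
      then have "\<forall>\<^sub>F n in sequentially. F n \<in> k" using UN by blast
      then show "\<forall>\<^sub>F n in sequentially. F n \<in> \<Union>K"
        by (rule eventually_mono) (use k in blast)
    qed
  next
    case (Int a b)
    then show ?case by (simp add: eventually_conj_iff)
  qed simp
  then show "\<forall>\<^sub>F n in sequentially. F n \<in> U" using U by simp
qed simp

text \<open>The approximants may lie in the closure rather than in \<open>S\<close>; this lets one
  limit be taken over the results of another. Dominated convergence against each integrable function
  does the rest.\<close>

lemma weak_star_closure_AE_limit:
  assumes F: "\<And>n. F n \<in> linf_weak_star closure_of S"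
    and b: "\<And>n. norm (F n) \<le> C"
    and lim: "AE z in circle_measure. (\<lambda>n. rep_linf (F n) z) \<longlonglongrightarrow> rep_linf f z"
  shows "f \<in> linf_weak_star closure_of S"
proof -
  have "(\<lambda>n. linf_pairing (F n) g) \<longlonglongrightarrow> linf_pairing f g" if g: "integrable circle_measure g" for g
    unfolding linf_pairing_eq[OF g]
  proof (rule integral_dominated_convergence[where w="\<lambda>z. C * cmod (g z)"])
    have [measurable]: "g \<in> borel_measurable circle_measure" using g by auto
    show "(\<lambda>z. rep_linf f z * g z) \<in> borel_measurable circle_measure"
         "\<And>n. (\<lambda>z. rep_linf (F n) z * g z) \<in> borel_measurable circle_measure" by measurable
    show "integrable circle_measure (\<lambda>z. C * cmod (g z))" using g by auto
    show "AE z in circle_measure. (\<lambda>n. rep_linf (F n) z * g z) \<longlonglongrightarrow> rep_linf f z * g z"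
      using lim by eventually_elim (intro tendsto_intros)
    show "AE z in circle_measure. norm (rep_linf (F n) z * g z) \<le> C * cmod (g z)" for n
      using AE_norm_linf[of "F n"]
    proof eventually_elim
      case (elim z)
      then show ?case using b[of n] by (simp add: norm_mult mult_right_mono)
    qed
  qed
  then have "limitin linf_weak_star F f sequentially" by (rule limitin_weak_star)
  then have "f \<in> linf_weak_star closure_of (linf_weak_star closure_of S)"
    unfolding in_closure_of[of _ _ "linf_weak_star closure_of S"]
  proof (intro conjI allI impI)
    fix U assume "f \<in> U \<and> openin linf_weak_star U"
    with \<open>limitin _ _ _ _\<close> have "\<forall>\<^sub>F n in sequentially. F n \<in> U"
      by (simp add: limitin_def)
    then obtain n where "F n \<in> U" by (auto simp: eventually_sequentially)
    then show "\<exists>y. y \<in> linf_weak_star closure_of S \<and> y \<in> U" using F by blast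
  qed simp
  then show ?thesis by simp
qed


text \<open>If \<open>norm f\<close> exceeds one, a single integrable \<open>g\<close> already
  separates \<open>f\<close> from the ball.\<close>

lemma cball_weak_star_closed:
  assumes "S \<subseteq> cball 0 1" "f \<in> linf_weak_star closure_of S"
  shows "norm f \<le> 1"
proof (rule ccontr)
  assume nf: "\<not> norm f \<le> 1"
  let ?f = "rep_linf f"
  \<comment> \<open>\<open>g\<close> is the conjugate phase of \<open>f\<close> where
    \<open>f\<close> exceeds one in modulus. There \<open>f * g\<close> is the modulus of
    \<open>f\<close>, so the pairing with \<open>f\<close> beats the integral of
    \<open>cmod g\<close> by the integral of the excess \<open>D\<close>, whereas no
    \<open>h\<close> of norm at most one beats it.\<close>
  define g where "g z = (if cmod (?f z) > 1 then inverse (cmod (?f z)) *\<^sub>R cnj (?f z) else 0)" for z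
  define D where "D z = max 0 (cmod (?f z) - 1)" for z
  have [measurable]: "(\<lambda>z. cnj (?f z)) \<in> borel_measurable circle_measure"
    using ess_bounded_cnj[OF ess_bounded_rep_linf] by (simp add: ess_bounded_def)
  have [measurable]: "g \<in> borel_measurable circle_measure"
    unfolding g_def by (intro measurable_If borel_measurable_scaleR borel_measurable_inverse) measurable
  have [measurable]: "D \<in> borel_measurable circle_measure"
    unfolding D_def by measurable
  have g1: "cmod (g z) \<le> 1" for z by (auto simp: g_def field_simps)
  have ig: "integrable circle_measure g" "integrable circle_measure (\<lambda>z. cmod (g z))"
    by (rule integrable_circle_bounded[of _ 1]; use g1 in simp)+
  have iD: "integrable circle_measure D"
  proof (rule integrable_circle_bounded[of _ "norm f"])
    show "AE z in circle_measure. norm (D z) \<le> norm f"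
      using AE_norm_linf[of f] by eventually_elim (auto simp: D_def)
  qed simp
  have fg: "?f z * g z = of_real (D z + cmod (g z))" for z
  proof (cases "cmod (?f z) > 1")
    case True
    have nz: "?f z \<noteq> 0" using True by auto
    have "?f z * (inverse (cmod (?f z)) *\<^sub>R cnj (?f z)) = of_real (inverse (cmod (?f z)) * (cmod (?f z))\<^sup>2)"
      by (simp add: scaleR_conv_of_real complex_norm_square del: complex_cnj_complex_of_real)
         (use nz in \<open>simp add: complex_norm_square[symmetric]\<close>)
    also have "inverse (cmod (?f z)) * (cmod (?f z))\<^sup>2 = cmod (?f z)"
      using nz by (simp add: power2_eq_square)
    finally have "?f z * (inverse (cmod (?f z)) *\<^sub>R cnj (?f z)) = of_real (cmod (?f z))" .
    moreover have "D z + cmod (g z) = cmod (?f z)" using True nz by (simp add: D_def g_def)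
    ultimately show ?thesis using True by (simp add: g_def)
  qed (auto simp: g_def D_def)
  have "linf_pairing f g = of_real (LINT z|circle_measure. D z + cmod (g z))"
    using ig by (simp only: linf_pairing_eq fg integral_complex_of_real)
  then have pf: "cmod (linf_pairing f g) = \<bar>(LINT z|circle_measure. D z) + (LINT z|circle_measure. cmod (g z))\<bar>"
    using iD ig by (simp flip: of_real_add)
  have "(LINT z|circle_measure. D z) > 0"
  proof (rule ccontr)
    assume "\<not> ?thesis"
    moreover have "(LINT z|circle_measure. D z) \<ge> 0" by (rule Bochner_Integration.integral_nonneg) (simp add: D_def)
    ultimately have D0: "integral\<^sup>L circle_measure D = 0" by simp
    have "AE z in circle_measure. D z = 0"
      by (rule integral_nonneg_eq_0_iff_AE[THEN iffD1, OF iD _ D0]) (simp add: D_def)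
    then have "AE z in circle_measure. cmod (?f z) \<le> 1"
      by eventually_elim (auto simp: D_def max_def split: if_splits)
    then have "norm f \<le> 1" by (intro norm_linf_le) auto
    then show False using nf by simp
  qed
  moreover have "(LINT z|circle_measure. cmod (g z)) \<ge> 0" by simp
  ultimately have gt: "cmod (linf_pairing f g) > (LINT z|circle_measure. cmod (g z))"
    using pf by linarith
  have le: "cmod (linf_pairing h g) \<le> (LINT z|circle_measure. cmod (g z))" if "h \<in> S" for h
  proof -
    have h: "norm h \<le> 1" using that assms(1) by auto
    have b: "AE z in circle_measure. cmod (rep_linf h z * g z) \<le> cmod (g z)"
      using AE_norm_linf[of h]
    proof eventually_elim
      case (elim z)
      then have "cmod (rep_linf h z) \<le> 1" using h by simp
      then show ?case by (simp add: norm_mult mult_left_le_one_le)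
    qed
    have "cmod (linf_pairing h g) \<le> (LINT z|circle_measure. cmod (rep_linf h z * g z))"
      using ig by (simp add: linf_pairing_eq)
    also have "\<dots> \<le> (LINT z|circle_measure. cmod (g z))"
    proof (rule integral_mono_AE[OF _ ig(2) b])
      show "integrable circle_measure (\<lambda>z. cmod (rep_linf h z * g z))"
      proof (rule integrable_circle_bounded[of _ 1])
        show "AE z in circle_measure. norm (cmod (rep_linf h z * g z)) \<le> 1"
          using b by eventually_elim (use g1 in \<open>auto intro: order_trans\<close>)
      qed measurable
    qed
    finally show ?thesis .
  qed
  let ?U = "- cball 0 (LINT z|circle_measure. cmod (g z)) :: complex set"
  have "openin linf_weak_star {h. linf_pairing h g \<in> ?U}"
    unfolding linf_weak_star_def
    by (intro topology_generated_by_Basis CollectI exI[of _ g] exI[of _ ?U] conjI refl ig open_Compl closed_cball)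
  moreover have "f \<in> {h. linf_pairing h g \<in> ?U}" using gt by simp
  ultimately have "\<exists>h. h \<in> S \<and> h \<in> {h. linf_pairing h g \<in> ?U}"
    using assms(2)[unfolded in_closure_of, THEN conjunct2, rule_format, OF conjI] by (simp only:)
  then obtain h where "h \<in> S" "linf_pairing h g \<in> ?U" by (elim exE conjE) (simp only: mem_Collect_eq)
  then show False using le[of h] by simp
qed

section \<open>Moebius maps and rotation averages of analytic functions\<close>

text \<open>A rotation by \<open>\<eta>\<close>, then the hyperbolic translation along the real axis
  that takes \<open>0\<close> to \<open>r\<close>, then a rotation by \<open>\<zeta>\<close>.
  Precomposing with a rotation changes only \<open>\<eta>\<close>, and the inverse has parameters
  \<open>cnj \<eta>\<close>, \<open>cnj \<zeta>\<close>, \<open>- r\<close>, so rotates and inverses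
  stay within one family.\<close>

definition mobius :: "complex \<Rightarrow> complex \<Rightarrow> real \<Rightarrow> complex \<Rightarrow> complex" where
  "mobius \<zeta> \<eta> r z = \<zeta> * (\<eta> * z + of_real r) / (1 + of_real r * \<eta> * z)"

lemma mobius_norm_identity:
  "(cmod (1 + of_real r * w))\<^sup>2 - (cmod (w + of_real r))\<^sup>2 = (1 - r\<^sup>2) * (1 - (cmod w)\<^sup>2)"
  unfolding cmod_power2 by (simp add: algebra_simps power2_eq_square)

lemma mobius_denominator:
  assumes "\<bar>r\<bar> < 1" "cmod w \<le> 1"
  shows "1 + of_real r * w \<noteq> 0"
proof
  assume "1 + of_real r * w = 0"
  then have "cmod (of_real r * w) = 1"
    by (metis add_eq_0_iff norm_minus_cancel norm_one)
  moreover have "cmod (of_real r * w) \<le> \<bar>r\<bar>"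
    using assms by (simp add: norm_mult mult_left_le)
  ultimately show False using assms(1) by simp
qed

lemma mobius_cball:
  assumes "cmod \<zeta> = 1" "cmod \<eta> = 1" "\<bar>r\<bar> < 1"
  shows "cmod z \<le> 1 \<Longrightarrow> cmod (mobius \<zeta> \<eta> r z) \<le> 1"
    and "cmod z < 1 \<Longrightarrow> cmod (mobius \<zeta> \<eta> r z) < 1"
proof -
  have r2: "0 < 1 - r\<^sup>2" using assms(3) by (simp add: abs_square_less_1)
  have c: "cmod (mobius \<zeta> \<eta> r z) = cmod (\<eta> * z + of_real r) / cmod (1 + of_real r * (\<eta> * z))"
    using assms by (simp add: mobius_def norm_mult norm_divide mult.assoc)
  have w: "cmod (\<eta> * z) = cmod z" using assms by (simp add: norm_mult)
  show "cmod (mobius \<zeta> \<eta> r z) \<le> 1" if z: "cmod z \<le> 1"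
  proof -
    have "(cmod z)\<^sup>2 \<le> 1" using z by (simp add: power_le_one)
    then have "(1 - r\<^sup>2) * (1 - (cmod z)\<^sup>2) \<ge> 0" using r2 by simp
    then have "(cmod (\<eta> * z + of_real r))\<^sup>2 \<le> (cmod (1 + of_real r * (\<eta> * z)))\<^sup>2"
      using mobius_norm_identity[of r "\<eta> * z"] unfolding w by linarith
    then have "cmod (\<eta> * z + of_real r) \<le> cmod (1 + of_real r * (\<eta> * z))"
      by (rule power2_le_imp_le) simp
    then show ?thesis unfolding c
      using mobius_denominator[OF assms(3), of "\<eta> * z"] z w by (simp add: divide_le_eq)
  qed
  show "cmod (mobius \<zeta> \<eta> r z) < 1" if z: "cmod z < 1"
  proof -
    have "(cmod z)\<^sup>2 < 1" using z by (simp add: abs_square_less_1)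
    then have "(1 - r\<^sup>2) * (1 - (cmod z)\<^sup>2) > 0" using r2 by simp
    then have "(cmod (\<eta> * z + of_real r))\<^sup>2 < (cmod (1 + of_real r * (\<eta> * z)))\<^sup>2"
      using mobius_norm_identity[of r "\<eta> * z"] unfolding w by linarith
    then have "cmod (\<eta> * z + of_real r) < cmod (1 + of_real r * (\<eta> * z))"
      by (rule power2_less_imp_less) simp
    then show ?thesis unfolding c
      using mobius_denominator[OF assms(3), of "\<eta> * z"] z w by (simp add: divide_less_eq)
  qed
qed

lemma mobius_inverse:
  assumes "cmod \<zeta> = 1" "cmod \<eta> = 1" "\<bar>r\<bar> < 1" "cmod z \<le> 1"
  shows "mobius (cnj \<eta>) (cnj \<zeta>) (- r) (mobius \<zeta> \<eta> r z) = z"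
proof -
  have u: "cnj \<zeta> * \<zeta> = 1" "cnj \<eta> * \<eta> = 1"
    using assms by (simp_all add: complex_norm_square[symmetric] mult.commute)
  have d: "1 + of_real r * (\<eta> * z) \<noteq> 0"
    using mobius_denominator[OF assms(3), of "\<eta> * z"] assms by (simp add: norm_mult)
  define D where "D = 1 + of_real r * (\<eta> * z)"
  have "\<bar>r\<^sup>2\<bar> \<noteq> 1" using assms(3) by (simp add: abs_square_eq_1 abs_square_less_1)
  then have r2: "1 - (of_real r :: complex)\<^sup>2 \<noteq> 0"
    by (metis abs_one eq_iff_diff_eq_0 of_real_eq_1_iff of_real_power)
  have m: "cnj \<zeta> * mobius \<zeta> \<eta> r z = (\<eta> * z + of_real r) / D"
    using u(1) by (simp add: mobius_def D_def mult.assoc flip: mult.assoc[of "cnj \<zeta>"])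
  have n: "(\<eta> * z + of_real r) / D + of_real (- r) = (1 - (of_real r)\<^sup>2) * (\<eta> * z) / D"
    using d by (simp add: D_def field_simps power2_eq_square)
  have dd: "1 + of_real (- r) * ((\<eta> * z + of_real r) / D) = (1 - (of_real r)\<^sup>2) / D"
    using d by (simp add: D_def field_simps power2_eq_square)
  have "mobius (cnj \<eta>) (cnj \<zeta>) (- r) (mobius \<zeta> \<eta> r z)
     = cnj \<eta> * ((1 - (of_real r)\<^sup>2) * (\<eta> * z) / D) / ((1 - (of_real r)\<^sup>2) / D)"
    unfolding mobius_def[of "cnj \<eta>"] mult.assoc m n dd ..
  also have "\<dots> = (cnj \<eta> * \<eta>) * z"
    using r2 d by (simp add: D_def)
  finally show ?thesis using u by simp
qed

lemma disc_automorphism_mobius: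
  assumes "cmod \<zeta> = 1" "cmod \<eta> = 1" "\<bar>r\<bar> < 1"
  shows "disc_automorphism (mobius \<zeta> \<eta> r)"
  unfolding disc_automorphism_def
proof
  have "\<bar>r\<^sup>2\<bar> \<noteq> 1" using assms(3) by (simp add: abs_square_eq_1 abs_square_less_1)
  then have r2: "1 - (of_real r :: complex)\<^sup>2 \<noteq> 0"
    by (metis abs_one eq_iff_diff_eq_0 of_real_eq_1_iff of_real_power)
  have "(\<zeta> * \<eta>) * 1 - (\<zeta> * of_real r) * (of_real r * \<eta>) = \<zeta> * \<eta> * (1 - (of_real r)\<^sup>2)"
    by (simp add: algebra_simps power2_eq_square)
  also have "\<dots> \<noteq> 0" using assms r2 by auto
  finally have nz: "(\<zeta> * \<eta>) * 1 - (\<zeta> * of_real r) * (of_real r * \<eta>) \<noteq> 0" .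
  have "mobius \<zeta> \<eta> r = (\<lambda>z. (\<zeta> * \<eta> * z + \<zeta> * of_real r) / (of_real r * \<eta> * z + 1))"
    by (auto simp: mobius_def fun_eq_iff algebra_simps)
  with nz show "\<exists>a b c d. a * d - b * c \<noteq> 0 \<and> mobius \<zeta> \<eta> r = (\<lambda>z. (a * z + b) / (c * z + d))"
    by blast
  show "mobius \<zeta> \<eta> r ` ball 0 1 = ball 0 1"
  proof safe
    fix z :: complex assume "z \<in> ball 0 1"
    then show "mobius \<zeta> \<eta> r z \<in> ball 0 1" using mobius_cball(2)[OF assms] by simp
  next
    fix z :: complex assume z: "z \<in> ball 0 1"
    have "mobius (cnj \<eta>) (cnj \<zeta>) (- r) z \<in> ball 0 1"
      using mobius_cball(2)[of "cnj \<eta>" "cnj \<zeta>" "- r" z] assms z by simp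
    moreover have "mobius \<zeta> \<eta> r (mobius (cnj \<eta>) (cnj \<zeta>) (- r) z) = z"
      using mobius_inverse[of "cnj \<eta>" "cnj \<zeta>" "- r" z] assms z by simp
    ultimately show "z \<in> mobius \<zeta> \<eta> r ` ball 0 1" by (metis imageI)
  qed
qed

lemma mobius_rotation: "mobius \<zeta> \<eta> r (w * z) = mobius \<zeta> (\<eta> * w) r z"
  by (simp add: mobius_def mult.assoc)

lemma mobius_0: "mobius \<zeta> \<eta> r 0 = \<zeta> * of_real r"
  by (simp add: mobius_def)

lemma mobius_has_derivative_0:
  "(mobius \<zeta> \<eta> r has_field_derivative \<zeta> * \<eta> * (1 - (of_real r)\<^sup>2)) (at 0)"
  unfolding mobius_def[abs_def]
  by (auto intro!: derivative_eq_intros simp: algebra_simps power2_eq_square)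

text \<open>Compactness of the closed disc leaves a uniform margin. A radius above one makes the
  Taylor series at \<open>0\<close> converge absolutely on the unit circle.\<close>

lemma holomorphic_on_ball_larger:
  assumes "open U" "cball 0 1 \<subseteq> U" "G holomorphic_on U"
  obtains R where "1 < R" "G holomorphic_on ball (0::complex) R"
proof -
  obtain e where e: "e > 0" "(\<Union>x\<in>cball 0 1. ball x e) \<subseteq> U"
    using compact_subset_open_imp_ball_epsilon_subset[of "cball (0::complex) 1" U] assms by auto
  have "ball 0 (1 + e) \<subseteq> U"
  proof
    fix z :: complex assume z: "z \<in> ball 0 (1 + e)"
    show "z \<in> U"
    proof (cases "cmod z \<le> 1")
      case False
      have "z \<noteq> 0" using False by auto
      then have "z - sgn z = of_real (cmod z - 1) * sgn z"
        by (simp add: sgn_div_norm scaleR_conv_of_real algebra_simps)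
      then have "cmod (z - sgn z) = cmod z - 1"
        using False \<open>z \<noteq> 0\<close> by (simp add: norm_mult norm_sgn del: of_real_diff)
      then have "z \<in> ball (sgn z) e" using z by (simp add: dist_norm norm_minus_commute)
      moreover have "sgn z \<in> cball 0 1" using \<open>z \<noteq> 0\<close> by (simp add: norm_sgn)
      ultimately show ?thesis using e(2) by blast
    qed (use assms in auto)
  qed
  then show thesis using that[of "1 + e"] e(1) holomorphic_on_subset[OF assms(3)] by simp
qed

text \<open>The automorphism has modulus at most one on the closed disc, so after the factor
  \<open>s\<close> the argument of \<open>F\<close> stays strictly inside the disc, and by
  continuity it does so slightly beyond the circle.\<close>

lemma holomorphic_scaled_mobius:
  assumes m: "cmod \<zeta> = 1" "cmod \<eta> = 1" "\<bar>r\<bar> < 1" and s: "0 \<le> s" "s < 1"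
    and F: "F holomorphic_on ball 0 1"
  obtains R where "1 < R" "(\<lambda>z. F (of_real s * mobius \<zeta> \<eta> r z)) holomorphic_on ball 0 R"
proof -
  define V where "V = {z. 1 + of_real r * \<eta> * z \<noteq> 0}"
  have oV: "open V" unfolding V_def by (intro open_Collect_neq continuous_intros)
  have hm: "mobius \<zeta> \<eta> r holomorphic_on V"
    unfolding mobius_def by (intro holomorphic_intros) (auto simp: V_def)
  define U where "U = {z \<in> V. of_real s * mobius \<zeta> \<eta> r z \<in> ball 0 1}"
  have hs: "(\<lambda>z. of_real s * mobius \<zeta> \<eta> r z) holomorphic_on V"
    by (intro holomorphic_intros hm)
  have "open (V \<inter> (\<lambda>z. of_real s * mobius \<zeta> \<eta> r z) -` ball 0 1)"
    using continuous_open_preimage[OF holomorphic_on_imp_continuous_on[OF hs] oV open_ball] .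
  then have oU: "open U" by (simp add: U_def vimage_def Int_def)
  have "cball 0 1 \<subseteq> U"
  proof
    fix z :: complex assume z: "z \<in> cball 0 1"
    have "z \<in> V" using mobius_denominator[OF m(3), of "\<eta> * z"] z m by (simp add: V_def norm_mult mult.assoc)
    moreover have "cmod (of_real s * mobius \<zeta> \<eta> r z) \<le> s"
      using mobius_cball(1)[OF m, of z] z s by (simp add: norm_mult mult_left_le)
    ultimately show "z \<in> U" using s by (simp add: U_def)
  qed
  moreover have "(\<lambda>z. F (of_real s * mobius \<zeta> \<eta> r z)) holomorphic_on U"
    using holomorphic_on_compose_gen[OF holomorphic_on_subset[OF hs, of U] F]
    by (simp add: U_def o_def image_subset_iff)
  ultimately show thesis using holomorphic_on_ball_larger[OF oU] that by blast
qed

section \<open>Averages over roots of unity\<close>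

definition root_of_unity :: "nat \<Rightarrow> nat \<Rightarrow> complex" where
  "root_of_unity N j = cis (2 * pi * real j / real N)"

lemma norm_root_of_unity [simp]: "cmod (root_of_unity N j) = 1"
  by (simp add: root_of_unity_def)

lemma sum_roots_of_unity_orthogonal:
  assumes "m < N" "n < N" "m \<noteq> n"
  shows "(\<Sum>j<N. cnj (root_of_unity N j) ^ n * root_of_unity N j ^ m) = 0"
proof -
  define t where "t = 2 * pi * (real m - real n) / real N"
  have N: "real N > 0" using assms by simp
  have "cnj (root_of_unity N j) ^ n * root_of_unity N j ^ m = cis t ^ j" for j
    unfolding root_of_unity_def cis_cnj Complex.DeMoivre cis_mult
    using N by (intro arg_cong[where f=cis]) (simp add: t_def field_simps)
  then have sum_eq: "(\<Sum>j<N. cnj (root_of_unity N j) ^ n * root_of_unity N j ^ m) = (\<Sum>j<N. cis t ^ j)" by (simp only:)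
  have neq: "cis t \<noteq> 1"
  proof
    assume "cis t = 1"
    then have "cos t = 1" by (simp add: complex_eq_iff)
    then obtain k :: int where "t = of_int k * 2 * pi" using cos_one_2pi_int by blast
    then have "pi * (real m - real n) = pi * (real_of_int k * real N)" 
      using N by (simp add: t_def field_simps)
    then have "real m - real n = real_of_int k * real N" by simp
    then have "real_of_int (int m - int n) = real_of_int (k * int N)" by simp
    then have k: "int m - int n = k * int N" using of_int_eq_iff by blast
    have "k < 1"
    proof (rule ccontr)
      assume "\<not> k < 1"
      then have "int N \<le> k * int N" using mult_right_mono[of 1 k "int N"] by simp
      then show False using k assms by linarith
    qed
    moreover have "k > -1"
    proof (rule ccontr)
      assume "\<not> k > -1"
      then have "k * int N \<le> - int N" using mult_right_mono[of k "-1" "int N"] by simp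
      then show False using k assms by linarith
    qed
    ultimately have "k = 0" by simp
    then show False using k assms by simp
  qed
  have "cis t ^ N = cis (real N * t)" by (rule Complex.DeMoivre)
  also have "real N * t = 2 * pi * real_of_int (int m - int n)" using N by (simp add: t_def)
  also have "cis \<dots> = 1" by (simp only: cis_multiple_2pi Ints_of_int)
  finally have "(\<Sum>j<N. cis t ^ j) = 0"
    using sum_gp_strict[of "cis t" N] neq by (simp only: if_False) simp
  then show ?thesis using sum_eq by (simp only:)
qed

text \<open>A discrete version of the projection onto the \<open>n\<close>-th Fourier mode. As a
  finite combination of rotates it does not leave an algebra that is invariant under
  rotations.\<close>

definition rotation_average :: "nat \<Rightarrow> nat \<Rightarrow> (complex \<Rightarrow> complex) \<Rightarrow> complex \<Rightarrow> complex" where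
  "rotation_average n N f z = (\<Sum>j<N. cnj (root_of_unity N j) ^ n * f (root_of_unity N j * z)) / of_nat N"

text \<open>Averaging over the \<open>N\<close>-th roots of unity keeps only the Taylor coefficients whose index is
  congruent to \<open>n\<close> modulo \<open>N\<close>.\<close>

lemma rotation_average_tendsto:
  assumes G: "G holomorphic_on ball 0 R" and R: "1 < R" and e: "e > 0"
  obtains N where "0 < N"
    "\<And>z. cmod z = 1 \<Longrightarrow> cmod (rotation_average n N G z - (deriv ^^ n) G 0 / fact n * z ^ n) < e"
proof -
  define g where "g m = (deriv ^^ m) G 0 / fact m" for m
  have G_sums: "(\<lambda>m. g m * w ^ m) sums G w" if "cmod w < R" for w
    using holomorphic_power_series[OF G, of w] that by (simp add: g_def)
  \<comment> \<open>Convergence at a point beyond radius one gives absolute summability of the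
    coefficients themselves.\<close>
  obtain x where x: "1 < x" "x < R" using dense[OF R] by blast
  have "summable (\<lambda>m. g m * of_real x ^ m)"
    using G_sums[of "of_real x"] x by (auto simp: sums_iff)
  from powser_insidea[OF this, of 1] x have sg: "summable (\<lambda>m. cmod (g m))" by simp
  obtain M where M: "\<And>k. k \<ge> M \<Longrightarrow> norm (\<Sum>i. cmod (g (i + k))) < e"
    using suminf_exist_split[OF e sg] by blast
  \<comment> \<open>Above \<open>n\<close>, so that \<open>n\<close> is the only index below
    \<open>N\<close> that survives the averaging; at least \<open>M\<close>, so that every other
    surviving term lies in a tail smaller than \<open>e\<close>.\<close>
  define N where "N = max (M + 1) (n + 1)"
  have N: "N > 0" "n < N" "N \<ge> M" by (auto simp: N_def)
  show thesis
  proof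
    fix z assume z: "cmod z = 1"
    define c where "c m = (\<Sum>j<N. cnj (root_of_unity N j) ^ n * root_of_unity N j ^ m) / of_nat N" for m
    have c1: "cmod (c m) \<le> 1" for m
    proof -
      have "cmod (\<Sum>j<N. cnj (root_of_unity N j) ^ n * root_of_unity N j ^ m) \<le> (\<Sum>j<N. 1)"
        by (rule sum_norm_le) (simp add: norm_mult norm_power)
      then show ?thesis using N by (simp add: c_def norm_divide)
    qed
    have c0: "c m = (if m = n then 1 else 0)" if "m < N" for m
    proof (cases "m = n")
      case True
      have "cnj (root_of_unity N j) ^ n * root_of_unity N j ^ n = 1" for j
        by (simp flip: power_mult_distrib add: mult.commute[of "cnj _"] complex_norm_square[symmetric])
      then show ?thesis using True N by (simp add: c_def)
    next
      case False
      then show ?thesis using sum_roots_of_unity_orthogonal[OF that N(2)] by (simp add: c_def)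
    qed
    have "(\<lambda>m. (\<Sum>j<N. cnj (root_of_unity N j) ^ n * (g m * (root_of_unity N j * z) ^ m)) / of_nat N)
        sums rotation_average n N G z"
      unfolding rotation_average_def
      by (intro sums_divide sums_sum sums_mult G_sums) (use z R in \<open>simp add: norm_mult\<close>)
    also have "(\<lambda>m. (\<Sum>j<N. cnj (root_of_unity N j) ^ n * (g m * (root_of_unity N j * z) ^ m)) / of_nat N)
        = (\<lambda>m. g m * z ^ m * c m)"
      by (auto simp: c_def fun_eq_iff power_mult_distrib sum_distrib_left sum_distrib_right sum_divide_distrib mult_ac intro!: sum.cong)
    finally have s1: "(\<lambda>m. g m * z ^ m * c m) sums rotation_average n N G z" .
    have "(\<lambda>i. g (i + N) * z ^ (i + N) * c (i + N)) sums
        (rotation_average n N G z - (\<Sum>m<N. g m * z ^ m * c m))"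
      using sums_split_initial_segment[OF s1, of N] by simp
    also have "(\<Sum>m<N. g m * z ^ m * c m) = (\<Sum>m<N. if m = n then g n * z ^ n else 0)"
      by (intro sum.cong) (auto simp: c0)
    also have "\<dots> = g n * z ^ n" using N by simp
    finally have s2: "(\<lambda>i. g (i + N) * z ^ (i + N) * c (i + N)) sums
        (rotation_average n N G z - g n * z ^ n)" .
    have le: "cmod (g (i + N) * z ^ (i + N) * c (i + N)) \<le> cmod (g (i + N))" for i
      using c1 z by (simp add: norm_mult norm_power mult_left_le)
    have sN: "summable (\<lambda>i. cmod (g (i + N)))" using summable_ignore_initial_segment[OF sg] .
    have "cmod (rotation_average n N G z - g n * z ^ n) \<le> (\<Sum>i. cmod (g (i + N)))"
      using norm_suminf_le[OF le sN] s2 by (simp add: sums_iff)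
    also have "\<dots> \<le> norm (\<Sum>i. cmod (g (i + N)))" by simp
    also have "\<dots> < e" using M[OF N(3)] .
    finally show "cmod (rotation_average n N G z - (deriv ^^ n) G 0 / fact n * z ^ n) < e"
      by (simp add: g_def)
  qed (use N in simp)
qed

section \<open>Boundary functions of bounded analytic functions\<close>

lemma measurable_rotation_average:
  assumes "f \<in> borel_measurable circle_measure"
  shows "rotation_average n N f \<in> borel_measurable circle_measure"
  unfolding rotation_average_def[abs_def]
  by (intro borel_measurable_divide borel_measurable_sum borel_measurable_times borel_measurable_const
        measurable_compose[OF measurable_rotation assms]) auto

lemma holomorphic_measurable_bounded:
  assumes "G holomorphic_on ball 0 R" "1 < R"
  shows "G \<in> borel_measurable circle_measure" "integrable circle_measure G"
    "\<exists>C. \<forall>z\<in>sphere 0 1. cmod (G z) \<le> C"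
proof -
  have c: "continuous_on (sphere 0 1) G"
    using holomorphic_on_imp_continuous_on[OF assms(1)]
    by (rule continuous_on_subset) (use assms(2) in auto)
  show m: "G \<in> borel_measurable circle_measure" using c by (rule measurable_circle_continuous)
  show C: "\<exists>C. \<forall>z\<in>sphere 0 1. cmod (G z) \<le> C"
    using compact_imp_bounded[OF compact_continuous_image[OF c compact_sphere]]
    by (auto simp: bounded_iff)
  then obtain C where C: "\<And>z. z \<in> sphere 0 1 \<Longrightarrow> cmod (G z) \<le> C" by blast
  have "AE z in circle_measure. cmod (G z) \<le> C"
    using AE_circle_sphere by eventually_elim (rule C)
  then show "integrable circle_measure G"
    using integrable_circle_bounded[OF m] by blast
qed

lemma integral_rotation_average_0:
  assumes f: "integrable circle_measure f" and N: "0 < N"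
  shows "(LINT z|circle_measure. rotation_average 0 N f z) = (LINT z|circle_measure. f z)"
proof -
  have m: "f \<in> borel_measurable circle_measure" using f by auto
  have i: "integrable circle_measure (\<lambda>z. f (w * z))" if "cmod w = 1" for w
    using integrable_distr[OF measurable_rotation[OF that], of f] distr_rotation[OF that] f by simp
  have "(LINT z|circle_measure. rotation_average 0 N f z) =
      (\<Sum>j<N. LINT z|circle_measure. f (root_of_unity N j * z)) / of_nat N"
    using i by (simp add: rotation_average_def)
  also have "\<dots> = (LINT z|circle_measure. f z)"
    using N by (simp add: integral_rotation[OF _ m])
  finally show ?thesis .
qed

text \<open>Averages with \<open>n = 0\<close> keep the integral, by rotation invariance, and come
  uniformly close to the constant \<open>G 0\<close> on the circle.\<close>

lemma circle_mean_value:
  fixes G :: "complex \<Rightarrow> complex"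
  assumes G: "G holomorphic_on ball 0 R" and R: "1 < R"
  shows "(LINT z|circle_measure. G z) = 2 * pi * G 0"
proof -
  note mb = holomorphic_measurable_bounded[OF G R]
  have small: "cmod ((LINT z|circle_measure. G z) - 2 * pi * G 0) \<le> e" if e: "e > 0" for e
  proof -
    obtain N where N: "0 < N"
      "\<And>z. cmod z = 1 \<Longrightarrow> cmod (rotation_average 0 N G z - (deriv ^^ 0) G 0 / fact 0 * z ^ 0) < e / (2 * pi)"
      by (rule rotation_average_tendsto[OF G R, of "e / (2 * pi)" 0]) (use e in simp, blast)
    have b: "AE z in circle_measure. cmod (rotation_average 0 N G z - G 0) \<le> e / (2 * pi)"
      using AE_circle_sphere by eventually_elim (use N(2) in \<open>auto intro: less_imp_le\<close>)
    have [measurable]: "rotation_average 0 N G \<in> borel_measurable circle_measure"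
      by (rule measurable_rotation_average[OF mb(1)])
    have i: "integrable circle_measure (\<lambda>z. rotation_average 0 N G z - G 0)"
      by (rule integrable_circle_bounded[OF _ b]) measurable
    have i0: "integrable circle_measure (\<lambda>z. G 0)" by simp
    have iA: "integrable circle_measure (rotation_average 0 N G)"
      using Bochner_Integration.integrable_add[OF i i0] by simp
    have "(LINT z|circle_measure. rotation_average 0 N G z - G 0) =
        (LINT z|circle_measure. G z) - 2 * pi * G 0"
      using iA by (simp add: integral_rotation_average_0[OF mb(2) N(1)] measure_circle scaleR_conv_of_real)
    moreover have "cmod (LINT z|circle_measure. rotation_average 0 N G z - G 0) \<le>
        (LINT z|circle_measure. e / (2 * pi))"
      by (rule order_trans[OF integral_norm_bound integral_mono_AE[OF integrable_norm[OF i] _ b]]) simp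
    ultimately show ?thesis by (simp add: measure_circle)
  qed
  have "cmod ((LINT z|circle_measure. G z) - 2 * pi * G 0) \<le> 0"
    by (rule field_le_epsilon) (use small in simp)
  then show ?thesis by simp
qed

text \<open>A radial limit is not preserved by a disc automorphism, so the dilates \<open>F (s z)\<close> are
  composed with the automorphism instead: they are analytic across the circle and converge
  boundedly almost everywhere to the composed boundary function.\<close>

lemma Hinf_mobius_approximation:
  fixes F :: "complex \<Rightarrow> complex"
  assumes F: "F holomorphic_on ball 0 1" "bounded (F ` ball 0 1)" "radial_boundary_value F f"
    and m: "cmod \<zeta> = 1" "cmod \<eta> = 1" "\<bar>r\<bar> < 1"
  obtains G :: "nat \<Rightarrow> complex \<Rightarrow> complex" and C
  where "\<And>k. \<exists>R>1. G k holomorphic_on ball 0 R"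
    "\<And>k z. cmod z \<le> 1 \<Longrightarrow> cmod (G k z) \<le> C"
    "AE z in circle_measure. (\<lambda>k. G k z) \<longlonglongrightarrow> rep_linf (linf_comp f (mobius \<zeta> \<eta> r)) z"
    "(\<lambda>k. G k 0) \<longlonglongrightarrow> F (mobius \<zeta> \<eta> r 0)"
    "(\<lambda>k. deriv (G k) 0) \<longlonglongrightarrow> deriv F (mobius \<zeta> \<eta> r 0) * (\<zeta> * \<eta> * (1 - (of_real r)\<^sup>2))"
proof -
  define \<phi> where "\<phi> = mobius \<zeta> \<eta> r"
  define s where "s k = 1 - 1 / real (k + 2)" for k
  have s: "0 \<le> s k" "s k < 1" for k by (auto simp: s_def)
  have s_lim: "s \<longlonglongrightarrow> 1"
  proof -
    have "(\<lambda>k. 1 / real (k + 2)) \<longlonglongrightarrow> 0"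
      by (intro LIMSEQ_ignore_initial_segment lim_1_over_n)
    from tendsto_diff[OF tendsto_const[of 1] this] show ?thesis by (simp add: s_def[abs_def])
  qed
  have cs_lim: "(\<lambda>k. complex_of_real (s k)) \<longlonglongrightarrow> 1" using tendsto_of_real[OF s_lim] by simp
  have at_left: "filterlim s (at_left 1) sequentially"
    unfolding filterlim_at using s_lim s(2) less_imp_neq[OF s(2)] by simp
  obtain C where C: "\<And>z. z \<in> ball 0 1 \<Longrightarrow> cmod (F z) \<le> C"
    using F(2) unfolding bounded_iff by blast
  note aut = disc_automorphism_mobius[OF m]
  have s_ball: "of_real (s k) * \<phi> z \<in> ball 0 1" if "cmod z \<le> 1" for k z
  proof -
    have "cmod (of_real (s k) * \<phi> z) \<le> s k"
      using mobius_cball(1)[OF m that] s[of k] by (simp add: norm_mult mult_left_le \<phi>_def)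
    then show ?thesis using s[of k] by simp
  qed
  define G where "G k z = F (of_real (s k) * \<phi> z)" for k z
  have p0: "\<phi> 0 \<in> ball 0 1" using mobius_cball(2)[OF m, of 0] by (simp add: \<phi>_def)
  have lim0: "(\<lambda>k. of_real (s k) * \<phi> 0) \<longlonglongrightarrow> \<phi> 0"
    using tendsto_mult[OF cs_lim tendsto_const[of "\<phi> 0"]] by simp
  show thesis
  proof
    show "\<exists>R>1. G k holomorphic_on ball 0 R" for k
      using holomorphic_scaled_mobius[OF m s F(1), of k] unfolding G_def \<phi>_def by metis
    show "cmod (G k z) \<le> C" if "cmod z \<le> 1" for k z
      unfolding G_def by (rule C[OF s_ball[OF that]])
    have "AE z in circle_measure. ((\<lambda>r. F (of_real r * z)) \<longlongrightarrow> rep_linf f z) (at_left 1)"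
      using F(3) by (simp add: radial_boundary_value_iff)
    from disc_automorphism_AE[OF aut this] rep_linf_comp[OF aut, of f]
    show "AE z in circle_measure. (\<lambda>k. G k z) \<longlonglongrightarrow> rep_linf (linf_comp f (mobius \<zeta> \<eta> r)) z"
    proof eventually_elim
      case (elim z)
      show ?case using filterlim_compose[OF elim(1) at_left] elim(2) by (simp add: G_def \<phi>_def)
    qed
    have contF: "continuous_on (ball 0 1) F" "continuous_on (ball 0 1) (deriv F)"
      using F(1) by (auto intro!: holomorphic_on_imp_continuous_on holomorphic_deriv)
    show "(\<lambda>k. G k 0) \<longlonglongrightarrow> F (mobius \<zeta> \<eta> r 0)"
      unfolding G_def \<phi>_def[symmetric]
      by (rule continuous_on_tendsto_compose[OF contF(1) lim0 p0]) (use s_ball[of 0] in simp)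
    have d: "(G k has_field_derivative
        deriv F (of_real (s k) * \<phi> 0) * (of_real (s k) * (\<zeta> * \<eta> * (1 - (of_real r)\<^sup>2)))) (at 0)" for k
      unfolding G_def
    proof (rule DERIV_chain2[of F])
      show "(F has_field_derivative deriv F (of_real (s k) * \<phi> 0)) (at (of_real (s k) * \<phi> 0))"
        using F(1) s_ball[of 0 k] holomorphic_derivI[OF F(1) open_ball] by auto
      show "((\<lambda>z. of_real (s k) * \<phi> z) has_field_derivative
          of_real (s k) * (\<zeta> * \<eta> * (1 - (of_real r)\<^sup>2))) (at 0)"
        unfolding \<phi>_def by (rule DERIV_cmult[OF mobius_has_derivative_0])
    qed
    have "(\<lambda>k. deriv F (of_real (s k) * \<phi> 0)) \<longlonglongrightarrow> deriv F (\<phi> 0)"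
      by (rule continuous_on_tendsto_compose[OF contF(2) lim0 p0]) (use s_ball[of 0] in simp)
    from tendsto_mult[OF this tendsto_mult[OF cs_lim tendsto_const]]
    show "(\<lambda>k. deriv (G k) 0) \<longlonglongrightarrow> deriv F (mobius \<zeta> \<eta> r 0) * (\<zeta> * \<eta> * (1 - (of_real r)\<^sup>2))"
      unfolding DERIV_imp_deriv[OF d] by (simp add: \<phi>_def)
  qed
qed

lemma circle_L1_dominated:
  fixes G :: "nat \<Rightarrow> complex \<Rightarrow> complex"
  assumes [measurable]: "\<And>k. G k \<in> borel_measurable circle_measure" "u \<in> borel_measurable circle_measure"
    and b: "\<And>k. AE z in circle_measure. cmod (G k z) \<le> C"
    and lim: "AE z in circle_measure. (\<lambda>k. G k z) \<longlonglongrightarrow> u z"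
  shows "(\<lambda>k. LINT z|circle_measure. cmod (u z - G k z)) \<longlonglongrightarrow> 0"
    and "(\<lambda>k. LINT z|circle_measure. G k z) \<longlonglongrightarrow> (LINT z|circle_measure. u z)"
proof -
  have "AE z in circle_measure. \<forall>k. cmod (G k z) \<le> C" using b by (simp add: AE_all_countable)
  with lim have bu: "AE z in circle_measure. cmod (u z) \<le> C"
  proof eventually_elim
    case (elim z)
    then show ?case by (intro Lim_norm_ubound[of sequentially "\<lambda>k. G k z"]) auto
  qed
  have "(\<lambda>k. LINT z|circle_measure. cmod (u z - G k z)) \<longlonglongrightarrow> (LINT z|circle_measure. 0)"
  proof (rule integral_dominated_convergence[where w="\<lambda>_. 2 * C"])
    show "AE z in circle_measure. (\<lambda>k. cmod (u z - G k z)) \<longlonglongrightarrow> 0"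
      using lim
    proof eventually_elim
      case (elim z)
      have "(\<lambda>k. cmod (u z - G k z)) \<longlonglongrightarrow> cmod (u z - u z)" by (intro tendsto_intros elim)
      then show ?case by simp
    qed
    show "AE z in circle_measure. norm (cmod (u z - G k z)) \<le> 2 * C" for k
      using bu b[of k] by eventually_elim (auto intro: order_trans[OF norm_triangle_ineq4])
  qed auto
  then show "(\<lambda>k. LINT z|circle_measure. cmod (u z - G k z)) \<longlonglongrightarrow> 0" by simp
  show "(\<lambda>k. LINT z|circle_measure. G k z) \<longlonglongrightarrow> (LINT z|circle_measure. u z)"
    by (rule integral_dominated_convergence[where w="\<lambda>_. C"]) (use lim b in auto)
qed

text \<open>The Poisson formula in invariant form: the mean of the composed boundary function
  evaluates \<open>F\<close> at the image of the centre. For the analytic approximants this is the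
  mean value property at \<open>0\<close>.\<close>

lemma Hinf_mobius_mean:
  fixes F :: "complex \<Rightarrow> complex"
  assumes F: "F holomorphic_on ball 0 1" "bounded (F ` ball 0 1)" "radial_boundary_value F f"
    and m: "cmod \<zeta> = 1" "cmod \<eta> = 1" "\<bar>r\<bar> < 1"
  shows "(LINT z|circle_measure. rep_linf (linf_comp f (mobius \<zeta> \<eta> r)) z) = 2 * pi * F (mobius \<zeta> \<eta> r 0)"
proof -
  obtain G C where hol: "\<And>k::nat. \<exists>R>1. G k holomorphic_on ball 0 R"
    and C: "\<And>k z. cmod z \<le> 1 \<Longrightarrow> cmod (G k z) \<le> C"
    and lim: "AE z in circle_measure. (\<lambda>k. G k z) \<longlonglongrightarrow> rep_linf (linf_comp f (mobius \<zeta> \<eta> r)) z"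
    and lim0: "(\<lambda>k. G k 0) \<longlonglongrightarrow> F (mobius \<zeta> \<eta> r 0)"
    by (rule Hinf_mobius_approximation[OF F m]) blast
  have "(\<lambda>k. LINT z|circle_measure. G k z) \<longlonglongrightarrow> (LINT z|circle_measure. rep_linf (linf_comp f (mobius \<zeta> \<eta> r)) z)"
  proof (rule circle_L1_dominated(2)[OF _ _ _ lim])
    show "G k \<in> borel_measurable circle_measure" for k
      using hol holomorphic_measurable_bounded(1) by blast
    show "AE z in circle_measure. cmod (G k z) \<le> C" for k
      using AE_circle_sphere by eventually_elim (use C in auto)
  qed simp
  moreover have "(LINT z|circle_measure. G k z) = 2 * pi * G k 0" for k
    using hol circle_mean_value by blast
  ultimately have "(\<lambda>k. 2 * pi * G k 0) \<longlonglongrightarrow> (LINT z|circle_measure. rep_linf (linf_comp f (mobius \<zeta> \<eta> r)) z)"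
    by simp
  moreover have "(\<lambda>k. 2 * pi * G k 0) \<longlonglongrightarrow> 2 * pi * F (mobius \<zeta> \<eta> r 0)"
    by (intro tendsto_intros lim0)
  ultimately show ?thesis using LIMSEQ_unique by blast
qed

lemma mobius_identity: "mobius 1 1 0 = (\<lambda>z. z)"
  by (simp add: mobius_def fun_eq_iff)

lemma Hinf_mean:
  fixes F :: "complex \<Rightarrow> complex"
  assumes "F holomorphic_on ball 0 1" "bounded (F ` ball 0 1)" "radial_boundary_value F f"
  shows "(LINT z|circle_measure. rep_linf f z) = 2 * pi * F 0"
proof -
  have aut: "disc_automorphism (mobius 1 1 0)" by (rule disc_automorphism_mobius) auto
  have "linf_comp f (mobius 1 1 0) = f"
    using rep_linf_comp[OF aut, of f] by (intro linf_eqI) (simp add: mobius_identity)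
  then show ?thesis using Hinf_mobius_mean[OF assms, of 1 1 0] by (simp add: mobius_identity)
qed

lemma norm_linf_comp_le:
  assumes "disc_automorphism \<phi>"
  shows "norm (linf_comp f \<phi>) \<le> norm f"
proof (rule norm_linf_le)
  show "AE z in circle_measure. cmod (rep_linf (linf_comp f \<phi>) z) \<le> norm f"
    using rep_linf_comp[OF assms, of f] disc_automorphism_AE[OF assms AE_norm_linf[of f]]
    by eventually_elim simp
qed simp

text \<open>An automorphism moves the centre to \<open>a\<close>, which makes \<open>F a\<close> a
  mean of boundary values. Closedness of \<open>Hinf\<close> rests on this control of the analytic
  extension by the essential norm.\<close>

lemma Hinf_maximum_principle:
  fixes F :: "complex \<Rightarrow> complex"
  assumes F: "F holomorphic_on ball 0 1" "bounded (F ` ball 0 1)" "radial_boundary_value F f"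
    and a: "a \<in> ball 0 1"
  shows "cmod (F a) \<le> norm f"
proof -
  define \<zeta> where "\<zeta> = (if a = 0 then 1 else sgn a)"
  have z: "cmod \<zeta> = 1" by (simp add: \<zeta>_def norm_sgn)
  have a_eq: "\<zeta> * of_real (cmod a) = a"
    by (simp add: \<zeta>_def sgn_div_norm scaleR_conv_of_real)
  have m: "cmod \<zeta> = 1" "cmod 1 = 1" "\<bar>cmod a\<bar> < 1" using z a by auto
  define u where "u = linf_comp f (mobius \<zeta> 1 (cmod a))"
  have u: "AE z in circle_measure. cmod (rep_linf u z) \<le> norm f"
    using AE_norm_linf[of u] norm_linf_comp_le[OF disc_automorphism_mobius[OF m], of f]
    by (auto simp: u_def)
  have "2 * pi * cmod (F a) = cmod (LINT z|circle_measure. rep_linf u z)"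
    using Hinf_mobius_mean[OF F m] by (simp add: u_def mobius_0 a_eq norm_mult)
  also have "\<dots> \<le> (LINT z|circle_measure. cmod (rep_linf u z))" by (rule integral_norm_bound)
  also have "\<dots> \<le> (LINT z|circle_measure. norm f)"
  proof (rule integral_mono_AE[OF _ _ u])
    show "integrable circle_measure (\<lambda>z. cmod (rep_linf u z))"
      by (rule integrable_circle_bounded[of _ "norm f"]) (use u in auto)
  qed simp
  also have "\<dots> = 2 * pi * norm f" by (simp add: measure_circle)
  finally show ?thesis by simp
qed

text \<open>The mean over the circle is evaluation at \<open>0\<close>, hence multiplicative on
  \<open>Hinf\<close>. With \<open>c\<close> the mean of a real \<open>f\<close>, the nonnegative
  function \<open>(f - c)^2\<close> therefore has mean zero.\<close>

lemma Hinf_real_constant: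
  assumes f: "f \<in> Hinf" and re: "AE z in circle_measure. Im (rep_linf f z) = 0"
  shows "\<exists>c::real. AE z in circle_measure. rep_linf f z = of_real c"
proof -
  obtain F where F: "F holomorphic_on ball 0 1" "bounded (F ` ball 0 1)" "radial_boundary_value F f"
    using f by (auto simp: Hinf_def)
  have [measurable]: "(\<lambda>z. Re (rep_linf f z)) \<in> borel_measurable circle_measure" by measurable
  have intf: "integrable circle_measure (rep_linf f)"
    by (rule integrable_circle_bounded[OF _ AE_norm_linf]) simp
  define c where "c = Re (F 0)"
  have "(LINT z|circle_measure. rep_linf f z) = (LINT z|circle_measure. of_real (Re (rep_linf f z)))"
    by (rule integral_cong_AE) (use re in \<open>auto elim!: eventually_mono simp: complex_eq_iff\<close>)
  also have "\<dots> = of_real (LINT z|circle_measure. Re (rep_linf f z))"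
    by (rule integral_complex_of_real)
  finally have "complex_of_real (LINT z|circle_measure. Re (rep_linf f z)) = 2 * pi * F 0"
    using Hinf_mean[OF F] by simp
  then have "Im (2 * pi * F 0) = 0" by (metis Im_complex_of_real)
  then have F0: "F 0 = of_real c" by (simp add: c_def complex_eq_iff)
  define g where "g = f - c *\<^sub>R 1"
  define h where "h = g * g"
  have g: "AE z in circle_measure. rep_linf g z = rep_linf f z - of_real c"
    using rep_linf_diff[of f "c *\<^sub>R 1"] rep_linf_scaleR[of c 1] rep_linf_1
    by eventually_elim (simp add: g_def scaleR_conv_of_real)
  have h: "AE z in circle_measure. rep_linf h z = of_real ((Re (rep_linf f z) - c)\<^sup>2)"
    using g rep_linf_mult[of g g] re
    by eventually_elim (simp add: h_def power2_eq_square complex_eq_iff)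
  define H where "H z = (F z - of_real c) * (F z - of_real c)" for z
  have "H holomorphic_on ball 0 1" unfolding H_def by (intro holomorphic_intros F)
  moreover have "bounded (H ` ball 0 1)"
  proof -
    obtain C where C: "\<And>z. z \<in> ball 0 1 \<Longrightarrow> cmod (F z) \<le> C" using F(2) unfolding bounded_iff by blast
    have "cmod (H z) \<le> (C + \<bar>c\<bar>) * (C + \<bar>c\<bar>)" if "z \<in> ball 0 1" for z
    proof -
      have "cmod (F z - of_real c) \<le> C + \<bar>c\<bar>"
        using C[OF that] norm_triangle_ineq4[of "F z" "of_real c"] by simp
      then show ?thesis unfolding H_def norm_mult by (intro mult_mono) (auto intro: order_trans[OF norm_ge_zero])
    qed
    then show ?thesis unfolding bounded_iff by (intro exI[of _ "(C + \<bar>c\<bar>) * (C + \<bar>c\<bar>)"]) blast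
  qed
  moreover have "radial_boundary_value H h"
    using F(3) g rep_linf_mult[of g g] unfolding radial_boundary_value_iff
  proof eventually_elim
    case (elim z)
    then show ?case unfolding H_def h_def by (simp only:) (intro tendsto_intros elim(1))
  qed
  ultimately have "(LINT z|circle_measure. rep_linf h z) = 2 * pi * H 0" by (rule Hinf_mean)
  also have "H 0 = 0" by (simp add: H_def F0)
  also have "(LINT z|circle_measure. rep_linf h z) = (LINT z|circle_measure. of_real ((Re (rep_linf f z) - c)\<^sup>2))"
    by (rule integral_cong_AE) (use h in auto)
  also have "\<dots> = of_real (LINT z|circle_measure. (Re (rep_linf f z) - c)\<^sup>2)"
    by (rule integral_complex_of_real)
  finally have z: "(LINT z|circle_measure. (Re (rep_linf f z) - c)\<^sup>2) = 0" by simp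
  have "integrable circle_measure (\<lambda>z. (Re (rep_linf f z) - c)\<^sup>2)"
  proof (rule integrable_circle_bounded[of _ "norm h"])
    show "AE z in circle_measure. norm ((Re (rep_linf f z) - c)\<^sup>2) \<le> norm h"
      using h AE_norm_linf[of h]
      by eventually_elim (simp add: norm_power flip: of_real_power of_real_diff)
  qed measurable
  then have "AE z in circle_measure. (Re (rep_linf f z) - c)\<^sup>2 = 0"
    using integral_nonneg_eq_0_iff_AE[of circle_measure "\<lambda>z. (Re (rep_linf f z) - c)\<^sup>2"] z by simp
  with re have "AE z in circle_measure. rep_linf f z = of_real c"
    by eventually_elim (simp add: complex_eq_iff)
  then show ?thesis by blast
qed

section \<open>The algebra of bounded analytic functions is not weak-star convex-transitive\<close>

lemma HinfI:
  assumes "F holomorphic_on ball 0 1" "\<And>z. z \<in> ball 0 1 \<Longrightarrow> cmod (F z) \<le> C" "radial_boundary_value F f"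
  shows "f \<in> Hinf"
  using assms unfolding Hinf_def bounded_iff by blast

lemma HinfE:
  assumes "f \<in> Hinf"
  obtains F C where "F holomorphic_on ball 0 1" "\<And>z. z \<in> ball 0 1 \<Longrightarrow> cmod (F z) \<le> C"
    "bounded (F ` ball 0 1)" "radial_boundary_value F f"
  using assms unfolding Hinf_def bounded_iff by blast

lemma radial_boundary_value_diff:
  assumes "radial_boundary_value F f" "radial_boundary_value G g"
  shows "radial_boundary_value (\<lambda>z. F z - G z) (f - g)"
  using assms rep_linf_diff[of f g] unfolding radial_boundary_value_iff
  by eventually_elim (simp add: tendsto_diff)

lemma Hinf_maximum_principle_diff:
  assumes "F holomorphic_on ball 0 1" "bounded (F ` ball 0 1)" "radial_boundary_value F f"
    "G holomorphic_on ball 0 1" "bounded (G ` ball 0 1)" "radial_boundary_value G g" "a \<in> ball 0 1"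
  shows "cmod (F a - G a) \<le> norm (f - g)"
  by (rule Hinf_maximum_principle[of "\<lambda>z. F z - G z"])
     (use assms in \<open>auto intro!: holomorphic_intros bounded_minus_comp radial_boundary_value_diff\<close>)

text \<open>By the maximum principle a norm-convergent sequence has uniformly Cauchy analytic
  extensions, which allows the radial limit and the limit of the sequence to be exchanged.\<close>

lemma Hinf_closed: "closed Hinf"
  unfolding closed_sequential_limits
proof (intro allI impI, elim conjE)
  fix f l assume f: "\<forall>n::nat. f n \<in> Hinf" and lim: "f \<longlonglongrightarrow> l"
  have "\<exists>F. F holomorphic_on ball 0 1 \<and> bounded (F ` ball 0 1) \<and> radial_boundary_value F (f n)" for n
    using f by (auto simp: Hinf_def)
  then obtain F where F: "\<And>n. F n holomorphic_on ball 0 1" "\<And>n. bounded (F n ` ball 0 1)"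
      "\<And>n. radial_boundary_value (F n) (f n)"
    by metis
  have diff: "cmod (F m a - F n a) \<le> norm (f m - f n)" if "a \<in> ball 0 1" for m n a
    by (rule Hinf_maximum_principle_diff[OF F F that])
  have "Cauchy f" using lim by (rule LIMSEQ_imp_Cauchy)
  have "uniformly_Cauchy_on (ball 0 1) F"
  proof (rule uniformly_Cauchy_onI)
    fix e :: real assume "e > 0"
    then obtain M where M: "\<forall>m\<ge>M. \<forall>n\<ge>M. norm (f m - f n) < e"
      using \<open>Cauchy f\<close> unfolding Cauchy_iff by blast
    show "\<exists>M. \<forall>x\<in>ball 0 1. \<forall>m\<ge>M. \<forall>n\<ge>M. dist (F m x) (F n x) < e"
      unfolding dist_norm using M diff by (intro exI[of _ M]) (meson le_less_trans)
  qed
  then have "uniformly_convergent_on (ball 0 1) F" by (rule Cauchy_uniformly_convergent)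
  then obtain L where L: "uniform_limit (ball 0 1) F L sequentially"
    by (auto simp: uniformly_convergent_on_def)
  have "L holomorphic_on ball 0 1"
  proof (rule holomorphic_uniform_sequence[OF open_ball F(1)])
    fix x :: complex assume "x \<in> ball 0 1"
    then have "\<exists>d>0. cball x d \<subseteq> ball 0 1"
      using open_contains_cball[of "ball (0::complex) 1"] open_ball by blast
    then show "\<exists>d>0. cball x d \<subseteq> ball 0 1 \<and> uniform_limit (cball x d) F L sequentially"
      using uniform_limit_on_subset[OF L] by blast
  qed
  obtain N where N: "\<forall>x\<in>ball 0 1. dist (F N x) (L x) < 1"
    using uniform_limitD[OF L zero_less_one] by (auto simp: eventually_sequentially)
  obtain C where C: "\<And>z. z \<in> ball 0 1 \<Longrightarrow> cmod (F N z) \<le> C"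
    using F(2)[of N] unfolding bounded_iff by blast
  have "cmod (L z) \<le> C + 1" if "z \<in> ball 0 1" for z
  proof -
    have "cmod (F N z - L z) < 1" using N that by (auto simp: dist_norm)
    then show ?thesis using C[OF that] norm_triangle_sub[of "L z" "F N z"] by (simp add: norm_minus_commute)
  qed
  moreover have "radial_boundary_value L l"
  proof -
    have "AE z in circle_measure. \<forall>n. ((\<lambda>r. F n (of_real r * z)) \<longlongrightarrow> rep_linf (f n) z) (at_left 1)"
      using F(3) by (simp add: AE_all_countable radial_boundary_value_iff)
    moreover have "AE z in circle_measure. \<forall>n. cmod (rep_linf (f n - l) z) \<le> norm (f n - l)"
      using AE_norm_linf by (simp add: AE_all_countable)
    moreover have "AE z in circle_measure. \<forall>n. rep_linf (f n - l) z = rep_linf (f n) z - rep_linf l z"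
      using rep_linf_diff by (simp add: AE_all_countable)
    ultimately show ?thesis unfolding radial_boundary_value_iff using AE_circle_sphere
    proof eventually_elim
      case (elim z)
      show ?case
      proof (rule tendstoI)
        fix e :: real assume "e > 0"
        then have e3: "e / 3 > 0" by simp
        have "\<forall>\<^sub>F n in sequentially. norm (f n - l) < e / 3"
          using tendstoD[OF lim e3] by (simp add: dist_norm)
        moreover have "\<forall>\<^sub>F n in sequentially. \<forall>x\<in>ball 0 1. dist (F n x) (L x) < e / 3"
          using uniform_limitD[OF L e3] .
        ultimately have "\<forall>\<^sub>F n in sequentially. norm (f n - l) < e / 3 \<and> (\<forall>x\<in>ball 0 1. dist (F n x) (L x) < e / 3)"
          by (rule eventually_conj)
        then obtain n where n: "norm (f n - l) < e / 3" "\<And>x. x \<in> ball 0 1 \<Longrightarrow> dist (F n x) (L x) < e / 3"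
          by (auto simp: eventually_sequentially)
        have "\<forall>\<^sub>F r in at_left (1::real). r \<in> {0<..<1}" by (rule eventually_at_left_real) simp
        moreover have "\<forall>\<^sub>F r in at_left 1. dist (F n (of_real r * z)) (rep_linf (f n) z) < e / 3"
          by (rule tendstoD[OF elim(1)[rule_format] e3])
        ultimately show "\<forall>\<^sub>F r in at_left 1. dist (L (of_real r * z)) (rep_linf l z) < e"
        proof eventually_elim
          case (elim r)
          then have "dist (F n (of_real r * z)) (L (of_real r * z)) < e / 3"
            using n(2) \<open>z \<in> sphere 0 1\<close> by (simp add: norm_mult)
          moreover have "dist (rep_linf (f n) z) (rep_linf l z) < e / 3"
            using \<open>\<forall>n. cmod (rep_linf (f n - l) z) \<le> _ n\<close> \<open>\<forall>n. rep_linf (f n - l) z = _ n\<close> n(1)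
            by (metis dist_norm le_less_trans)
          ultimately show ?case using elim(2)
            dist_triangle2[of "L (of_real r * z)" "rep_linf l z" "rep_linf (f n) z"]
            dist_triangle2[of "L (of_real r * z)" "rep_linf (f n) z" "F n (of_real r * z)"]
            by (simp add: dist_commute)
        qed
      qed
    qed
  qed
  ultimately show "l \<in> Hinf" using \<open>L holomorphic_on _\<close> HinfI by blast
qed

lemma Hinf_closed_subalgebra: "closed_subalgebra Hinf"
  unfolding closed_subalgebra_def
proof (intro conjI ballI allI Hinf_closed)
  show "0 \<in> Hinf"
    by (rule HinfI[of "\<lambda>_. 0" 0])
       (use rep_linf_0 in \<open>auto simp: radial_boundary_value_iff elim!: eventually_mono\<close>)
next
  fix f g assume "f \<in> Hinf" "g \<in> Hinf"
  then obtain F C G D where F: "F holomorphic_on ball 0 1" "\<And>z. z \<in> ball 0 1 \<Longrightarrow> cmod (F z) \<le> C"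
      "radial_boundary_value F f"
    and G: "G holomorphic_on ball 0 1" "\<And>z. z \<in> ball 0 1 \<Longrightarrow> cmod (G z) \<le> D"
      "radial_boundary_value G g"
    by (metis HinfE)
  show "f + g \<in> Hinf"
  proof (rule HinfI)
    show "(\<lambda>z. F z + G z) holomorphic_on ball 0 1" by (intro holomorphic_intros F G)
    show "cmod (F z + G z) \<le> C + D" if "z \<in> ball 0 1" for z
      using F(2)[OF that] G(2)[OF that] by (rule norm_triangle_mono)
    show "radial_boundary_value (\<lambda>z. F z + G z) (f + g)"
      using F(3) G(3) rep_linf_add[of f g] unfolding radial_boundary_value_iff
      by eventually_elim (simp add: tendsto_add)
  qed
  show "f * g \<in> Hinf"
  proof (rule HinfI)
    show "(\<lambda>z. F z * G z) holomorphic_on ball 0 1" by (intro holomorphic_intros F G)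
    show "cmod (F z * G z) \<le> C * D" if "z \<in> ball 0 1" for z
      using F(2)[OF that] G(2)[OF that] unfolding norm_mult
      by (intro mult_mono) (auto intro: order_trans[OF norm_ge_zero])
    show "radial_boundary_value (\<lambda>z. F z * G z) (f * g)"
      using F(3) G(3) rep_linf_mult[of f g] unfolding radial_boundary_value_iff
      by eventually_elim (simp add: tendsto_mult)
  qed
next
  fix c f assume "f \<in> Hinf"
  then obtain F C where F: "F holomorphic_on ball 0 1" "\<And>z. z \<in> ball 0 1 \<Longrightarrow> cmod (F z) \<le> C"
      "radial_boundary_value F f"
    by (metis HinfE)
  show "c *\<^sub>C f \<in> Hinf"
  proof (rule HinfI)
    show "(\<lambda>z. c * F z) holomorphic_on ball 0 1" by (intro holomorphic_intros F)
    show "cmod (c * F z) \<le> cmod c * C" if "z \<in> ball 0 1" for z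
      using F(2)[OF that] by (simp add: norm_mult mult_left_mono)
    show "radial_boundary_value (\<lambda>z. c * F z) (c *\<^sub>C f)"
      using F(3) rep_linf_scaleC[of c f] unfolding radial_boundary_value_iff
      by eventually_elim (simp add: tendsto_mult)
  qed
qed

lemma one_in_Hinf: "1 \<in> Hinf"
  by (rule HinfI[of "\<lambda>_. 1" 1])
     (use rep_linf_1 in \<open>auto simp: radial_boundary_value_iff elim!: eventually_mono\<close>)

section \<open>Surjective isometries of \<open>Hinf\<close> and the image of the unit\<close>

lemma norm_affine_square:
  "(cmod (1 + \<i> * of_real t * w))\<^sup>2 = 1 - 2 * t * Im w + t\<^sup>2 * (cmod w)\<^sup>2"
  unfolding cmod_power2 by (simp add: power2_eq_square algebra_simps)

text \<open>For \<open>cmod w = 1\<close> the number \<open>1 + w * w\<close> is a real multiple of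
  \<open>w\<close>, so the displacement is orthogonal to \<open>w\<close> and the modulus grows only
  to second order. Inside the disc the deficit \<open>s\<close> absorbs the linear term. The
  constant 8 is 4, from the bound 2 on \<open>cmod (1 + w * w)\<close>, plus 4, from absorbing the
  linear term.\<close>

lemma norm_perturbation_bound:
  assumes w: "cmod w \<le> 1"
  shows "(cmod (w + \<i> * of_real t * (1 + w * w)))\<^sup>2 \<le> 1 + 8 * t\<^sup>2"
proof -
  define s where "s = 1 - (cmod w)\<^sup>2"
  have s: "0 \<le> s" "s \<le> 1" using w by (simp_all add: s_def power_le_one)
  have "cmod (1 + w * w) \<le> 1 + 1 * 1"
    using w by (intro norm_triangle_mono) (auto simp: norm_mult mult_le_one)
  then have "(cmod (1 + w * w))\<^sup>2 \<le> 2\<^sup>2" by (intro power_mono) auto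
  then have q: "t\<^sup>2 * (cmod (1 + w * w))\<^sup>2 \<le> t\<^sup>2 * 4" by (intro mult_left_mono) auto
  have eq: "(cmod (w + \<i> * of_real t * (1 + w * w)))\<^sup>2 = (1 - s) + 2 * t * Im w * s + t\<^sup>2 * (cmod (1 + w * w))\<^sup>2"
    unfolding cmod_power2 s_def by (simp add: power2_eq_square algebra_simps)
  have "\<bar>Im w\<bar> \<le> 1" using abs_Im_le_cmod[of w] w by linarith
  then have "\<bar>t * Im w * s\<bar> \<le> \<bar>t\<bar> * 1 * s" using s unfolding abs_mult by (intro mult_mono) auto
  then have m: "2 * t * Im w * s \<le> 2 * \<bar>t\<bar> * s" by (simp add: abs_le_iff)
  have "2 * \<bar>t\<bar> * s \<le> s + 4 * t\<^sup>2"
  proof (cases "\<bar>t\<bar> \<le> 1 / 2")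
    case True
    then have "2 * \<bar>t\<bar> * s \<le> 1 * s" using s by (intro mult_right_mono) auto
    then show ?thesis using zero_le_power2[of t] by linarith
  next
    case False
    have "2 * \<bar>t\<bar> * s \<le> 2 * \<bar>t\<bar> * 1" using s by (intro mult_left_mono) auto
    also have "\<dots> \<le> 2 * \<bar>t\<bar> * (2 * \<bar>t\<bar>)" using False by (intro mult_left_mono) auto
    also have "\<dots> = 4 * t\<^sup>2" by (simp add: power2_eq_square)
    finally show ?thesis using s by linarith
  qed
  then show ?thesis using eq q m by linarith
qed

lemma square_real_cases:
  assumes "w * w = complex_of_real d"
  shows "d \<ge> 0 \<Longrightarrow> Im w = 0" "d \<le> 0 \<Longrightarrow> Re w = 0"
proof -
  have e: "Re w * Re w - Im w * Im w = d" "Re w * Im w = 0"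
    using arg_cong[OF assms, of Re] arg_cong[OF assms, of Im] by auto
  show "Im w = 0" if "d \<ge> 0"
    using e that not_real_square_gt_zero[of "Im w"] by (cases "Re w = 0") auto
  show "Re w = 0" if "d \<le> 0"
    using e that not_real_square_gt_zero[of "Re w"] by (cases "Im w = 0") auto
qed

text \<open>Among all \<open>f\<close> in the algebra, those with \<open>\<parallel>v + itf\<parallel>\<^sup>2 \<le> 1 + C t\<^sup>2\<close> for
  some \<open>C\<close> and all real \<open>t\<close> correspond to those for \<open>1\<close> under an isometry sending \<open>1\<close> to \<open>v\<close>. At \<open>v = 1\<close> only real constants occur, whereas \<open>1 + v\<^sup>2\<close> always occurs.\<close>

lemma Hinf_isometry_one_constant:
  assumes T: "T \<in> isometry_group Hinf"
  shows "\<exists>c. T 1 = c *\<^sub>C 1"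
proof -
  note alg = Hinf_closed_subalgebra[unfolded closed_subalgebra_def]
  have bij: "bij_betw T Hinf Hinf"
    and Tadd: "\<And>f g. f \<in> Hinf \<Longrightarrow> g \<in> Hinf \<Longrightarrow> T (f + g) = T f + T g"
    and Tsc: "\<And>c f. f \<in> Hinf \<Longrightarrow> T (c *\<^sub>C f) = c *\<^sub>C T f"
    and Tn: "\<And>f. f \<in> Hinf \<Longrightarrow> norm (T f) = norm f"
    using T by (auto simp: isometry_group_def)
  define u where "u = T 1"
  have u: "u \<in> Hinf" using bij one_in_Hinf by (auto simp: u_def bij_betw_def)
  have nu: "norm u = 1" using Tn[OF one_in_Hinf] by (simp add: u_def)
  \<comment> \<open>\<open>1 + u * u\<close> is a direction with a second-order bound at any
    \<open>u\<close> in the unit ball. Its preimage \<open>g\<close> inherits the bound at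
    \<open>1\<close>, where it forces the imaginary part of \<open>g\<close> to vanish.\<close>
  have "1 + u * u \<in> Hinf" using alg u one_in_Hinf by auto
  then obtain g where g: "g \<in> Hinf" "T g = 1 + u * u"
    using bij by (auto simp: bij_betw_def) (metis imageE)
  have bound: "(norm (1 + (\<i> * of_real t) *\<^sub>C g))\<^sup>2 \<le> 1 + 8 * t\<^sup>2" for t :: real
  proof -
    have "T (1 + (\<i> * of_real t) *\<^sub>C g) = u + (\<i> * of_real t) *\<^sub>C (1 + u * u)"
      using Tadd[of 1 "(\<i> * of_real t) *\<^sub>C g"] Tsc[OF g(1)] alg one_in_Hinf g by (simp add: u_def)
    moreover have "1 + (\<i> * of_real t) *\<^sub>C g \<in> Hinf" using alg g one_in_Hinf by auto
    ultimately have "norm (1 + (\<i> * of_real t) *\<^sub>C g) = norm (u + (\<i> * of_real t) *\<^sub>C (1 + u * u))"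
      using Tn by metis
    also have "\<dots> \<le> sqrt (1 + 8 * t\<^sup>2)"
    proof (rule norm_linf_le)
      show "AE z in circle_measure. cmod (rep_linf (u + (\<i> * of_real t) *\<^sub>C (1 + u * u)) z) \<le> sqrt (1 + 8 * t\<^sup>2)"
        using rep_linf_add[of u "(\<i> * of_real t) *\<^sub>C (1 + u * u)"] rep_linf_scaleC[of "\<i> * of_real t" "1 + u * u"]
          rep_linf_add[of 1 "u * u"] rep_linf_1 rep_linf_mult[of u u] AE_norm_linf[of u]
      proof eventually_elim
        case (elim z)
        then show ?case using norm_perturbation_bound[of "rep_linf u z" t] nu
          by (simp add: real_le_rsqrt)
      qed
    qed simp
    finally have "(norm (1 + (\<i> * of_real t) *\<^sub>C g))\<^sup>2 \<le> (sqrt (1 + 8 * t\<^sup>2))\<^sup>2"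
      by (intro power_mono) auto
    then show ?thesis by simp
  qed
  have ae: "AE z in circle_measure. - 2 * t * Im (rep_linf g z) \<le> 8 * t\<^sup>2" for t :: real
    using rep_linf_add[of 1 "(\<i> * of_real t) *\<^sub>C g"] rep_linf_1 rep_linf_scaleC[of "\<i> * of_real t" g]
      AE_norm_linf[of "1 + (\<i> * of_real t) *\<^sub>C g"]
  proof eventually_elim
    case (elim z)
    then have "cmod (1 + \<i> * of_real t * rep_linf g z) \<le> norm (1 + (\<i> * of_real t) *\<^sub>C g)" by simp
    then have "(cmod (1 + \<i> * of_real t * rep_linf g z))\<^sup>2 \<le> (norm (1 + (\<i> * of_real t) *\<^sub>C g))\<^sup>2"
      by (intro power_mono) auto
    then have "1 - 2 * t * Im (rep_linf g z) + t\<^sup>2 * (cmod (rep_linf g z))\<^sup>2 \<le> 1 + 8 * t\<^sup>2"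
      using bound[of t] unfolding norm_affine_square by linarith
    moreover have "0 \<le> t\<^sup>2 * (cmod (rep_linf g z))\<^sup>2" by simp
    ultimately show ?case by linarith
  qed
  \<comment> \<open>Countably many \<open>t\<close>, so that one null set serves them all, and both
    signs, so that the imaginary part is bounded on both sides by \<open>4 / Suc n\<close>.\<close>
  have "AE z in circle_measure. \<forall>n. - 2 * (1 / real (Suc n)) * Im (rep_linf g z) \<le> 8 * (1 / real (Suc n))\<^sup>2"
    by (rule AE_all_countable[THEN iffD2]) (intro allI ae)
  moreover have "AE z in circle_measure. \<forall>n. - 2 * (- (1 / real (Suc n))) * Im (rep_linf g z) \<le> 8 * (- (1 / real (Suc n)))\<^sup>2"
    by (rule AE_all_countable[THEN iffD2]) (intro allI ae)
  ultimately have "AE z in circle_measure. Im (rep_linf g z) = 0"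
  proof eventually_elim
    case (elim z)
    have "real (Suc n) * \<bar>Im (rep_linf g z)\<bar> \<le> 4" for n
    proof -
      have p: "real (Suc n) > 0" by simp
      have "- 2 * (1 / real (Suc n)) * Im (rep_linf g z) * (real (Suc n))\<^sup>2 \<le> 8 * (1 / real (Suc n))\<^sup>2 * (real (Suc n))\<^sup>2"
           "- 2 * (- (1 / real (Suc n))) * Im (rep_linf g z) * (real (Suc n))\<^sup>2 \<le> 8 * (- (1 / real (Suc n)))\<^sup>2 * (real (Suc n))\<^sup>2"
        using elim by (intro mult_right_mono; simp del: of_nat_Suc)+
      then have "- 2 * Im (rep_linf g z) * real (Suc n) \<le> 8" "2 * Im (rep_linf g z) * real (Suc n) \<le> 8"
        using p by (simp_all add: power2_eq_square field_simps del: of_nat_Suc)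
      then show ?thesis by (auto simp: abs_if algebra_simps simp del: of_nat_Suc)
    qed
    note le = this
    show ?case
    proof (rule ccontr)
      assume "Im (rep_linf g z) \<noteq> 0"
      then obtain n where "4 < real n * \<bar>Im (rep_linf g z)\<bar>"
        using reals_Archimedean3[of "\<bar>Im (rep_linf g z)\<bar>"] by auto
      also have "\<dots> \<le> real (Suc n) * \<bar>Im (rep_linf g z)\<bar>" by (intro mult_right_mono) auto
      finally show False using le[of n] by simp
    qed
  qed
  then obtain c :: real where c: "AE z in circle_measure. rep_linf g z = of_real c"
    using Hinf_real_constant[OF g(1)] by blast
  have "g = of_real c *\<^sub>C 1"
    using c rep_linf_scaleC[of "of_real c" 1] rep_linf_1
    by (intro linf_eqI) (auto elim: eventually_elim2)
  \<comment> \<open>\<open>u\<close> solves a quadratic equation with real coefficients, so a.e. it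
    takes at most two values. It remains to exclude that it takes both.\<close>
  then have qe: "1 + u * u = of_real c *\<^sub>C u" using g(2) Tsc[OF one_in_Hinf] by (simp add: u_def)
  have quad: "AE z in circle_measure. 1 + rep_linf u z * rep_linf u z = of_real c * rep_linf u z"
    using rep_linf_add[of 1 "u * u"] rep_linf_1 rep_linf_mult[of u u] rep_linf_scaleC[of "of_real c" u]
    by eventually_elim (simp add: qe)
  define d where "d = c\<^sup>2 / 4 - 1"
  \<comment> \<open>By the sign of \<open>d\<close>, the function \<open>u - c / 2\<close> is real
    a.e. or purely imaginary a.e. Multiplication by \<open>k\<close>, later \<open>1\<close> or
    \<open>\<i>\<close>, turns it into a real element of \<open>Hinf\<close>, hence a
    constant.\<close>
  have const: "\<exists>a. u = a *\<^sub>C 1" if k: "k * k = 1 \<or> k * k = -1"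
    and im: "AE z in circle_measure. Im (k * (rep_linf u z - of_real (c / 2))) = 0" for k
  proof -
    define v where "v = k *\<^sub>C (u + of_real (- c / 2) *\<^sub>C 1)"
    have v: "v \<in> Hinf" unfolding v_def using alg u one_in_Hinf by metis
    have repv: "AE z in circle_measure. rep_linf v z = k * (rep_linf u z - of_real (c / 2))"
      using rep_linf_scaleC[of k "u + of_real (- c / 2) *\<^sub>C 1"] rep_linf_add[of u "of_real (- c / 2) *\<^sub>C 1"]
        rep_linf_scaleC[of "of_real (- c / 2)" 1] rep_linf_1
      unfolding v_def by eventually_elim simp
    have "AE z in circle_measure. Im (rep_linf v z) = 0"
      using repv im by eventually_elim simp
    then obtain b :: real where b: "AE z in circle_measure. rep_linf v z = of_real b"
      using Hinf_real_constant[OF v] by blast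
    have k0: "k \<noteq> 0" using k by auto
    have "u = (of_real b / k + of_real (c / 2)) *\<^sub>C 1"
    proof (rule linf_eqI)
      show "AE z in circle_measure. rep_linf u z = rep_linf ((of_real b / k + of_real (c / 2)) *\<^sub>C 1) z"
        using b repv rep_linf_scaleC[of "of_real b / k + of_real (c / 2)" 1] rep_linf_1
      proof eventually_elim
        case (elim z)
        then have "k * (rep_linf u z - of_real (c / 2)) = of_real b" by simp
        then have "rep_linf u z - of_real (c / 2) = of_real b / k" using k0 by (metis nonzero_mult_div_cancel_left)
        then show ?case using elim by (simp add: algebra_simps)
      qed
    qed
    then show ?thesis by blast
  qed
  have sq: "AE z in circle_measure. (rep_linf u z - of_real (c / 2)) * (rep_linf u z - of_real (c / 2)) = of_real d"
    using quad
  proof eventually_elim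
    case (elim z)
    have "(rep_linf u z - of_real (c / 2)) * (rep_linf u z - of_real (c / 2)) =
        (1 + rep_linf u z * rep_linf u z) - of_real c * rep_linf u z + of_real (c\<^sup>2 / 4 - 1)"
      by (simp add: algebra_simps power2_eq_square)
    then show ?case using elim by (simp add: d_def)
  qed
  have "\<exists>a. u = a *\<^sub>C 1"
  proof (cases "d \<ge> 0")
    case True
    show ?thesis
      by (rule const[of 1]) (use sq in \<open>auto elim!: eventually_mono dest: square_real_cases(1)[OF _ True]\<close>)
  next
    case False
    then have d: "d \<le> 0" by simp
    show ?thesis
      by (rule const[of \<i>]) (use sq in \<open>auto elim!: eventually_mono dest: square_real_cases(2)[OF _ d]\<close>)
  qed
  then show ?thesis by (simp add: u_def)
qed

definition linf_coordinate :: linf where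
  "linf_coordinate = abs_linf (\<lambda>z. z)"

lemma rep_linf_coordinate: "AE z in circle_measure. rep_linf linf_coordinate z = z"
  unfolding linf_coordinate_def
proof (rule rep_abs_linf, rule ess_boundedI)
  show "(\<lambda>z. z) \<in> borel_measurable circle_measure" by (rule measurable_circleI) simp
  show "AE z in circle_measure. cmod z \<le> 1" using AE_circle_sphere by eventually_elim simp
qed

lemma linf_coordinate_in_Hinf: "linf_coordinate \<in> Hinf"
proof (rule HinfI[of "\<lambda>z. z" 1])
  show "radial_boundary_value (\<lambda>z. z) linf_coordinate"
    unfolding radial_boundary_value_iff using rep_linf_coordinate
  proof eventually_elim
    case (elim z)
    have "((\<lambda>r. complex_of_real r * z) \<longlongrightarrow> of_real 1 * z) (at_left 1)" by (intro tendsto_intros)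
    then show ?case using elim by simp
  qed
qed auto

text \<open>Pairing with \<open>cnj\<close> reads off the first Fourier coefficient. It vanishes on
  the constants, hence on the hull of the orbit of \<open>1\<close>, but is \<open>2 * pi\<close> at
  the coordinate function, which lies in the unit ball.\<close>

lemma Hinf_not_weak_star_convex_transitive: "\<not> weak_star_convex_transitive Hinf"
proof
  assume tr: "weak_star_convex_transitive Hinf"
  have "1 \<in> Hinf \<inter> sphere 0 1" using one_in_Hinf by simp
  then have eq: "subtopology linf_weak_star Hinf closure_of (convex hull {T 1 | T. T \<in> isometry_group Hinf})
      = Hinf \<inter> cball 0 1"
    using tr unfolding weak_star_convex_transitive_def weak_star_convex_transitive_wrt_def by blast
  have "norm linf_coordinate \<le> 1"
  proof (rule norm_linf_le)
    show "AE z in circle_measure. cmod (rep_linf linf_coordinate z) \<le> 1"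
      using rep_linf_coordinate AE_circle_sphere by eventually_elim simp
  qed simp
  then have "linf_coordinate \<in> Hinf \<inter> cball 0 1" using linf_coordinate_in_Hinf by simp
  then have cl: "linf_coordinate \<in> linf_weak_star closure_of (Hinf \<inter> convex hull {T 1 | T. T \<in> isometry_group Hinf})"
    unfolding eq[symmetric] closure_of_subtopology by simp
  define K where "K = range (\<lambda>c. c *\<^sub>C (1::linf))"
  have "convex K"
  proof (rule convexI)
    fix x y :: linf and a b :: real assume "x \<in> K" "y \<in> K"
    then obtain c d where "x = c *\<^sub>C 1" "y = d *\<^sub>C 1" by (auto simp: K_def)
    note xy = this
    have "a *\<^sub>R x + b *\<^sub>R y = (of_real a * c + of_real b * d) *\<^sub>C 1"
    proof (rule linf_eqI)
      show "AE z in circle_measure. rep_linf (a *\<^sub>R x + b *\<^sub>R y) z = rep_linf ((of_real a * c + of_real b * d) *\<^sub>C 1) z"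
        using rep_linf_add[of "a *\<^sub>R x" "b *\<^sub>R y"] rep_linf_scaleR[of a x] rep_linf_scaleR[of b y]
          rep_linf_scaleC[of c 1] rep_linf_scaleC[of d 1] rep_linf_scaleC[of "of_real a * c + of_real b * d" 1]
        by eventually_elim (simp only: xy, simp add: algebra_simps scaleR_conv_of_real[where 'a=complex])
    qed
    then show "a *\<^sub>R x + b *\<^sub>R y \<in> K" by (auto simp: K_def)
  qed
  moreover have "{T 1 | T. T \<in> isometry_group Hinf} \<subseteq> K"
    using Hinf_isometry_one_constant by (auto simp: K_def)
  ultimately have hull: "convex hull {T 1 | T. T \<in> isometry_group Hinf} \<subseteq> K"
    by (rule hull_minimal[rotated])
  have cm: "integrable circle_measure (\<lambda>z::complex. z)" "(LINT z|circle_measure. z) = (0::complex)"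
    using holomorphic_measurable_bounded(2)[of "\<lambda>z. z" 2] circle_mean_value[of "\<lambda>z. z" 2]
    by (auto intro: holomorphic_intros)
  have ic: "integrable circle_measure cnj"
    using integrable_cnj[of circle_measure "\<lambda>z. z"] cm(1) by simp
  have [measurable]: "cnj \<in> borel_measurable circle_measure"
    by (rule borel_measurable_integrable[OF ic])
  have pK: "linf_pairing h cnj = 0" if hK: "h \<in> K" for h
  proof -
    obtain c where h: "h = c *\<^sub>C 1" using hK by (auto simp: K_def)
    have "linf_pairing h cnj = (LINT z|circle_measure. c * cnj z)"
      unfolding linf_pairing_eq[OF ic]
    proof (rule integral_cong_AE)
      show "AE z in circle_measure. rep_linf h z * cnj z = c * cnj z"
        using rep_linf_scaleC[of c 1] rep_linf_1 unfolding h by eventually_elim simp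
    qed measurable
    also have "\<dots> = c * cnj (LINT z|circle_measure. z)" by simp
    finally show ?thesis using cm(2) by simp
  qed
  have "linf_pairing linf_coordinate cnj = (LINT z|circle_measure. 1)"
    unfolding linf_pairing_eq[OF ic]
  proof (rule integral_cong_AE)
    show "AE z in circle_measure. rep_linf linf_coordinate z * cnj z = 1"
      using rep_linf_coordinate AE_circle_sphere
      by eventually_elim (simp add: complex_norm_square[symmetric])
  qed measurable
  then have pZ: "linf_pairing linf_coordinate cnj \<noteq> 0" by (simp add: measure_circle)
  have "openin linf_weak_star {h. linf_pairing h cnj \<in> - {0}}"
    unfolding linf_weak_star_def
    by (intro topology_generated_by_Basis CollectI exI[of _ cnj] exI[of _ "- {0}"] conjI refl ic open_Compl closed_singleton)
  note op = this
  have "linf_coordinate \<in> {h. linf_pairing h cnj \<in> - {0}}" using pZ by simp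
  from cl[unfolded in_closure_of, THEN conjunct2, rule_format, OF conjI, OF this op]
  show False using hull pK by auto
qed

section \<open>Concentrating automorphisms\<close>

text \<open>Serves the joint measurability of a rotation whose angle depends on a second variable,
  as the exchange of integrals below requires.\<close>

lemma measurable_circle_mult:
  assumes "\<phi> \<in> measurable M circle_measure" "\<psi> \<in> measurable M circle_measure"
  shows "(\<lambda>x. \<phi> x * \<psi> x) \<in> measurable M circle_measure"
proof -
  have id: "(\<lambda>z. z) \<in> borel_measurable circle_measure" by (rule measurable_circleI) simp
  have "(\<lambda>x. \<phi> x * \<psi> x) \<in> borel_measurable M"
    using measurable_compose[OF assms(1) id] measurable_compose[OF assms(2) id] by (rule borel_measurable_times)
  then have "(\<lambda>x. \<phi> x * \<psi> x) \<in> measurable M (restrict_space borel (sphere 0 1))"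
    using measurable_space[OF assms(1)] measurable_space[OF assms(2)]
    by (intro measurable_restrict_space2) (auto simp: norm_mult)
  then show ?thesis by (simp cong: measurable_cong_sets)
qed

text \<open>Continuity of translation in mean. Once \<open>f\<close> is approximated by a continuous
  function, rotation invariance makes the two error terms equal.\<close>

lemma rotation_L1_continuous:
  fixes f :: "complex \<Rightarrow> complex"
  assumes fm [measurable]: "f \<in> borel_measurable circle_measure" and f1: "\<And>z. cmod (f z) \<le> 1"
    and w: "\<And>n. cmod (w n) = 1" "w \<longlonglongrightarrow> 1"
  shows "(\<lambda>n. LINT z|circle_measure. cmod (f (w n * z) - f z)) \<longlonglongrightarrow> 0"
proof -
  obtain \<alpha> \<beta> :: "nat \<Rightarrow> complex \<Rightarrow> real" where
    ab: "\<And>n. continuous_on UNIV (\<alpha> n)" "\<And>n. continuous_on UNIV (\<beta> n)"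
      "AE z in circle_measure. (\<lambda>n. (cis (\<alpha> n z) + cis (\<beta> n z)) / 2) \<longlonglongrightarrow> f z"
    by (rule circle_unit_approx[OF fm]) (use f1 in auto)
  define H where "H n z = (cis (\<alpha> n z) + cis (\<beta> n z)) / 2" for n z
  have Hc: "continuous_on UNIV (H n)" for n
    unfolding H_def by (intro continuous_intros ab) simp
  have Hm [measurable]: "H n \<in> borel_measurable circle_measure" for n
    by (rule measurable_circle_continuous[OF continuous_on_subset[OF Hc]]) simp
  have H1: "cmod (H n z) \<le> 1" for n z
    using norm_triangle_ineq[of "cis (\<alpha> n z)" "cis (\<beta> n z)"] by (simp add: H_def norm_divide)
  have HL: "(\<lambda>n. LINT z|circle_measure. cmod (f z - H n z)) \<longlonglongrightarrow> 0"
    by (rule circle_L1_dominated(1)[where C=1]) (use ab(3) H1 in \<open>auto simp: H_def[symmetric]\<close>)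
  show ?thesis
  proof (rule LIMSEQ_I)
    fix e :: real assume e: "e > 0"
    then have e3: "e / 3 > 0" by simp
    obtain m where m: "(LINT z|circle_measure. cmod (f z - H m z)) < e / 3"
      using order_tendstoD(2)[OF HL e3] by (auto simp: eventually_sequentially)
    have fw [measurable]: "(\<lambda>z. f (w n * z)) \<in> borel_measurable circle_measure"
      and Hw [measurable]: "(\<lambda>z. H m (w n * z)) \<in> borel_measurable circle_measure" for n
      by (rule measurable_compose[OF measurable_rotation[OF w(1)] fm],
          rule measurable_compose[OF measurable_rotation[OF w(1)] Hm])
    have "(\<lambda>n. LINT z|circle_measure. cmod (H m (w n * z) - H m z)) \<longlonglongrightarrow> (LINT z|circle_measure. 0)"
    proof (rule integral_dominated_convergence[where w="\<lambda>_. 2"])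
      show "AE z in circle_measure. (\<lambda>n. cmod (H m (w n * z) - H m z)) \<longlonglongrightarrow> 0"
      proof (rule AE_I2)
        fix z :: complex
        have "(\<lambda>n. H m (w n * z)) \<longlonglongrightarrow> H m (1 * z)"
          by (rule continuous_on_tendsto_compose[OF Hc[of m]]) (use tendsto_mult[OF w(2) tendsto_const[of z]] in auto)
        from tendsto_norm[OF tendsto_diff[OF this tendsto_const[of "H m z"]]]
        show "(\<lambda>n. cmod (H m (w n * z) - H m z)) \<longlonglongrightarrow> 0" by simp
      qed
      show "AE z in circle_measure. norm (cmod (H m (w n * z) - H m z)) \<le> 2" for n
      proof (rule AE_I2)
        fix z
        show "norm (cmod (H m (w n * z) - H m z)) \<le> 2"
          using norm_triangle_ineq4[of "H m (w n * z)" "H m z"] H1[of m "w n * z"] H1[of m z] by simp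
      qed
    qed measurable
    then have "\<forall>\<^sub>F n in sequentially. (LINT z|circle_measure. cmod (H m (w n * z) - H m z)) < e / 3"
      using order_tendstoD(2)[OF _ e3] by simp
    then obtain M where M: "\<And>n. n \<ge> M \<Longrightarrow> (LINT z|circle_measure. cmod (H m (w n * z) - H m z)) < e / 3"
      by (auto simp: eventually_sequentially)
    show "\<exists>M. \<forall>n\<ge>M. norm ((LINT z|circle_measure. cmod (f (w n * z) - f z)) - 0) < e"
    proof (intro exI allI impI)
      fix n assume n: "n \<ge> M"
      have b2: "cmod (a - b) \<le> 2" if "cmod a \<le> 1" "cmod b \<le> 1" for a b
        using norm_triangle_ineq4[of a b] that by simp
      have i1: "integrable circle_measure (\<lambda>z. cmod (f (w n * z) - f z))"
        by (rule integrable_circle_bounded[of _ 2]) (measurable, auto intro!: AE_I2 b2 f1)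
      have i2: "integrable circle_measure (\<lambda>z. cmod (f (w n * z) - H m (w n * z)))"
        by (rule integrable_circle_bounded[of _ 2]) (measurable, auto intro!: AE_I2 b2 f1 H1)
      have i3: "integrable circle_measure (\<lambda>z. cmod (H m (w n * z) - H m z))"
        by (rule integrable_circle_bounded[of _ 2]) (measurable, auto intro!: AE_I2 b2 f1 H1)
      have i4: "integrable circle_measure (\<lambda>z. cmod (f z - H m z))"
        by (rule integrable_circle_bounded[of _ 2]) (measurable, auto intro!: AE_I2 b2 f1 H1)
      have tri: "cmod (f (w n * z) - f z) \<le>
          cmod (f (w n * z) - H m (w n * z)) + cmod (H m (w n * z) - H m z) + cmod (f z - H m z)" for z
      proof -
        have "f (w n * z) - f z = (f (w n * z) - H m (w n * z)) + (H m (w n * z) - H m z) - (f z - H m z)" by simp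
        then show ?thesis
          by (metis norm_triangle_ineq4 norm_triangle_ineq add_right_mono order_trans)
      qed
      have "(LINT z|circle_measure. cmod (f (w n * z) - f z)) \<le>
          (LINT z|circle_measure. cmod (f (w n * z) - H m (w n * z)) + cmod (H m (w n * z) - H m z) + cmod (f z - H m z))"
        by (intro integral_mono i1 i2 i3 i4 Bochner_Integration.integrable_add tri)
      also have "\<dots> = (LINT z|circle_measure. cmod (f (w n * z) - H m (w n * z)))
          + (LINT z|circle_measure. cmod (H m (w n * z) - H m z)) + (LINT z|circle_measure. cmod (f z - H m z))"
        using i2 i3 i4 by simp
      also have "(LINT z|circle_measure. cmod (f (w n * z) - H m (w n * z))) = (LINT z|circle_measure. cmod (f z - H m z))"
        by (rule integral_rotation[OF w(1), of "\<lambda>z. cmod (f z - H m z)"]) measurable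
      finally have "(LINT z|circle_measure. cmod (f (w n * z) - f z)) < e"
        using m M[OF n] by linarith
      then show "norm ((LINT z|circle_measure. cmod (f (w n * z) - f z)) - 0) < e" by simp
    qed
  qed
qed

text \<open>All these maps fix \<open>-1\<close>. At any other point of the circle the formula
  passes to the limit, where numerator and denominator agree.\<close>

lemma mobius_concentrates:
  assumes z: "z \<in> sphere 0 1" "z \<noteq> -1" and \<rho>: "\<rho> \<longlonglongrightarrow> 1"
  shows "(\<lambda>n. mobius 1 1 (\<rho> n) z) \<longlonglongrightarrow> 1"
proof -
  have nz: "1 + z \<noteq> 0" using z(2) by (metis add.commute eq_neg_iff_add_eq_0)
  have "(\<lambda>n. 1 * (1 * z + of_real (\<rho> n)) / (1 + of_real (\<rho> n) * 1 * z)) \<longlonglongrightarrow> 1 * (1 * z + of_real 1) / (1 + of_real 1 * 1 * z)"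
    by (intro tendsto_intros \<rho>) (use nz in simp)
  also have "1 * (1 * z + of_real 1) / (1 + of_real 1 * 1 * z) = 1" using nz by (simp add: add.commute)
  finally show ?thesis by (simp add: mobius_def)
qed

lemma mobius_factor: "mobius \<zeta> \<eta> r z = mobius 1 \<eta> r z * \<zeta>"
  by (simp add: mobius_def)

text \<open>Averaging over \<open>\<zeta>\<close> replaces the existence of Lebesgue points.\<close>

lemma exists_concentrating_mobius:
  fixes f :: "complex \<Rightarrow> complex"
  assumes fm [measurable]: "f \<in> borel_measurable circle_measure" and f1: "\<And>z. cmod (f z) \<le> 1"
    and E: "measure circle_measure {z \<in> sphere 0 1. cmod (f z) > 1 - e} > 0" and e: "0 < e"
  shows "\<exists>\<zeta> r. cmod \<zeta> = 1 \<and> \<bar>r\<bar> < 1 \<and> cmod (f \<zeta>) > 1 - e \<and>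
    (LINT z|circle_measure. cmod (f (mobius \<zeta> 1 r z) - f \<zeta>)) < e"
proof -
  interpret P: pair_sigma_finite circle_measure circle_measure ..
  interpret PF: finite_measure "circle_measure \<Otimes>\<^sub>M circle_measure"
    by (rule finite_measure_pair_measure) unfold_locales
  define \<rho> where "\<rho> n = 1 - 1 / real (n + 2)" for n
  have \<rho>: "\<bar>\<rho> n\<bar> < 1" for n by (auto simp: \<rho>_def)
  have "(\<lambda>k. 1 / real (k + 2)) \<longlonglongrightarrow> 0"
    by (intro LIMSEQ_ignore_initial_segment lim_1_over_n)
  from tendsto_diff[OF tendsto_const[of 1] this] have \<rho>_lim: "\<rho> \<longlonglongrightarrow> 1" by (simp add: \<rho>_def[abs_def])
  define \<phi> where "\<phi> n = mobius 1 1 (\<rho> n)" for n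
  have aut: "disc_automorphism (\<phi> n)" for n
    unfolding \<phi>_def by (rule disc_automorphism_mobius) (use \<rho> in auto)
  note \<phi>m = disc_automorphism_measurable_nonsingular(1)[OF aut]
  have \<phi>1: "cmod (\<phi> n z) = 1" if "z \<in> sphere 0 1" for n z
    using measurable_space[OF \<phi>m, of z n] that by simp
  \<comment> \<open>For fixed \<open>z\<close> the factor \<open>\<phi> n z\<close> tends to
    \<open>1\<close>, so the integral over \<open>\<zeta>\<close> is the error of a small rotation.
    Exchanging the integrals makes the integral over \<open>z\<close> small for most
    \<open>\<zeta>\<close>.\<close>
  define D where "D n z \<zeta> = cmod (f (\<phi> n z * \<zeta>) - f \<zeta>)" for n z \<zeta>
  have D2: "0 \<le> D n z \<zeta>" "D n z \<zeta> \<le> 2" for n z \<zeta>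
    using norm_triangle_ineq4[of "f (\<phi> n z * \<zeta>)" "f \<zeta>"] f1[of "\<phi> n z * \<zeta>"] f1[of \<zeta>] by (auto simp: D_def)
  have [measurable]: "(\<lambda>p. f (\<phi> n (fst p) * snd p)) \<in> borel_measurable (circle_measure \<Otimes>\<^sub>M circle_measure)" for n
    by (rule measurable_compose[OF measurable_circle_mult fm])
       (auto intro: measurable_compose[OF measurable_fst \<phi>m])
  have [measurable]: "(\<lambda>p. f (snd p)) \<in> borel_measurable (circle_measure \<Otimes>\<^sub>M circle_measure)"
    by (rule measurable_compose[OF measurable_snd fm])
  have Dm: "(\<lambda>p. D n (fst p) (snd p)) \<in> borel_measurable (circle_measure \<Otimes>\<^sub>M circle_measure)" for n
    unfolding D_def by measurable
  have Di: "integrable (circle_measure \<Otimes>\<^sub>M circle_measure) (\<lambda>(z, \<zeta>). D n z \<zeta>)" for n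
    using PF.integrable_const_bound[of "\<lambda>p. D n (fst p) (snd p)" 2] Dm D2
    by (simp add: case_prod_beta')
  define S where "S n z = (LINT \<zeta>|circle_measure. D n z \<zeta>)" for n z
  define U where "U n \<zeta> = (LINT z|circle_measure. D n z \<zeta>)" for n \<zeta>
  have Sm: "S n \<in> borel_measurable circle_measure" for n
    unfolding S_def using P.integrable_fst'[OF Di[of n, unfolded case_prod_beta']] by auto
  have Ui: "integrable circle_measure (U n)" for n
    unfolding U_def using P.integrable_snd[OF Di[of n]] by simp
  have fub: "(LINT \<zeta>|circle_measure. U n \<zeta>) = (LINT z|circle_measure. S n z)" for n
    unfolding U_def S_def by (rule P.Fubini_integral[OF Di])
  have "(\<lambda>n. LINT z|circle_measure. S n z) \<longlonglongrightarrow> (LINT z|circle_measure. 0)"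
  proof (rule integral_dominated_convergence[where w="\<lambda>_. 2 * (2 * pi)"])
    show "AE z in circle_measure. (\<lambda>n. S n z) \<longlonglongrightarrow> 0"
      using AE_circle_sphere AE_circle_neq[of "-1"]
    proof eventually_elim
      case (elim z)
      show ?case unfolding S_def D_def
        by (rule rotation_L1_continuous[OF fm f1])
           (use elim mobius_concentrates[OF _ _ \<rho>_lim] \<phi>1 in \<open>auto simp: \<phi>_def\<close>)
    qed
    show "AE z in circle_measure. norm (S n z) \<le> 2 * (2 * pi)" for n
      using AE_circle_sphere
    proof eventually_elim
      case (elim z)
      have [measurable]: "(\<lambda>\<zeta>. f (\<phi> n z * \<zeta>)) \<in> borel_measurable circle_measure"
        by (rule measurable_compose[OF measurable_rotation fm]) (use \<phi>1 elim in auto)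
      have [measurable]: "D n z \<in> borel_measurable circle_measure" unfolding D_def by measurable
      have "S n z \<le> (LINT \<zeta>|circle_measure. 2)" unfolding S_def
        by (intro integral_mono integrable_circle_bounded[of _ 2] AE_I2) (use D2 in auto)
      moreover have "S n z \<ge> 0" unfolding S_def using D2 by simp
      ultimately show ?case by (simp add: measure_circle)
    qed
  qed (use Sm in auto)
  then have I: "(\<lambda>n. LINT \<zeta>|circle_measure. U n \<zeta>) \<longlonglongrightarrow> 0" by (simp add: fub)
  define X where "X = {z \<in> sphere 0 1. cmod (f z) > 1 - e}"
  have Xm: "X \<in> sets circle_measure"
  proof -
    have "{z \<in> space circle_measure. cmod (f z) > 1 - e} \<in> sets circle_measure" by measurable
    then show ?thesis by (simp add: X_def)
  qed
  have "e * measure circle_measure X > 0" using E e by (simp add: X_def)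
  from order_tendstoD(2)[OF I this] obtain n
    where n: "(LINT \<zeta>|circle_measure. U n \<zeta>) < e * measure circle_measure X"
    by (auto simp: eventually_sequentially)
  \<comment> \<open>Otherwise the integral of \<open>U n\<close> would be at least \<open>e\<close>
    times the measure of \<open>X\<close>.\<close>
  have "\<exists>\<zeta>\<in>X. U n \<zeta> < e"
  proof (rule ccontr)
    assume "\<not> ?thesis"
    then have ge: "e * indicat_real X \<zeta> \<le> U n \<zeta>" for \<zeta>
      using D2 by (cases "\<zeta> \<in> X") (auto simp: U_def not_less)
    have "(LINT \<zeta>|circle_measure. e * indicat_real X \<zeta>) \<le> (LINT \<zeta>|circle_measure. U n \<zeta>)"
      by (intro integral_mono Ui ge integrable_mult_right integrable_real_indicator Xm)
         (simp add: circle.emeasure_finite less_top[symmetric])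
    moreover have "X \<inter> sphere 0 1 = X" by (auto simp: X_def)
    ultimately show False using n by simp
  qed
  then obtain \<zeta> where \<zeta>: "\<zeta> \<in> X" "U n \<zeta> < e" by blast
  show ?thesis
    using \<zeta> \<rho>[of n] unfolding U_def D_def \<phi>_def X_def
    by (intro exI[of _ \<zeta>] exI[of _ "\<rho> n"]) (simp add: mobius_factor[of \<zeta>])
qed

text \<open>One automorphism for each tolerance gives convergence in mean, and a subsequence gives
  it a.e. The constants \<open>c k\<close> undo the phase of \<open>x\<close> at the point of
  concentration.\<close>

lemma concentrating_sequence:
  assumes x: "norm (x :: linf) = 1"
  obtains \<zeta> :: "nat \<Rightarrow> complex" and r :: "nat \<Rightarrow> real" and c :: "nat \<Rightarrow> complex"
  where "\<And>k. cmod (\<zeta> k) = 1" "\<And>k. \<bar>r k\<bar> < 1" "\<And>k. cmod (c k) = 1"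
    "AE z in circle_measure. (\<lambda>k. c k * rep_linf x (mobius (\<zeta> k) 1 (r k) z)) \<longlonglongrightarrow> 1"
proof -
  \<comment> \<open>A version bounded by one everywhere, because \<open>f\<close> is evaluated at
    the single points \<open>\<zeta> k\<close>, where an a.e. bound says nothing.\<close>
  define f where "f z = (if cmod (rep_linf x z) \<le> 1 then rep_linf x z else 0)" for z
  have fm [measurable]: "f \<in> borel_measurable circle_measure" unfolding f_def by measurable
  have f1: "cmod (f z) \<le> 1" for z by (simp add: f_def)
  have fx: "AE z in circle_measure. f z = rep_linf x z"
    using AE_norm_linf[of x] by eventually_elim (simp add: f_def x)
  define \<epsilon> where "\<epsilon> k = 1 / real (Suc k)" for k
  have \<epsilon>: "0 < \<epsilon> k" "\<epsilon> k \<le> 1" for k by (auto simp: \<epsilon>_def)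
  have \<epsilon>_lim: "\<epsilon> \<longlonglongrightarrow> 0" unfolding \<epsilon>_def using LIMSEQ_inverse_real_of_nat by (simp add: inverse_eq_divide)
  \<comment> \<open>The essential supremum of the modulus is exactly one, so it exceeds each smaller
    level on a set of positive measure.\<close>
  have pos: "measure circle_measure {z \<in> sphere 0 1. cmod (f z) > 1 - \<epsilon> k} > 0" for k
  proof (rule ccontr)
    assume "\<not> ?thesis"
    then have m0: "measure circle_measure {z \<in> space circle_measure. cmod (f z) > 1 - \<epsilon> k} = 0"
      by (simp add: not_less measure_le_0_iff)
    have "{z \<in> space circle_measure. cmod (f z) > 1 - \<epsilon> k} \<in> sets circle_measure" by measurable
    with m0 have "{z \<in> space circle_measure. cmod (f z) > 1 - \<epsilon> k} \<in> null_sets circle_measure"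
      by (simp add: circle.emeasure_eq_measure null_setsI)
    then have "AE z in circle_measure. cmod (f z) \<le> 1 - \<epsilon> k"
      by (rule AE_I'[rotated 0]) (auto simp: not_le)
    with fx have "AE z in circle_measure. cmod (rep_linf x z) \<le> 1 - \<epsilon> k" by eventually_elim simp
    then have "norm x \<le> 1 - \<epsilon> k" using \<epsilon>[of k] by (intro norm_linf_le) auto
    then show False using x \<epsilon>(1)[of k] by simp
  qed
  have "\<exists>\<zeta> r. cmod \<zeta> = 1 \<and> \<bar>r\<bar> < 1 \<and> cmod (f \<zeta>) > 1 - \<epsilon> k \<and>
    (LINT z|circle_measure. cmod (f (mobius \<zeta> 1 r z) - f \<zeta>)) < \<epsilon> k" for k
    by (rule exists_concentrating_mobius[OF fm f1 pos \<epsilon>(1)])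
  then obtain \<zeta> r where m: "\<And>k. cmod (\<zeta> k) = 1" "\<And>k. \<bar>r k\<bar> < 1"
      and big: "\<And>k. cmod (f (\<zeta> k)) > 1 - \<epsilon> k"
      and L1: "\<And>k. (LINT z|circle_measure. cmod (f (mobius (\<zeta> k) 1 (r k) z) - f (\<zeta> k))) < \<epsilon> k"
    by metis
  define c where "c k = cnj (sgn (f (\<zeta> k)))" for k
  have f0: "f (\<zeta> k) \<noteq> 0" for k using big[of k] \<epsilon>(2)[of k] by auto
  have c1: "cmod (c k) = 1" for k using f0 by (simp add: c_def norm_sgn)
  have cf: "c k * f (\<zeta> k) = of_real (cmod (f (\<zeta> k)))" for k
  proof -
    have "f (\<zeta> k) = of_real (cmod (f (\<zeta> k))) * sgn (f (\<zeta> k))"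
      using f0[of k] by (simp add: sgn_div_norm scaleR_conv_of_real)
    then have "c k * f (\<zeta> k) = of_real (cmod (f (\<zeta> k))) * (sgn (f (\<zeta> k)) * cnj (sgn (f (\<zeta> k))))"
      unfolding c_def by (metis mult.assoc mult.commute)
    also have "sgn (f (\<zeta> k)) * cnj (sgn (f (\<zeta> k))) = 1"
      using f0[of k] by (simp add: complex_norm_square[symmetric] norm_sgn)
    finally show ?thesis by simp
  qed
  have aut: "disc_automorphism (mobius (\<zeta> k) 1 (r k))" for k
    by (rule disc_automorphism_mobius) (use m in auto)
  have fk [measurable]: "(\<lambda>z. f (mobius (\<zeta> k) 1 (r k) z)) \<in> borel_measurable circle_measure" for k
    by (rule measurable_compose[OF disc_automorphism_measurable_nonsingular(1)[OF aut] fm])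
  define u where "u k z = c k * f (mobius (\<zeta> k) 1 (r k) z) - 1" for k z
  have um [measurable]: "u k \<in> borel_measurable circle_measure" for k unfolding u_def by measurable
  have ui: "integrable circle_measure (u k)" for k
  proof (rule integrable_circle_bounded[of _ 2], simp, rule AE_I2)
    fix z
    show "cmod (u k z) \<le> 2"
      using norm_triangle_ineq4[of "c k * f (mobius (\<zeta> k) 1 (r k) z)" 1] f1[of "mobius (\<zeta> k) 1 (r k) z"] c1[of k]
      by (simp add: u_def norm_mult)
  qed
  have ub: "(LINT z|circle_measure. cmod (u k z)) \<le> \<epsilon> k + 2 * pi * \<epsilon> k" for k
  proof -
    have i: "integrable circle_measure (\<lambda>z. cmod (f (mobius (\<zeta> k) 1 (r k) z) - f (\<zeta> k)))"
    proof (rule integrable_circle_bounded[of _ 2], measurable, rule AE_I2)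
      fix z
      show "norm (cmod (f (mobius (\<zeta> k) 1 (r k) z) - f (\<zeta> k))) \<le> 2"
        using norm_triangle_ineq4[of "f (mobius (\<zeta> k) 1 (r k) z)" "f (\<zeta> k)"] f1[of "mobius (\<zeta> k) 1 (r k) z"] f1[of "\<zeta> k"]
        by simp
    qed
    have "cmod (u k z) \<le> cmod (f (mobius (\<zeta> k) 1 (r k) z) - f (\<zeta> k)) + \<epsilon> k" for z
    proof -
      have "u k z = c k * (f (mobius (\<zeta> k) 1 (r k) z) - f (\<zeta> k)) + of_real (cmod (f (\<zeta> k)) - 1)"
        using cf[of k] by (simp add: u_def algebra_simps)
      also have "cmod \<dots> \<le> cmod (f (mobius (\<zeta> k) 1 (r k) z) - f (\<zeta> k)) + \<bar>cmod (f (\<zeta> k)) - 1\<bar>"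
        using norm_triangle_ineq[of "c k * (f (mobius (\<zeta> k) 1 (r k) z) - f (\<zeta> k))" "of_real (cmod (f (\<zeta> k)) - 1)"] c1[of k]
        unfolding norm_of_real by (simp add: norm_mult)
      finally show ?thesis using big[of k] f1[of "\<zeta> k"] by linarith
    qed
    then have "(LINT z|circle_measure. cmod (u k z)) \<le>
        (LINT z|circle_measure. cmod (f (mobius (\<zeta> k) 1 (r k) z) - f (\<zeta> k)) + \<epsilon> k)"
      using ui i by (intro integral_mono) auto
    also have "\<dots> = (LINT z|circle_measure. cmod (f (mobius (\<zeta> k) 1 (r k) z) - f (\<zeta> k))) + 2 * pi * \<epsilon> k"
      using i by (simp add: measure_circle)
    finally show ?thesis using L1[of k] by simp
  qed
  have "(\<lambda>k. LINT z|circle_measure. cmod (u k z)) \<longlonglongrightarrow> 0"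
  proof (rule tendsto_sandwich[OF _ _ tendsto_const])
    have "(\<lambda>k. \<epsilon> k + 2 * pi * \<epsilon> k) \<longlonglongrightarrow> 0 + 2 * pi * 0" by (intro tendsto_intros \<epsilon>_lim)
    then show "(\<lambda>k. \<epsilon> k + 2 * pi * \<epsilon> k) \<longlonglongrightarrow> 0" by simp
  qed (use ub in auto)
  then obtain s where s: "strict_mono s" "AE z in circle_measure. (\<lambda>k. u (s k) z) \<longlonglongrightarrow> 0"
    using tendsto_L1_AE_subseq[of circle_measure u] ui by blast
  have "AE z in circle_measure. \<forall>k. f (mobius (\<zeta> (s k)) 1 (r (s k)) z) = rep_linf x (mobius (\<zeta> (s k)) 1 (r (s k)) z)"
    by (rule AE_all_countable[THEN iffD2]) (intro allI disc_automorphism_AE[OF aut fx])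
  with s(2) have "AE z in circle_measure. (\<lambda>k. c (s k) * rep_linf x (mobius (\<zeta> (s k)) 1 (r (s k)) z)) \<longlonglongrightarrow> 1"
  proof eventually_elim
    case (elim z)
    have "(\<lambda>k. u (s k) z + 1) \<longlonglongrightarrow> 0 + 1" by (intro tendsto_intros elim(1))
    then show ?case using elim(2) by (simp add: u_def)
  qed
  then show thesis
    using that[of "\<lambda>k. \<zeta> (s k)" "\<lambda>k. r (s k)" "\<lambda>k. c (s k)"] m c1 by simp
qed

section \<open>Functional calculus in the self-adjoint part\<close>

lemma closed_subalgebraD:
  assumes "closed_subalgebra A"
  shows "closed A" "0 \<in> A" "\<And>f g. f \<in> A \<Longrightarrow> g \<in> A \<Longrightarrow> f + g \<in> A"
    "\<And>f g. f \<in> A \<Longrightarrow> g \<in> A \<Longrightarrow> f * g \<in> A" "\<And>c f. f \<in> A \<Longrightarrow> c *\<^sub>C f \<in> A"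
  using assms by (auto simp: closed_subalgebra_def)

lemma real_polynomial_calculus:
  assumes A: "closed_subalgebra A" "1 \<in> A" and b: "b \<in> A" "linf_cnj b \<in> A"
    and q: "real_polynomial_function q"
  shows "\<exists>y\<in>A. AE z in circle_measure. rep_linf y z = of_real (q (rep_linf b z))"
  using q
proof induction
  case (linear f)
  then interpret bounded_linear f .
  have f: "f w = Re w * f 1 + Im w * f \<i>" for w
  proof -
    have "w = Re w *\<^sub>R 1 + Im w *\<^sub>R \<i>" by (simp add: complex_eq_iff)
    then show ?thesis by (metis add scaleR real_scaleR_def)
  qed
  have Re: "complex_of_real (Re w) = (w + cnj w) / 2" and Im: "complex_of_real (Im w) = (w - cnj w) / (2 * \<i>)" for w
    by (simp_all add: complex_eq_iff Re_divide Im_divide)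
  \<comment> \<open>A real-linear functional of \<open>w\<close> is a combination of
    \<open>w\<close> and \<open>cnj w\<close>; the coefficients come from expressing
    \<open>Re w\<close> and \<open>Im w\<close> by these two. Here both \<open>b\<close> and its
    conjugate enter.\<close>
  define p m where "p = of_real (f 1) / 2 + of_real (f \<i>) / (2 * \<i>)" and "m = of_real (f 1) / 2 - of_real (f \<i>) / (2 * \<i>)"
  have eq: "of_real (f w) = p * w + m * cnj w" for w
    unfolding f[of w] of_real_add of_real_mult Re Im p_def m_def by (simp add: field_simps)
  have "p *\<^sub>C b + m *\<^sub>C linf_cnj b \<in> A" using closed_subalgebraD[OF A(1)] b by auto
  moreover have "AE z in circle_measure. rep_linf (p *\<^sub>C b + m *\<^sub>C linf_cnj b) z = of_real (f (rep_linf b z))"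
    using rep_linf_add[of "p *\<^sub>C b" "m *\<^sub>C linf_cnj b"] rep_linf_scaleC[of p b]
      rep_linf_scaleC[of m "linf_cnj b"] rep_linf_cnj[of b]
    by eventually_elim (simp add: eq)
  ultimately show ?case by blast
next
  case (const c)
  have "AE z in circle_measure. rep_linf (of_real c *\<^sub>C 1) z = of_real c"
    using rep_linf_scaleC[of "of_real c" 1] rep_linf_1 by eventually_elim simp
  then show ?case using closed_subalgebraD(5)[OF A(1) A(2)] by blast
next
  case (add f g)
  then obtain x y where xy: "x \<in> A" "y \<in> A" "AE z in circle_measure. rep_linf x z = of_real (f (rep_linf b z))"
    "AE z in circle_measure. rep_linf y z = of_real (g (rep_linf b z))" by blast
  have "AE z in circle_measure. rep_linf (x + y) z = of_real (f (rep_linf b z) + g (rep_linf b z))"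
    using xy(3,4) rep_linf_add[of x y] by eventually_elim simp
  then show ?case using closed_subalgebraD(3)[OF A(1) xy(1,2)] by blast
next
  case (mult f g)
  then obtain x y where xy: "x \<in> A" "y \<in> A" "AE z in circle_measure. rep_linf x z = of_real (f (rep_linf b z))"
    "AE z in circle_measure. rep_linf y z = of_real (g (rep_linf b z))" by blast
  have "AE z in circle_measure. rep_linf (x * y) z = of_real (f (rep_linf b z) * g (rep_linf b z))"
    using xy(3,4) rep_linf_mult[of x y] by eventually_elim simp
  then show ?case using closed_subalgebraD(4)[OF A(1) xy(1,2)] by blast
qed

text \<open>The essential range of \<open>b\<close> lies in the disc of radius
  \<open>norm b\<close>. Uniform polynomial approximation there, by Stone-Weierstrass, is
  approximation in the essential norm, and \<open>A\<close> is norm-closed.\<close>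

lemma continuous_calculus:
  fixes g :: "complex \<Rightarrow> complex"
  assumes A: "closed_subalgebra A" "1 \<in> A" and b: "b \<in> A" "linf_cnj b \<in> A"
    and g: "continuous_on UNIV g"
  shows "\<exists>h\<in>A. AE z in circle_measure. rep_linf h z = g (rep_linf b z)"
proof -
  have "compact (g ` cball 0 (norm b))"
    by (intro compact_continuous_image continuous_on_subset[OF g]) auto
  then have "bounded (g ` cball 0 (norm b))" by (rule compact_imp_bounded)
  then obtain C where C: "\<And>w. w \<in> cball 0 (norm b) \<Longrightarrow> cmod (g w) \<le> C"
    unfolding bounded_iff by blast
  have "ess_bounded (\<lambda>z. g (rep_linf b z))"
  proof (rule ess_boundedI)
    have "g \<in> borel_measurable borel" using g by (rule borel_measurable_continuous_onI)
    then show "(\<lambda>z. g (rep_linf b z)) \<in> borel_measurable circle_measure"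
      by (rule measurable_compose[OF measurable_rep_linf])
    show "AE z in circle_measure. cmod (g (rep_linf b z)) \<le> C"
      using AE_norm_linf[of b] by eventually_elim (use C in auto)
  qed
  note rep_h = rep_abs_linf[OF this]
  define h where "h = abs_linf (\<lambda>z. g (rep_linf b z))"
  have "h \<in> closure A"
    unfolding closure_approachable
  proof (intro allI impI)
    fix e :: real assume e: "e > 0"
    then obtain p where p: "polynomial_function p" "\<And>w. w \<in> cball 0 (norm b) \<Longrightarrow> cmod (g w - p w) < e / 2"
      using Stone_Weierstrass_polynomial_function[of "cball 0 (norm b)" g "e / 2"]
        continuous_on_subset[OF g] by auto
    have "real_polynomial_function (Re \<circ> p)" "real_polynomial_function (Im \<circ> p)"
      using p(1) bounded_linear_Re bounded_linear_Im unfolding polynomial_function_def by blast+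
    then obtain x y where xy: "x \<in> A" "y \<in> A"
      "AE z in circle_measure. rep_linf x z = of_real ((Re \<circ> p) (rep_linf b z))"
      "AE z in circle_measure. rep_linf y z = of_real ((Im \<circ> p) (rep_linf b z))"
      using real_polynomial_calculus[OF A b] by metis
    have "x + \<i> *\<^sub>C y \<in> A" using closed_subalgebraD[OF A(1)] xy by auto
    moreover have "norm (x + \<i> *\<^sub>C y - h) \<le> e / 2"
    proof (rule norm_linf_le)
      show "AE z in circle_measure. cmod (rep_linf (x + \<i> *\<^sub>C y - h) z) \<le> e / 2"
        using rep_linf_diff[of "x + \<i> *\<^sub>C y" h] rep_linf_add[of x "\<i> *\<^sub>C y"] rep_linf_scaleC[of \<i> y]
          xy(3,4) rep_h AE_norm_linf[of b]
      proof eventually_elim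
        case (elim z)
        have "rep_linf (x + \<i> *\<^sub>C y - h) z = p (rep_linf b z) - g (rep_linf b z)"
          using elim by (simp add: h_def complex_eq_iff)
        then show ?case using p(2)[of "rep_linf b z"] elim by (simp add: norm_minus_commute)
      qed
    qed (use e in simp)
    ultimately show "\<exists>y\<in>A. dist y h < e"
      using e by (intro bexI[of _ "x + \<i> *\<^sub>C y"]) (auto simp: dist_norm)
  qed
  then have "h \<in> A" using closed_subalgebraD(1)[OF A(1)] by simp
  then show ?thesis using rep_h unfolding h_def by blast
qed

text \<open>The conjugate is the calculus applied to the negated exponent. Having both in
  \<open>A\<close> is what a weight needs.\<close>

lemma unitary_calculus:
  fixes \<alpha> :: "complex \<Rightarrow> real"
  assumes A: "closed_subalgebra A" "1 \<in> A" and b: "b \<in> A" "linf_cnj b \<in> A"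
    and \<alpha>: "continuous_on UNIV \<alpha>"
  obtains u where "u \<in> A" "linf_cnj u \<in> A" "AE z in circle_measure. rep_linf u z = cis (\<alpha> (rep_linf b z))"
proof -
  have c: "continuous_on UNIV (\<lambda>w. cis (\<alpha> w))" "continuous_on UNIV (\<lambda>w. cis (- \<alpha> w))"
    by (intro continuous_intros \<alpha>)+
  obtain u where u: "u \<in> A" "AE z in circle_measure. rep_linf u z = cis (\<alpha> (rep_linf b z))"
    using continuous_calculus[OF A b c(1)] by blast
  obtain v where v: "v \<in> A" "AE z in circle_measure. rep_linf v z = cis (- \<alpha> (rep_linf b z))"
    using continuous_calculus[OF A b c(2)] by blast
  have "linf_cnj u = v"
    by (rule linf_eqI, use u(2) v(2) rep_linf_cnj[of u] in eventually_elim) (simp add: cis_cnj)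
  then show thesis using that u v(1) by blast
qed

section \<open>Approximating the coordinate function\<close>

text \<open>The averages are contractions in mean, uniformly in \<open>N\<close>, so an
  \<open>N\<close> chosen for an analytic approximant still serves its boundary limit.\<close>

lemma rotation_average_L1:
  assumes f: "integrable circle_measure f" and N: "0 < N"
  shows "(LINT z|circle_measure. cmod (rotation_average n N f z)) \<le> (LINT z|circle_measure. cmod (f z))"
proof -
  have m: "f \<in> borel_measurable circle_measure" using f by auto
  have i: "integrable circle_measure (\<lambda>z. f (w * z))" if "cmod w = 1" for w
    using integrable_distr[OF measurable_rotation[OF that], of f] distr_rotation[OF that] f by simp
  then have ic: "integrable circle_measure (\<lambda>z. cmod (f (root_of_unity N j * z)))" for j
    by (intro integrable_norm) simp
  have le: "cmod (rotation_average n N f z) \<le> (\<Sum>j<N. cmod (f (root_of_unity N j * z))) / real N" for z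
  proof -
    have "cmod (\<Sum>j<N. cnj (root_of_unity N j) ^ n * f (root_of_unity N j * z)) \<le> (\<Sum>j<N. cmod (f (root_of_unity N j * z)))"
      by (rule sum_norm_le) (simp add: norm_mult norm_power)
    then show ?thesis using N by (simp add: rotation_average_def norm_divide divide_right_mono)
  qed
  have ir: "integrable circle_measure (rotation_average n N f)"
    unfolding rotation_average_def[abs_def] using i by auto
  have rot: "(LINT z|circle_measure. cmod (f (root_of_unity N j * z))) = (LINT z|circle_measure. cmod (f z))" for j
    by (rule integral_rotation[of _ "\<lambda>z. cmod (f z)"]) (use m in auto)
  have "(LINT z|circle_measure. cmod (rotation_average n N f z)) \<le>
      (LINT z|circle_measure. (\<Sum>j<N. cmod (f (root_of_unity N j * z))) / real N)"
    using ir ic le by (intro integral_mono) auto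
  also have "\<dots> = (\<Sum>j<N. LINT z|circle_measure. cmod (f (root_of_unity N j * z))) / real N"
    using ic by simp
  finally show ?thesis using N by (simp add: rot)
qed

lemma rotation_average_diff:
  "rotation_average n N (\<lambda>z. f z - g z) z = rotation_average n N f z - rotation_average n N g z"
  by (simp add: rotation_average_def right_diff_distrib sum_subtractf diff_divide_distrib)

text \<open>Taylor series on the circle are available for \<open>G k\<close> but not for
  \<open>u\<close>. Therefore \<open>N k\<close> is fitted to \<open>G k\<close>, the contraction
  property transfers the estimate to \<open>u\<close>, and a subsequence turns the error in mean
  into a.e. convergence.\<close>

lemma rotation_averages_approach_coordinate:
  fixes G :: "nat \<Rightarrow> complex \<Rightarrow> complex"
  assumes hol: "\<And>k. \<exists>R>1. G k holomorphic_on ball 0 R"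
    and C: "\<And>k z. cmod z \<le> 1 \<Longrightarrow> cmod (G k z) \<le> C"
    and u: "u \<in> borel_measurable circle_measure"
    and lim: "AE z in circle_measure. (\<lambda>k. G k z) \<longlonglongrightarrow> u z"
    and d: "(\<lambda>k. deriv (G k) 0) \<longlonglongrightarrow> d" "d \<noteq> 0"
  shows "\<exists>N. (\<forall>k. 0 < N k) \<and> (AE z in circle_measure. (\<lambda>k. rotation_average 1 (N k) u z / d) \<longlonglongrightarrow> z)"
proof -
  have Gm: "G k \<in> borel_measurable circle_measure" for k
    using hol holomorphic_measurable_bounded(1) by blast
  have Gi: "integrable circle_measure (G k)" for k
    using hol holomorphic_measurable_bounded(2) by blast
  have GC: "AE z in circle_measure. cmod (G k z) \<le> C" for k
    using AE_circle_sphere by eventually_elim (use C in auto)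
  have "AE z in circle_measure. \<forall>k. cmod (G k z) \<le> C"
    by (rule AE_all_countable[THEN iffD2]) (intro allI GC)
  with lim have "AE z in circle_measure. cmod (u z) \<le> C"
  proof eventually_elim
    case (elim z)
    then show ?case by (intro Lim_norm_ubound[of sequentially "\<lambda>k. G k z"]) auto
  qed
  then have ui: "integrable circle_measure u" by (rule integrable_circle_bounded[OF u])
  define \<epsilon> where "\<epsilon> k = (LINT z|circle_measure. cmod (u z - G k z))" for k
  have \<epsilon>: "\<epsilon> \<longlonglongrightarrow> 0"
    unfolding \<epsilon>_def using circle_L1_dominated(1)[OF Gm u GC lim] .
  have "\<exists>N. 0 < N \<and> (\<forall>z. cmod z = 1 \<longrightarrow> cmod (rotation_average 1 N (G k) z - deriv (G k) 0 * z) < 1 / real (Suc k))" for k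
  proof -
    obtain R where R: "G k holomorphic_on ball 0 R" "1 < R" using hol by blast
    have "0 < 1 / real (Suc k)" by simp
    from rotation_average_tendsto[OF R this, of 1] show ?thesis by (metis (no_types, lifting) fact_1 div_by_1 funpow_0 funpow_simps_right(2) One_nat_def o_apply power_one_right)
  qed
  then obtain N where N: "\<And>k. 0 < N k"
    and NG: "\<And>k z. cmod z = 1 \<Longrightarrow> cmod (rotation_average 1 (N k) (G k) z - deriv (G k) 0 * z) < 1 / real (Suc k)"
    by metis
  define v where "v k z = rotation_average 1 (N k) u z - d * z" for k z
  have idm: "(\<lambda>z. z) \<in> borel_measurable circle_measure" by (rule measurable_circleI) simp
  have idi: "integrable circle_measure (\<lambda>z::complex. z)"
    by (rule integrable_circle_bounded[OF idm, of 1], use AE_circle_sphere in eventually_elim) simp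
  have ri: "integrable circle_measure (rotation_average 1 (N k) f)" if "integrable circle_measure f" for k f
  proof -
    have "integrable circle_measure (\<lambda>z. f (w * z))" if "cmod w = 1" for w
      using integrable_distr[OF measurable_rotation[OF that], of f] distr_rotation[OF that] \<open>integrable circle_measure f\<close> by simp
    then show ?thesis unfolding rotation_average_def[abs_def] by auto
  qed
  have vi: "integrable circle_measure (v k)" for k
    unfolding v_def using ri[OF ui] idi by auto
  have vb: "(LINT z|circle_measure. cmod (v k z)) \<le> \<epsilon> k + 2 * pi * (1 / real (Suc k) + cmod (deriv (G k) 0 - d))" for k
  proof -
    have duG: "integrable circle_measure (\<lambda>z. u z - G k z)" using ui Gi by auto
    have le: "cmod (v k z) \<le> cmod (rotation_average 1 (N k) (\<lambda>z. u z - G k z) z) + (1 / real (Suc k) + cmod (deriv (G k) 0 - d))"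
      if z: "cmod z = 1" for z
    proof -
      have "v k z = rotation_average 1 (N k) (\<lambda>z. u z - G k z) z
          + ((rotation_average 1 (N k) (G k) z - deriv (G k) 0 * z) + (deriv (G k) 0 - d) * z)"
        by (simp add: v_def rotation_average_diff algebra_simps)
      also have "cmod \<dots> \<le> cmod (rotation_average 1 (N k) (\<lambda>z. u z - G k z) z)
          + (cmod (rotation_average 1 (N k) (G k) z - deriv (G k) 0 * z) + cmod ((deriv (G k) 0 - d) * z))"
        by (intro order_trans[OF norm_triangle_ineq] add_left_mono norm_triangle_ineq)
      finally show ?thesis using NG[OF z, of k] z by (simp add: norm_mult)
    qed
    have ae: "AE z in circle_measure. cmod (v k z) \<le> cmod (rotation_average 1 (N k) (\<lambda>z. u z - G k z) z) + (1 / real (Suc k) + cmod (deriv (G k) 0 - d))"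
      using AE_circle_sphere by eventually_elim (rule le, simp)
    have "(LINT z|circle_measure. cmod (v k z)) \<le> (LINT z|circle_measure.
        cmod (rotation_average 1 (N k) (\<lambda>z. u z - G k z) z) + (1 / real (Suc k) + cmod (deriv (G k) 0 - d)))"
      by (intro integral_mono_AE ae integrable_norm[OF vi]) (use integrable_norm[OF ri[OF duG]] in simp)
    also have "\<dots> = (LINT z|circle_measure. cmod (rotation_average 1 (N k) (\<lambda>z. u z - G k z) z))
        + 2 * pi * (1 / real (Suc k) + cmod (deriv (G k) 0 - d))"
      using integrable_norm[OF ri[OF duG]] by (simp add: measure_circle del: of_nat_Suc)
    finally show ?thesis using rotation_average_L1[OF duG N[of k], of 1] by (simp add: \<epsilon>_def)
  qed
  have "(\<lambda>k. LINT z|circle_measure. cmod (v k z)) \<longlonglongrightarrow> 0"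
  proof (rule tendsto_sandwich[OF _ _ tendsto_const])
    have "(\<lambda>k. 1 / real (Suc k)) \<longlonglongrightarrow> 0" using LIMSEQ_inverse_real_of_nat by (simp add: inverse_eq_divide)
    then have "(\<lambda>k. \<epsilon> k + 2 * pi * (1 / real (Suc k) + cmod (deriv (G k) 0 - d))) \<longlonglongrightarrow> 0 + 2 * pi * (0 + cmod (d - d))"
      by (intro tendsto_intros \<epsilon> d)
    then show "(\<lambda>k. \<epsilon> k + 2 * pi * (1 / real (Suc k) + cmod (deriv (G k) 0 - d))) \<longlonglongrightarrow> 0" by simp
    show "\<forall>\<^sub>F k in sequentially. (LINT z|circle_measure. cmod (v k z)) \<le> \<epsilon> k + 2 * pi * (1 / real (Suc k) + cmod (deriv (G k) 0 - d))"
      using vb by (intro always_eventually allI)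
  qed simp
  then obtain s where s: "strict_mono s" "AE z in circle_measure. (\<lambda>k. v (s k) z) \<longlonglongrightarrow> 0"
    using tendsto_L1_AE_subseq[of circle_measure v] vi by blast
  from s(2) have "AE z in circle_measure. (\<lambda>k. rotation_average 1 (N (s k)) u z / d) \<longlonglongrightarrow> z"
  proof eventually_elim
    case (elim z)
    have "(\<lambda>k. (v (s k) z + d * z) / d) \<longlonglongrightarrow> (0 + d * z) / d" by (intro tendsto_intros elim d(2))
    then show ?case using d(2) by (simp add: v_def)
  qed
  with N show ?thesis by (intro exI[of _ "\<lambda>k. N (s k)"] conjI allI)
qed

lemma coordinate_approximation:
  assumes A: "closed_subalgebra A"
    and inv: "\<And>f \<phi>. f \<in> A \<Longrightarrow> disc_automorphism \<phi> \<Longrightarrow> linf_comp f \<phi> \<in> A"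
    and q: "q \<in> A" "linf_cnj q \<in> A"
    and F: "F holomorphic_on ball 0 1" "bounded (F ` ball 0 1)" "radial_boundary_value F q"
    and a: "a \<in> ball 0 1" "deriv F a \<noteq> 0"
  obtains b :: "nat \<Rightarrow> linf"
  where "\<And>k. b k \<in> A" "\<And>k. linf_cnj (b k) \<in> A" "AE z in circle_measure. (\<lambda>k. rep_linf (b k) z) \<longlonglongrightarrow> z"
proof -
  note AD = closed_subalgebraD[OF A]
  \<comment> \<open>Parameters of an automorphism taking \<open>0\<close> to \<open>a\<close>; the
    case \<open>a = 0\<close> is separate because \<open>sgn 0\<close> is not unimodular. The first
    Taylor coefficient of the composite is then \<open>d\<close>, a nonzero multiple of
    \<open>deriv F a\<close>.\<close>
  define \<zeta> where "\<zeta> = (if a = 0 then 1 else sgn a)"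
  define r where "r = cmod a"
  have m: "cmod \<zeta> = 1" "cmod 1 = 1" "\<bar>r\<bar> < 1" using a by (auto simp: \<zeta>_def norm_sgn r_def)
  have a_eq: "mobius \<zeta> 1 r 0 = a"
    by (simp add: mobius_0 \<zeta>_def r_def sgn_div_norm scaleR_conv_of_real)
  define u where "u = linf_comp q (mobius \<zeta> 1 r)"
  define d where "d = deriv F a * (\<zeta> * 1 * (1 - (of_real r)\<^sup>2))"
  have "r\<^sup>2 < 1" using m(3) by (simp add: abs_square_less_1)
  then have "(of_real r :: complex)\<^sup>2 \<noteq> 1" by (metis less_irrefl of_real_eq_1_iff of_real_power)
  then have d0: "d \<noteq> 0" using a(2) m(1) by (auto simp: d_def)
  obtain G C where G: "\<And>k::nat. \<exists>R>1. G k holomorphic_on ball 0 R"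
    "\<And>k z. cmod z \<le> 1 \<Longrightarrow> cmod (G k z) \<le> C"
    "AE z in circle_measure. (\<lambda>k. G k z) \<longlonglongrightarrow> rep_linf u z"
    "(\<lambda>k. deriv (G k) 0) \<longlonglongrightarrow> d"
    unfolding u_def d_def a_eq[symmetric] by (rule Hinf_mobius_approximation[OF F m]) blast
  obtain N :: "nat \<Rightarrow> nat" where N: "\<And>k. 0 < N k"
    "AE z in circle_measure. (\<lambda>k. rotation_average 1 (N k) (rep_linf u) z / d) \<longlonglongrightarrow> z"
    using rotation_averages_approach_coordinate[OF G(1,2) measurable_rep_linf G(3,4) d0] by auto
  \<comment> \<open>The rotation by a root of unity is absorbed into the inner parameter of the
    automorphism, so invariance of \<open>A\<close> covers each rotate.\<close>
  define t where "t k j = linf_comp q (mobius \<zeta> (root_of_unity (N k) j) r)" for k j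
  have aut: "disc_automorphism (mobius \<zeta> \<eta> r)" if "cmod \<eta> = 1" for \<eta>
    using m that by (intro disc_automorphism_mobius)
  have sumA: "(\<Sum>i\<in>I. f i) \<in> A" if "\<And>i. i \<in> I \<Longrightarrow> f i \<in> A" for I :: "nat set" and f
    using that AD(2,3) by (induction I rule: infinite_finite_induct) auto
  have cnj_sum: "linf_cnj (\<Sum>i\<in>I. f i) = (\<Sum>i\<in>I. linf_cnj (f i))" for I :: "nat set" and f
    by (induction I rule: infinite_finite_induct) (auto simp: linf_cnj_add)
  have cnj_comp: "linf_cnj (linf_comp q \<phi>) = linf_comp (linf_cnj q) \<phi>" if "disc_automorphism \<phi>" for \<phi>
    by (rule linf_eqI, use rep_linf_cnj[of "linf_comp q \<phi>"] rep_linf_comp[OF that, of q]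
        rep_linf_comp[OF that, of "linf_cnj q"] disc_automorphism_AE[OF that rep_linf_cnj[of q]] in eventually_elim) simp
  have tA: "t k j \<in> A" "linf_cnj (t k j) \<in> A" for k j
    using inv q aut by (auto simp: t_def cnj_comp)
  define b where "b k = (1 / (of_nat (N k) * d)) *\<^sub>C (\<Sum>j<N k. cnj (root_of_unity (N k) j) *\<^sub>C t k j)" for k
  have rep_b: "AE z in circle_measure. rep_linf (b k) z = rotation_average 1 (N k) (rep_linf u) z / d" for k
  proof -
    have "AE z in circle_measure. \<forall>j. rep_linf (cnj (root_of_unity (N k) j) *\<^sub>C t k j) z =
        cnj (root_of_unity (N k) j) * rep_linf u (root_of_unity (N k) j * z)"
    proof (rule AE_all_countable[THEN iffD2], rule allI)
      fix j
      have w: "cmod (root_of_unity (N k) j) = 1" by simp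
      show "AE z in circle_measure. rep_linf (cnj (root_of_unity (N k) j) *\<^sub>C t k j) z =
        cnj (root_of_unity (N k) j) * rep_linf u (root_of_unity (N k) j * z)"
        using rep_linf_scaleC[of "cnj (root_of_unity (N k) j)" "t k j"] rep_linf_comp[OF aut[OF w], of q]
          AE_rotation[OF w rep_linf_comp[OF aut[OF m(2)], of q]]
        by eventually_elim (simp add: t_def u_def mobius_rotation)
    qed
    then show ?thesis
      using rep_linf_scaleC[of "1 / (of_nat (N k) * d)" "\<Sum>j<N k. cnj (root_of_unity (N k) j) *\<^sub>C t k j"]
        rep_linf_sum[OF finite_lessThan, of "\<lambda>j. cnj (root_of_unity (N k) j) *\<^sub>C t k j" "N k"]
      by eventually_elim (simp add: b_def rotation_average_def)
  qed
  have "AE z in circle_measure. \<forall>k. rep_linf (b k) z = rotation_average 1 (N k) (rep_linf u) z / d"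
    by (rule AE_all_countable[THEN iffD2]) (intro allI rep_b)
  with N(2) have "AE z in circle_measure. (\<lambda>k. rep_linf (b k) z) \<longlonglongrightarrow> z"
    by eventually_elim simp
  moreover have "b k \<in> A" for k unfolding b_def by (intro AD sumA tA)
  moreover have "linf_cnj (b k) \<in> A" for k
    unfolding b_def linf_cnj_scaleC cnj_sum by (intro AD sumA tA)
  ultimately show thesis using that by blast
qed

section \<open>Weak-star convex transitivity\<close>

lemma linf_comp_mobius_inverse:
  assumes m: "cmod \<zeta> = 1" "cmod \<eta> = 1" "\<bar>r\<bar> < 1"
  shows "linf_comp (linf_comp f (mobius \<zeta> \<eta> r)) (mobius (cnj \<eta>) (cnj \<zeta>) (- r)) = f"
proof (rule linf_eqI)
  have m': "cmod (cnj \<eta>) = 1" "cmod (cnj \<zeta>) = 1" "\<bar>- r\<bar> < 1" using m by auto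
  note a = disc_automorphism_mobius[OF m] and a' = disc_automorphism_mobius[OF m']
  show "AE z in circle_measure. rep_linf (linf_comp (linf_comp f (mobius \<zeta> \<eta> r)) (mobius (cnj \<eta>) (cnj \<zeta>) (- r))) z = rep_linf f z"
    using rep_linf_comp[OF a', of "linf_comp f (mobius \<zeta> \<eta> r)"]
      disc_automorphism_AE[OF a' rep_linf_comp[OF a, of f]] AE_circle_sphere
  proof eventually_elim
    case (elim z)
    then show ?case using mobius_inverse[OF m', of z] by simp
  qed
qed

lemma linf_comp_add:
  assumes "disc_automorphism \<phi>"
  shows "linf_comp (f + g) \<phi> = linf_comp f \<phi> + linf_comp g \<phi>"
  by (rule linf_eqI, use rep_linf_comp[OF assms, of "f + g"] rep_linf_comp[OF assms, of f]
      rep_linf_comp[OF assms, of g] disc_automorphism_AE[OF assms rep_linf_add[of f g]]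
      rep_linf_add[of "linf_comp f \<phi>" "linf_comp g \<phi>"] in eventually_elim) simp

lemma linf_comp_scaleC:
  assumes "disc_automorphism \<phi>"
  shows "linf_comp (c *\<^sub>C f) \<phi> = c *\<^sub>C linf_comp f \<phi>"
  by (rule linf_eqI, use rep_linf_comp[OF assms, of "c *\<^sub>C f"] rep_linf_comp[OF assms, of f]
      disc_automorphism_AE[OF assms rep_linf_scaleC[of c f]]
      rep_linf_scaleC[of c "linf_comp f \<phi>"] in eventually_elim) simp

lemma scaleC_mult_right: "f * (c *\<^sub>C g) = c *\<^sub>C (f * g)"
  using scaleC_mult_left[of c g f] by (simp only: linf_mult_commute[of f])

lemma unimodular_cnj_mult:
  assumes "unimodular \<psi>"
  shows "linf_cnj \<psi> * \<psi> = 1"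
  by (rule linf_eqI, use assms[unfolded unimodular_iff] rep_linf_mult[of "linf_cnj \<psi>" \<psi>] rep_linf_cnj[of \<psi>]
      rep_linf_1 in eventually_elim) (simp add: mult.commute[of "cnj _"] complex_norm_square[symmetric])

lemma norm_unimodular_mult:
  assumes "unimodular \<psi>"
  shows "norm (\<psi> * f) = norm f"
proof (rule antisym)
  have le: "norm (\<psi> * f) \<le> norm f" if "unimodular \<psi>" for \<psi> f
  proof (rule norm_linf_le)
    show "AE z in circle_measure. cmod (rep_linf (\<psi> * f) z) \<le> norm f"
      using that[unfolded unimodular_iff] rep_linf_mult[of \<psi> f] AE_norm_linf[of f]
      by eventually_elim (simp add: norm_mult)
  qed simp
  show "norm (\<psi> * f) \<le> norm f" by (rule le[OF assms])
  have "unimodular (linf_cnj \<psi>)"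
    using assms rep_linf_cnj[of \<psi>] unfolding unimodular_iff by eventually_elim simp
  from le[OF this, of "\<psi> * f"] show "norm f \<le> norm (\<psi> * f)"
    by (simp add: mult.assoc[symmetric] unimodular_cnj_mult[OF assms])
qed

text \<open>The inverse multiplies by \<open>linf_cnj \<psi>\<close> and then composes with the
  inverse automorphism; the conjugate weight in \<open>A\<close> makes the operator onto.\<close>

lemma weighted_composition_in_group:
  assumes A: "closed_subalgebra A"
    and inv: "\<And>f \<phi>. f \<in> A \<Longrightarrow> disc_automorphism \<phi> \<Longrightarrow> linf_comp f \<phi> \<in> A"
    and \<psi>: "\<psi> \<in> A" "linf_cnj \<psi> \<in> A" "unimodular \<psi>"
    and m: "cmod \<zeta> = 1" "cmod \<eta> = 1" "\<bar>r\<bar> < 1"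
  shows "(\<lambda>f. \<psi> * linf_comp f (mobius \<zeta> \<eta> r)) \<in> weighted_composition_group A"
proof -
  note AD = closed_subalgebraD[OF A]
  define \<phi> where "\<phi> = mobius \<zeta> \<eta> r"
  define \<phi>' where "\<phi>' = mobius (cnj \<eta>) (cnj \<zeta>) (- r)"
  have aut: "disc_automorphism \<phi>" "disc_automorphism \<phi>'"
    unfolding \<phi>_def \<phi>'_def using m by (auto intro: disc_automorphism_mobius)
  have inv1: "linf_comp (linf_comp f \<phi>) \<phi>' = f" for f
    unfolding \<phi>_def \<phi>'_def by (rule linf_comp_mobius_inverse[OF m])
  have inv2: "linf_comp (linf_comp f \<phi>') \<phi> = f" for f
    using linf_comp_mobius_inverse[of "cnj \<eta>" "cnj \<zeta>" "- r" f] m unfolding \<phi>_def \<phi>'_def by simp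
  have pp: "linf_cnj \<psi> * (\<psi> * f) = f" "\<psi> * (linf_cnj \<psi> * f) = f" for f
    using unimodular_cnj_mult[OF \<psi>(3)] linf_mult_commute[of \<psi> "linf_cnj \<psi>"]
    by (simp_all add: mult.assoc[symmetric])
  have n: "norm (linf_comp f \<phi>) = norm f" for f
    using norm_linf_comp_le[OF aut(1), of f] norm_linf_comp_le[OF aut(2), of "linf_comp f \<phi>"]
    by (simp add: inv1)
  have "bij_betw (\<lambda>f. \<psi> * linf_comp f \<phi>) A A"
  proof (rule bij_betw_byWitness[where f'="\<lambda>g. linf_comp (linf_cnj \<psi> * g) \<phi>'"])
    show "\<forall>a\<in>A. linf_comp (linf_cnj \<psi> * (\<psi> * linf_comp a \<phi>)) \<phi>' = a" by (simp add: pp inv1)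
    show "\<forall>a\<in>A. \<psi> * linf_comp (linf_comp (linf_cnj \<psi> * a) \<phi>') \<phi> = a" by (simp add: pp inv2)
    show "(\<lambda>f. \<psi> * linf_comp f \<phi>) ` A \<subseteq> A" using AD(4) \<psi>(1) inv aut by blast
    show "(\<lambda>g. linf_comp (linf_cnj \<psi> * g) \<phi>') ` A \<subseteq> A" using AD(4) \<psi>(2) inv aut by blast
  qed
  then have "(\<lambda>f. \<psi> * linf_comp f \<phi>) \<in> isometry_group A"
    unfolding isometry_group_def
    by (simp add: linf_comp_add[OF aut(1)] linf_comp_scaleC[OF aut(1)] distrib_left
        norm_unimodular_mult[OF \<psi>(3)] n scaleC_mult_right)
  then show ?thesis
    unfolding weighted_composition_group_def \<phi>_def[symmetric] using \<psi> aut(1) by blast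
qed

text \<open>The target is the unit ball of the ambient space; restriction to \<open>A\<close> comes
  afterwards. Three limits are nested, from the inside out: concentration of \<open>x\<close> at
  fixed weights (\<open>step1\<close>), approach of \<open>b k\<close> to the coordinate at fixed
  exponents (\<open>step2\<close>), and approximation of \<open>h\<close> by continuous
  exponents.\<close>

lemma weak_star_density:
  assumes A: "closed_subalgebra A" "1 \<in> A"
    and inv: "\<And>f \<phi>. f \<in> A \<Longrightarrow> disc_automorphism \<phi> \<Longrightarrow> linf_comp f \<phi> \<in> A"
    and b: "\<And>k::nat. b k \<in> A" "\<And>k. linf_cnj (b k) \<in> A" "AE z in circle_measure. (\<lambda>k. rep_linf (b k) z) \<longlonglongrightarrow> z"
    and x: "norm x = 1" and h: "norm h \<le> 1"
  shows "h \<in> linf_weak_star closure_of (convex hull {T x | T. T \<in> weighted_composition_group A})"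
proof -
  note AD = closed_subalgebraD[OF A(1)]
  let ?S = "convex hull {T x | T. T \<in> weighted_composition_group A}"
  obtain \<zeta> :: "nat \<Rightarrow> complex" and r :: "nat \<Rightarrow> real" and c :: "nat \<Rightarrow> complex"
    where m: "\<And>k. cmod (\<zeta> k) = 1" "\<And>k. \<bar>r k\<bar> < 1" and c: "\<And>k. cmod (c k) = 1"
    and lim: "AE z in circle_measure. (\<lambda>k. c k * rep_linf x (mobius (\<zeta> k) 1 (r k) z)) \<longlonglongrightarrow> 1"
    by (rule concentrating_sequence[OF x]) blast
  define \<phi> where "\<phi> k = mobius (\<zeta> k) 1 (r k)" for k
  have aut: "disc_automorphism (\<phi> k)" for k
    unfolding \<phi>_def by (rule disc_automorphism_mobius) (use m in auto)
  define y where "y k = c k *\<^sub>C linf_comp x (\<phi> k)" for k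
  have rep_y: "AE z in circle_measure. rep_linf (y k) z = c k * rep_linf x (\<phi> k z)" for k
    using rep_linf_scaleC[of "c k" "linf_comp x (\<phi> k)"] rep_linf_comp[OF aut, of x k]
    unfolding y_def by eventually_elim simp
  have "AE z in circle_measure. \<forall>k. rep_linf (y k) z = c k * rep_linf x (\<phi> k z)"
    by (rule AE_all_countable[THEN iffD2]) (intro allI rep_y)
  with lim have y_lim: "AE z in circle_measure. (\<lambda>k. rep_linf (y k) z) \<longlonglongrightarrow> 1"
    by eventually_elim (simp add: \<phi>_def)
  have y1: "norm (y k) \<le> 1" for k
  proof (rule norm_linf_le)
    show "AE z in circle_measure. cmod (rep_linf (y k) z) \<le> 1"
      using rep_y[of k] disc_automorphism_AE[OF aut AE_norm_linf[of x], of k]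
      by eventually_elim (simp add: norm_mult c x)
  qed simp
  \<comment> \<open>The constant \<open>c k\<close> that corrects the phase of \<open>x\<close> is
    absorbed into the weight.\<close>
  have orbit: "u * y k \<in> ?S" if u: "u \<in> A" "linf_cnj u \<in> A" "unimodular u" for u k
  proof -
    have "unimodular (c k *\<^sub>C u)"
      using u(3) rep_linf_scaleC[of "c k" u] unfolding unimodular_iff
      by eventually_elim (simp add: norm_mult c)
    then have "(\<lambda>f. (c k *\<^sub>C u) * linf_comp f (\<phi> k)) \<in> weighted_composition_group A"
      unfolding \<phi>_def using u m
      by (intro weighted_composition_in_group[OF A(1) inv]) (auto simp: linf_cnj_scaleC intro: AD)
    moreover have "u * y k = (c k *\<^sub>C u) * linf_comp x (\<phi> k)"
      unfolding y_def by (metis linf_mult_commute scaleC_mult_left)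
    ultimately show ?thesis
      by (intro hull_inc CollectI exI[of _ "\<lambda>f. (c k *\<^sub>C u) * linf_comp f (\<phi> k)"] conjI)
  qed
  have norm_half: "norm ((1 / 2) *\<^sub>R (u + v)) \<le> 1" if "norm u \<le> 1" "norm v \<le> 1" for u v :: linf
    using norm_triangle_ineq[of u v] that by simp
  \<comment> \<open>Since \<open>y k\<close> tends to \<open>1\<close> a.e., elements of the hull
    converge to the mean of the two weights themselves.\<close>
  have step1: "(1 / 2) *\<^sub>R (u + v) \<in> linf_weak_star closure_of ?S"
    if u: "u \<in> A" "linf_cnj u \<in> A" "unimodular u" and v: "v \<in> A" "linf_cnj v \<in> A" "unimodular v" for u v
  proof (rule weak_star_closure_AE_limit[where F="\<lambda>k. (1 / 2) *\<^sub>R (u * y k + v * y k)" and C=1])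
    fix k
    have "(1 / 2) *\<^sub>R (u * y k) + (1 / 2) *\<^sub>R (v * y k) \<in> ?S"
      by (rule convexD[OF convex_convex_hull orbit[OF u] orbit[OF v]]) auto
    then have "(1 / 2) *\<^sub>R (u * y k + v * y k) \<in> ?S" by (simp only: scaleR_add_right)
    then show "(1 / 2) *\<^sub>R (u * y k + v * y k) \<in> linf_weak_star closure_of ?S"
      using closure_of_subset[of ?S linf_weak_star] by auto
    show "norm ((1 / 2) *\<^sub>R (u * y k + v * y k)) \<le> 1"
      by (rule norm_half) (use y1 in \<open>simp_all add: norm_unimodular_mult u v\<close>)
  next
    have "AE z in circle_measure. \<forall>k. rep_linf ((1 / 2) *\<^sub>R (u * y k + v * y k)) z
        = (1 / 2) *\<^sub>R (rep_linf u z * rep_linf (y k) z + rep_linf v z * rep_linf (y k) z)"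
    proof (rule AE_all_countable[THEN iffD2], rule allI)
      fix k
      show "AE z in circle_measure. rep_linf ((1 / 2) *\<^sub>R (u * y k + v * y k)) z
        = (1 / 2) *\<^sub>R (rep_linf u z * rep_linf (y k) z + rep_linf v z * rep_linf (y k) z)"
        using rep_linf_scaleR[of "1 / 2" "u * y k + v * y k"] rep_linf_add[of "u * y k" "v * y k"]
          rep_linf_mult[of u "y k"] rep_linf_mult[of v "y k"] by eventually_elim simp
    qed
    with y_lim rep_linf_scaleR[of "1 / 2" "u + v"] rep_linf_add[of u v]
    show "AE z in circle_measure. (\<lambda>k. rep_linf ((1 / 2) *\<^sub>R (u * y k + v * y k)) z) \<longlonglongrightarrow> rep_linf ((1 / 2) *\<^sub>R (u + v)) z"
    proof eventually_elim
      case (elim z)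
      have "(\<lambda>k. (1 / 2) *\<^sub>R (rep_linf u z * rep_linf (y k) z + rep_linf v z * rep_linf (y k) z))
          \<longlonglongrightarrow> (1 / 2) *\<^sub>R (rep_linf u z * 1 + rep_linf v z * 1)"
        by (intro tendsto_intros elim(1))
      then show ?case using elim by simp
    qed
  qed
  \<comment> \<open>\<open>cis (\<alpha> z)\<close> is reached only as a limit: continuity of the
    exponents carries over the convergence of the values of \<open>b k\<close> to
    \<open>z\<close>.\<close>
  have step2: "w \<in> linf_weak_star closure_of ?S"
    if \<alpha>: "continuous_on UNIV \<alpha>" and \<beta>: "continuous_on UNIV \<beta>"
      and w: "AE z in circle_measure. rep_linf w z = (cis (\<alpha> z) + cis (\<beta> z)) / 2"
    for \<alpha> \<beta> :: "complex \<Rightarrow> real" and w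
  proof -
    have ex: "\<forall>k. \<exists>u. u \<in> A \<and> linf_cnj u \<in> A \<and> (AE z in circle_measure. rep_linf u z = cis (\<gamma> (rep_linf (b k) z)))"
      if "continuous_on UNIV \<gamma>" for \<gamma> :: "complex \<Rightarrow> real"
      by (rule allI, rule unitary_calculus[OF A b(1,2) that]) blast
    from choice[OF ex[OF \<alpha>]] obtain u where u: "\<And>k. u k \<in> A" "\<And>k. linf_cnj (u k) \<in> A"
        "\<And>k. AE z in circle_measure. rep_linf (u k) z = cis (\<alpha> (rep_linf (b k) z))"
      by auto
    from choice[OF ex[OF \<beta>]] obtain v where v: "\<And>k. v k \<in> A" "\<And>k. linf_cnj (v k) \<in> A"
        "\<And>k. AE z in circle_measure. rep_linf (v k) z = cis (\<beta> (rep_linf (b k) z))"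
      by auto
    have uni: "unimodular (u k)" "unimodular (v k)" for k
      unfolding unimodular_iff using u(3)[of k] v(3)[of k] by (eventually_elim, simp)+
    show ?thesis
    proof (rule weak_star_closure_AE_limit[where F="\<lambda>k. (1 / 2) *\<^sub>R (u k + v k)" and C=1])
      show "(1 / 2) *\<^sub>R (u k + v k) \<in> linf_weak_star closure_of ?S" for k
        by (rule step1[OF u(1,2) uni(1) v(1,2) uni(2)])
      show "norm ((1 / 2) *\<^sub>R (u k + v k)) \<le> 1" for k
        using norm_unimodular_mult[OF uni(1)[of k], of 1] norm_unimodular_mult[OF uni(2)[of k], of 1]
        by (intro norm_half) auto
      have "AE z in circle_measure. \<forall>k. rep_linf ((1 / 2) *\<^sub>R (u k + v k)) z =
          (cis (\<alpha> (rep_linf (b k) z)) + cis (\<beta> (rep_linf (b k) z))) / 2"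
      proof (rule AE_all_countable[THEN iffD2], rule allI)
        fix k
        show "AE z in circle_measure. rep_linf ((1 / 2) *\<^sub>R (u k + v k)) z =
          (cis (\<alpha> (rep_linf (b k) z)) + cis (\<beta> (rep_linf (b k) z))) / 2"
          using rep_linf_scaleR[of "1 / 2" "u k + v k"] rep_linf_add[of "u k" "v k"] u(3)[of k] v(3)[of k]
          by eventually_elim (simp add: scaleR_conv_of_real)
      qed
      with b(3) w show "AE z in circle_measure. (\<lambda>k. rep_linf ((1 / 2) *\<^sub>R (u k + v k)) z) \<longlonglongrightarrow> rep_linf w z"
      proof eventually_elim
        case (elim z)
        have "(\<lambda>k. \<alpha> (rep_linf (b k) z)) \<longlonglongrightarrow> \<alpha> z" "(\<lambda>k. \<beta> (rep_linf (b k) z)) \<longlonglongrightarrow> \<beta> z"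
          using continuous_on_tendsto_compose[OF \<alpha> elim(1)] continuous_on_tendsto_compose[OF \<beta> elim(1)] by auto
        then have "(\<lambda>k. (cis (\<alpha> (rep_linf (b k) z)) + cis (\<beta> (rep_linf (b k) z))) / 2) \<longlonglongrightarrow> (cis (\<alpha> z) + cis (\<beta> z)) / 2"
          by (intro tendsto_intros) auto
        then show ?case by (simp only: elim(2) elim(3)[rule_format])
      qed
    qed
  qed
  have hb: "AE z in circle_measure. cmod (rep_linf h z) \<le> 1"
    using AE_norm_linf[of h] by eventually_elim (use h in simp)
  obtain \<alpha> \<beta> :: "nat \<Rightarrow> complex \<Rightarrow> real" where
    ab: "\<And>n. continuous_on UNIV (\<alpha> n)" "\<And>n. continuous_on UNIV (\<beta> n)"
      "AE z in circle_measure. (\<lambda>n. (cis (\<alpha> n z) + cis (\<beta> n z)) / 2) \<longlonglongrightarrow> rep_linf h z"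
    by (rule circle_unit_approx[OF measurable_rep_linf hb]) blast
  define w where "w n = abs_linf (\<lambda>z. (cis (\<alpha> n z) + cis (\<beta> n z)) / 2)" for n
  have cb: "cmod ((cis s + cis t) / 2) \<le> 1" for s t
    using norm_triangle_ineq[of "cis s" "cis t"] by (simp add: norm_divide)
  have rep_w: "AE z in circle_measure. rep_linf (w n) z = (cis (\<alpha> n z) + cis (\<beta> n z)) / 2" for n
    unfolding w_def
  proof (rule rep_abs_linf, rule ess_boundedI)
    show "(\<lambda>z. (cis (\<alpha> n z) + cis (\<beta> n z)) / 2) \<in> borel_measurable circle_measure"
      by (rule measurable_circle_continuous, rule continuous_on_subset[of UNIV])
         (auto intro!: continuous_intros ab)
    show "AE z in circle_measure. cmod ((cis (\<alpha> n z) + cis (\<beta> n z)) / 2) \<le> 1"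
      by (rule AE_I2) (rule cb)
  qed
  show ?thesis
  proof (rule weak_star_closure_AE_limit[where F=w and C=1])
    show "w n \<in> linf_weak_star closure_of ?S" for n
      by (rule step2[OF ab(1,2) rep_w])
    show "norm (w n) \<le> 1" for n
    proof (rule norm_linf_le)
      show "AE z in circle_measure. cmod (rep_linf (w n) z) \<le> 1"
        using rep_w[of n] by eventually_elim (simp only: cb)
    qed simp
    have "AE z in circle_measure. \<forall>n. rep_linf (w n) z = (cis (\<alpha> n z) + cis (\<beta> n z)) / 2"
      by (rule AE_all_countable[THEN iffD2]) (intro allI rep_w)
    with ab(3) show "AE z in circle_measure. (\<lambda>n. rep_linf (w n) z) \<longlonglongrightarrow> rep_linf h z"
      by eventually_elim (simp only:)
  qed
qed

section \<open>Orbit closures and the equivalence\<close>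

lemma convex_closed_subalgebra:
  assumes "closed_subalgebra A"
  shows "convex A"
proof (rule convexI)
  fix x y :: linf and a b :: real assume "x \<in> A" "y \<in> A"
  then have "of_real a *\<^sub>C x + of_real b *\<^sub>C y \<in> A"
    by (intro closed_subalgebraD[OF assms])
  then show "a *\<^sub>R x + b *\<^sub>R y \<in> A" by (simp only: scaleC_of_real)
qed

lemma orbit_hull_subset:
  assumes A: "closed_subalgebra A" and x: "x \<in> A \<inter> sphere 0 1" and G: "G \<subseteq> isometry_group A"
  shows "convex hull {T x | T. T \<in> G} \<subseteq> A \<inter> cball 0 1"
proof (rule hull_minimal)
  show "{T x | T. T \<in> G} \<subseteq> A \<inter> cball 0 1"
    using x G by (force simp: isometry_group_def bij_betw_def)
  show "convex (A \<inter> cball 0 1)"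
    by (intro convex_Int convex_closed_subalgebra A convex_cball)
qed

text \<open>The closure within \<open>A\<close> is contained in the ambient closure, and the ambient
  unit ball is weak-star closed.\<close>

lemma orbit_closure_subset:
  assumes A: "closed_subalgebra A" and x: "x \<in> A \<inter> sphere 0 1" and G: "G \<subseteq> isometry_group A"
  shows "subtopology linf_weak_star A closure_of (convex hull {T x | T. T \<in> G}) \<subseteq> A \<inter> cball 0 1"
proof
  fix f assume "f \<in> subtopology linf_weak_star A closure_of (convex hull {T x | T. T \<in> G})"
  then have f: "f \<in> A" "f \<in> linf_weak_star closure_of (A \<inter> convex hull {T x | T. T \<in> G})"
    by (auto simp: closure_of_subtopology)
  have "A \<inter> convex hull {T x | T. T \<in> G} \<subseteq> cball 0 1"
    using orbit_hull_subset[OF assms] by blast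
  from cball_weak_star_closed[OF this f(2)] show "f \<in> A \<inter> cball 0 1" using f(1) by simp
qed

lemma weighted_subset_isometry: "weighted_composition_group A \<subseteq> isometry_group A"
  by (auto simp: weighted_composition_group_def)

lemma weighted_transitive_imp_transitive:
  assumes A: "closed_subalgebra A" and tr: "weak_star_convex_transitive_wrt (weighted_composition_group A) A"
  shows "weak_star_convex_transitive A"
  unfolding weak_star_convex_transitive_def weak_star_convex_transitive_wrt_def
proof (intro ballI antisym)
  fix x assume x: "x \<in> A \<inter> sphere 0 1"
  show "subtopology linf_weak_star A closure_of (convex hull {T x | T. T \<in> isometry_group A}) \<subseteq> A \<inter> cball 0 1"
    by (rule orbit_closure_subset[OF A x order_refl])
  have "{T x | T. T \<in> weighted_composition_group A} \<subseteq> {T x | T. T \<in> isometry_group A}"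
    using weighted_subset_isometry by blast
  then have "subtopology linf_weak_star A closure_of (convex hull {T x | T. T \<in> weighted_composition_group A})
      \<subseteq> subtopology linf_weak_star A closure_of (convex hull {T x | T. T \<in> isometry_group A})"
    by (intro closure_of_mono hull_mono)
  then show "A \<inter> cball 0 1 \<subseteq> subtopology linf_weak_star A closure_of (convex hull {T x | T. T \<in> isometry_group A})"
    using tr x unfolding weak_star_convex_transitive_wrt_def by blast
qed

lemma closed_subalgebra_hull: "closed_subalgebra (closed_subalgebra hull S)"
  by (rule hull_in) (auto simp: closed_subalgebra_def)

text \<open>If the conjugates of all members of \<open>Q\<close> lay in \<open>Hinf\<close>, the
  generators would lie in \<open>Hinf\<close>, which is already a closed algebra.\<close>

lemma douglas_algebra_nonanalytic:
  assumes A: "douglas_algebra A" "A \<noteq> Hinf"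
  obtains q where "q \<in> Hinf" "linf_cnj q \<in> A" "linf_cnj q \<notin> Hinf"
proof -
  obtain Q where Q: "Q \<subseteq> inner_functions" "A = closed_subalgebra hull (Hinf \<union> linf_cnj ` Q)"
    using A(1) by (auto simp: douglas_algebra_def)
  have "\<not> linf_cnj ` Q \<subseteq> Hinf"
  proof
    assume "linf_cnj ` Q \<subseteq> Hinf"
    then have "A = closed_subalgebra hull Hinf" using Q(2) by (simp add: Un_absorb2)
    also have "\<dots> = Hinf" by (rule hull_same[of closed_subalgebra, OF Hinf_closed_subalgebra])
    finally show False using A(2) by simp
  qed
  then obtain q where q: "q \<in> Q" "linf_cnj q \<notin> Hinf" by blast
  have "linf_cnj q \<in> A" unfolding Q(2) by (rule hull_inc) (use q(1) in simp)
  moreover have "q \<in> Hinf" using q(1) Q(1) unfolding inner_functions_def by blast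
  ultimately show thesis using q(2) by (intro that)
qed

text \<open>A vanishing derivative makes \<open>F\<close>, hence \<open>q\<close>, constant, and the
  conjugate of a constant is in \<open>Hinf\<close>.\<close>

lemma nonconstant_derivative:
  assumes F: "F holomorphic_on ball 0 1" "radial_boundary_value F q" and q: "linf_cnj q \<notin> Hinf"
  obtains a where "a \<in> ball 0 1" "deriv F a \<noteq> 0"
proof -
  have "\<exists>a\<in>ball 0 1. deriv F a \<noteq> 0"
  proof (rule ccontr)
    assume "\<not> ?thesis"
    then have "(F has_field_derivative 0) (at z within ball 0 1)" if "z \<in> ball 0 1" for z
      using that has_field_derivative_at_within[OF holomorphic_derivI[OF F(1) open_ball that]] by simp
    then obtain c where c: "\<And>z. z \<in> ball 0 1 \<Longrightarrow> F z = c"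
      using has_field_derivative_zero_constant[of "ball 0 1" F] by auto
    have qc: "AE z in circle_measure. rep_linf q z = c"
      using F(2)[unfolded radial_boundary_value_iff] AE_circle_sphere
    proof eventually_elim
      case (elim z)
      have "\<forall>\<^sub>F r in at_left (1::real). r \<in> {0<..<1}" by (rule eventually_at_left_real) simp
      then have "\<forall>\<^sub>F r in at_left 1. F (of_real r * z) = c"
        by eventually_elim (use elim(2) in \<open>auto intro!: c simp: norm_mult\<close>)
      then have "((\<lambda>r. F (of_real r * z)) \<longlongrightarrow> c) (at_left 1)" by (rule tendsto_eventually)
      then show ?case using elim(1) tendsto_unique[of "at_left (1::real)"] by (metis trivial_limit_at_left_real)
    qed
    then have "linf_cnj q = cnj c *\<^sub>C 1"
      by (intro linf_eqI, use qc rep_linf_cnj[of q] rep_linf_scaleC[of "cnj c" 1] rep_linf_1 in eventually_elim) simp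
    then show False using q closed_subalgebraD(5)[OF Hinf_closed_subalgebra one_in_Hinf] by simp
  qed
  then show thesis using that by blast
qed

theorem theorem4p1:
  fixes A :: "linf set"
  assumes "douglas_algebra A"
    and "\<And>f \<phi>. f \<in> A \<Longrightarrow> disc_automorphism \<phi> \<Longrightarrow> linf_comp f \<phi> \<in> A"
  shows "(A \<noteq> Hinf \<longleftrightarrow> weak_star_convex_transitive A) \<and>
         (weak_star_convex_transitive A \<longleftrightarrow>
            weak_star_convex_transitive_wrt (weighted_composition_group A) A)"
proof -
  obtain Q where Q: "A = closed_subalgebra hull (Hinf \<union> linf_cnj ` Q)"
    using assms(1) by (auto simp: douglas_algebra_def)
  have A: "closed_subalgebra A" unfolding Q by (rule closed_subalgebra_hull)
  have HA: "Hinf \<subseteq> A"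
    using hull_subset[of "Hinf \<union> linf_cnj ` Q" closed_subalgebra] unfolding Q by simp
  \<comment> \<open>The equivalence is closed as a cycle: \<open>A \<noteq> Hinf\<close> gives
    transitivity for the weighted group, this gives it for all isometries, and that excludes
    \<open>Hinf\<close>.\<close>
  have "weak_star_convex_transitive_wrt (weighted_composition_group A) A" if ne: "A \<noteq> Hinf"
    unfolding weak_star_convex_transitive_wrt_def
  proof (intro ballI antisym)
    fix x assume x: "x \<in> A \<inter> sphere 0 1"
    obtain q where q: "q \<in> Hinf" "linf_cnj q \<in> A" "linf_cnj q \<notin> Hinf"
      using douglas_algebra_nonanalytic[OF assms(1) ne] .
    obtain F where F: "F holomorphic_on ball 0 1" "bounded (F ` ball 0 1)" "radial_boundary_value F q"
      using q(1) by (auto simp: Hinf_def)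
    obtain a where a: "a \<in> ball 0 1" "deriv F a \<noteq> 0"
      using nonconstant_derivative[OF F(1,3) q(3)] .
    obtain b :: "nat \<Rightarrow> linf" where b: "\<And>k. b k \<in> A" "\<And>k. linf_cnj (b k) \<in> A"
        "AE z in circle_measure. (\<lambda>k. rep_linf (b k) z) \<longlonglongrightarrow> z"
      using coordinate_approximation[OF A assms(2) _ q(2) F a] q(1) HA by blast
    let ?S = "convex hull {T x | T. T \<in> weighted_composition_group A}"
    show "subtopology linf_weak_star A closure_of ?S \<subseteq> A \<inter> cball 0 1"
      by (rule orbit_closure_subset[OF A x weighted_subset_isometry])
    have "A \<inter> ?S = ?S" using orbit_hull_subset[OF A x weighted_subset_isometry] by blast
    moreover have "h \<in> linf_weak_star closure_of ?S" if "h \<in> cball 0 1" for h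
      by (rule weak_star_density[OF A _ assms(2) b]) (use one_in_Hinf HA x that in auto)
    ultimately show "A \<inter> cball 0 1 \<subseteq> subtopology linf_weak_star A closure_of ?S"
      by (auto simp: closure_of_subtopology)
  qed
  moreover have "weak_star_convex_transitive A"
    if "weak_star_convex_transitive_wrt (weighted_composition_group A) A"
    using weighted_transitive_imp_transitive[OF A that] .
  moreover have "A \<noteq> Hinf" if "weak_star_convex_transitive A"
    using that Hinf_not_weak_star_convex_transitive by blast
  ultimately show ?thesis by blast
qed

end
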